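(* Let $p\neq \ell$ be primes, $K$ a finite extension of $\mathbb{Q}_\ell$, and $\mathscr{O}$ an integral domain containing $\mathbb{Q}$. Let $(r,N):W_K\to \mathrm{GL}_n(\mathscr{O})$ be a Weil-Deligne representation of $W_K$ with coefficients in $\mathscr{O}$. If $f:\mathscr{O}\to\overline{\mathbb{Q}}_p$ is a ring homomorphism such that the Weil-Deligne representation $f\circ(r,N)$ (over $\overline{\mathbb{Q}}_p$) is pure, then the conductor of $f\circ(r,N)$ equals the conductor of $(r,N)\otimes_{\mathscr{O}}\overline{Q}(\mathscr{O})$, where $\overline{Q}(\mathscr{O})$ is an algebraic closure of the fraction field of $\mathscr{O}$.
   Context: Let $q$ be the cardinality of the residue field of $K$, $G_K=\mathrm{Gal}(\overline K/K)$, $I_K$ its inertia subgroup, $\{G_K^u\}_{u\ge -1}$ the upper numbering ramification filtration. Fix $\phi\in G_K$ lifting the geometric Frobenius $\mathrm{Fr}_k$ of the residue field $k$. The Weil group $W_K$ is the subgroup of $G_K$ of elements mapping to an integral power of $\mathrm{Fr}_k$, topologized so that $I_K$ is open with its subspace topology from $G_K$; $v_K:W_K\to\mathbb{Z}$ is defined by $\sigma|_{K^{ur}}=\mathrm{Fr}_k^{v_K(\sigma)}$. For a commutative domain $A$ of characteristic zero, a Weil-Deligne representation of $W_K$ on a free $A$-module $M$ of finite rank is a pair $(r,N)$ with $r:W_K\to\mathrm{Aut}_A(M)$ a homomorphism with open kernel and $N\in\mathrm{End}_A(M)$ nilpotent such that $r(\sigma)Nr(\sigma)^{-1}=q^{-v_K(\sigma)}N$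 for all $\sigma\in W_K$. For a ring map $f:A\to B$, $f\circ(r,N)$ denotes the Weil-Deligne representation obtained by applying $f$ to matrix entries, and $(r,N)\otimes_A L$ is the base change to a field $L\supseteq A$. The conductor of a Weil-Deligne representation $(r,V,N)$ over an algebraically closed field of characteristic zero is $\mathrm{codim}\, V^{I_K,N=0}+\int_0^\infty \mathrm{codim}\,V^{G_K^u}\,du$, where $V^{I_K,N=0}$ is the subspace on which $I_K$ acts trivially and $N$ vanishes. A Weil-Deligne representation $(r,V,N)$ over $\overline{\mathbb{Q}}_p$ is pure of weight $w\in\mathbb{Z}$ if every eigenvalue $\alpha$ of $r(\phi)$ is algebraic over $\mathbb{Q}$ and there is an integer $k$ (the weight of $\alpha$) with $|\iota(\alpha)|^2=q^{k}$ for every embedding $\iota:\mathbb{Q}(\alpha)\to\mathbb{C}$, and, writing $V_k$ for the sum of generalized eigenspaces of $r(\phi)$ for eigenvalues of weight $k$, the map $N^i:V_{w+i}\to V_{w-i}$ is an isomorphism for every $i\ge 0$; it is pure if it is pure of some weight. *)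

theory Defs
  imports
    "HOL-Analysis.Analysis"
    "HOL-Algebra.Algebraic_Closure_Type"
    "HOL-Algebra.Generated_Fields"
begin

abbreviation type_ring :: "'a::ring_1 ring"
  where "type_ring \<equiv> ring_of_type_algebra"

abbreviation sub_ring :: "'a::ring_1 set \<Rightarrow> 'a ring"
  where "sub_ring L \<equiv> type_ring\<lparr>carrier := L\<rparr>"


section \<open>\<open>p\<close>-adic fields and their finite extensions\<close>

definition nonarch_abs :: "('a::field \<Rightarrow> real) \<Rightarrow> bool"
  where "nonarch_abs v \<longleftrightarrow>
    (\<forall>x. 0 \<le> v x) \<and> (\<forall>x. v x = 0 \<longleftrightarrow> x = 0) \<and>
    (\<forall>x y. v (x * y) = v x * v y) \<and> (\<forall>x y. v (x + y) \<le> max (v x) (v y))"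

definition padic_abs_rat :: "nat \<Rightarrow> rat \<Rightarrow> real"
  where "padic_abs_rat p x = (if x = 0 then 0 else
    real p powi (int (multiplicity (int p) (snd (quotient_of x)))
               - int (multiplicity (int p) (fst (quotient_of x)))))"

text \<open>
  \<open>padic_field p v\<close>: the field \<^typ>\<open>'a\<close> with the absolute value \<open>v\<close> is the completion of
  \<open>\<rat>\<close> for the \<open>p\<close>-adic absolute value. This determines the pair up to unique isomorphism.
\<close>

definition padic_field :: "nat \<Rightarrow> ('a::field_char_0 \<Rightarrow> real) \<Rightarrow> bool"
  where "padic_field p v \<longleftrightarrow>
    nonarch_abs v \<and>
    (\<forall>r. v (of_rat r) = padic_abs_rat p r) \<and>
    (\<forall>x. \<forall>e>0. \<exists>r. v (x - of_rat r) < e) \<and>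
    (\<forall>s. (\<forall>e>0. \<exists>M. \<forall>m\<ge>M. \<forall>n\<ge>M::nat. v (s m - s n) < e) \<longrightarrow>
       (\<exists>x. \<forall>e>0. \<exists>M. \<forall>n\<ge>M. v (s n - x) < e))"

definition finite_extension :: "('a::field \<Rightarrow> 'b::field) \<Rightarrow> bool"
  where "finite_extension j \<longleftrightarrow>
    j \<in> ring_hom type_ring type_ring \<and>
    (\<exists>B. finite B \<and> Modules.module.span (\<lambda>a x. j a * x) B = UNIV)"

text \<open>
  From here on \<^typ>\<open>'k\<close> is the local field \<open>K\<close>, the type \<^typ>\<open>'k alg_closure\<close> is its
  algebraic closure, and \<open>v\<close> is the absolute value of the latter; any positive power of
  \<open>v\<close> would give the same notions.
\<close>

definition residue_card :: "('k::field alg_closure \<Rightarrow> real) \<Rightarrow> nat"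
  where "residue_card v =
    card ({x. v (to_ac x) \<le> 1} //
      {(x, y). v (to_ac x) \<le> 1 \<and> v (to_ac y) \<le> 1 \<and> v (to_ac (x - y)) < 1})"


section \<open>Galois groups and the ramification filtration\<close>

text \<open>
  Automorphisms over \<open>K\<close> of an intermediate field \<open>L\<close>, extended by \<^const>\<open>undefined\<close>
  outside \<open>L\<close>.
\<close>

definition Gal :: "'k::field alg_closure set \<Rightarrow> ('k alg_closure \<Rightarrow> 'k alg_closure) set"
  where "Gal L = {\<tau> \<in> extensional L.
    \<tau> \<in> ring_iso (sub_ring L) (sub_ring L) \<and> (\<forall>a. \<tau> (to_ac a) = to_ac a)}"

abbreviation abs_Gal :: "('k::field alg_closure \<Rightarrow> 'k alg_closure) set"
  where "abs_Gal \<equiv> Gal UNIV"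

definition finite_intermediate :: "'k::field alg_closure set \<Rightarrow> bool"
  where "finite_intermediate L \<longleftrightarrow>
    subfield L type_ring \<and> range to_ac \<subseteq> L \<and>
    (\<exists>B. finite B \<and> Modules.module.span (\<lambda>a x. to_ac a * x) B = L)"

text \<open>Separability is automatic in characteristic zero, so only normality is required.\<close>

definition finite_Galois :: "'k::field alg_closure set \<Rightarrow> bool"
  where "finite_Galois L \<longleftrightarrow> finite_intermediate L \<and> (\<forall>\<sigma>\<in>abs_Gal. \<sigma> ` L \<subseteq> L)"

definition uniformizer_abs :: "('k::field alg_closure \<Rightarrow> real) \<Rightarrow> 'k alg_closure set \<Rightarrow> real"
  where "uniformizer_abs v L = Sup {v x |x. x \<in> L \<and> v x < 1}"

text \<open>
  Lower numbering: \<open>\<tau> \<in> G\<^sub>s\<close> iff \<open>v\<^sub>L(\<tau> x - x) \<ge> s + 1\<close> for all integral \<open>x \<in> L\<close>, where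
  \<open>v\<^sub>L\<close> is the normalized valuation of \<open>L\<close>, i.e. \<open>v x\<close> is \<open>uniformizer_abs v L\<close> to the
  power \<open>v\<^sub>L(x)\<close>.
\<close>

definition ram_lower ::
    "('k::field alg_closure \<Rightarrow> real) \<Rightarrow> 'k alg_closure set \<Rightarrow> real \<Rightarrow> ('k alg_closure \<Rightarrow> 'k alg_closure) set"
  where "ram_lower v L s =
    {\<tau> \<in> Gal L. \<forall>x\<in>L. v x \<le> 1 \<longrightarrow> v (\<tau> x - x) \<le> uniformizer_abs v L powr (s + 1)}"

text \<open>
  The Herbrand function: the integral from \<open>0\<close> to \<open>s\<close> of \<open>1 / (G\<^sub>0 : G\<^sub>t)\<close>. The integrand is
  \<open>1\<close> for \<open>-1 < t \<le> 0\<close>.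
\<close>

definition herbrand :: "('k::field alg_closure \<Rightarrow> real) \<Rightarrow> 'k alg_closure set \<Rightarrow> real \<Rightarrow> real"
  where "herbrand v L s = (if s \<le> 0 then s else
    integral {0..s} (\<lambda>t. real (card (ram_lower v L t)) / real (card (ram_lower v L 0))))"

definition ram_upper ::
    "('k::field alg_closure \<Rightarrow> real) \<Rightarrow> 'k alg_closure set \<Rightarrow> real \<Rightarrow> ('k alg_closure \<Rightarrow> 'k alg_closure) set"
  where "ram_upper v L u = ram_lower v L (inv_into {-1..} (herbrand v L) u)"

definition abs_ram_upper ::
    "('k::field alg_closure \<Rightarrow> real) \<Rightarrow> real \<Rightarrow> ('k alg_closure \<Rightarrow> 'k alg_closure) set"
  where "abs_ram_upper v u =
    {\<sigma> \<in> abs_Gal. \<forall>L. finite_Galois L \<longrightarrow> restrict \<sigma> L \<in> ram_upper v L u}"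


section \<open>The Weil group\<close>

definition inertia :: "('k::field alg_closure \<Rightarrow> real) \<Rightarrow> ('k alg_closure \<Rightarrow> 'k alg_closure) set"
  where "inertia v = {\<sigma> \<in> abs_Gal. \<forall>x. v x \<le> 1 \<longrightarrow> v (\<sigma> x - x) < 1}"

text \<open>
  \<open>acts_as_frob v \<sigma> n\<close>: on the residue field of the algebraic closure, \<open>\<sigma>\<close> induces the
  \<open>n\<close>-th power of the geometric Frobenius, i.e. of the inverse of \<open>x \<mapsto> x\<^sup>q\<close>.
\<close>

definition acts_as_frob ::
    "('k::field alg_closure \<Rightarrow> real) \<Rightarrow> ('k alg_closure \<Rightarrow> 'k alg_closure) \<Rightarrow> int \<Rightarrow> bool"
  where "acts_as_frob v \<sigma> n \<longleftrightarrow> (\<forall>x. v x \<le> 1 \<longrightarrow>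
    (if n \<ge> 0 then v (\<sigma> x ^ (residue_card v ^ nat n) - x) < 1
     else v (\<sigma> x - x ^ (residue_card v ^ nat (- n))) < 1))"

definition weil_group :: "('k::field alg_closure \<Rightarrow> real) \<Rightarrow> ('k alg_closure \<Rightarrow> 'k alg_closure) set"
  where "weil_group v = {\<sigma> \<in> abs_Gal. \<exists>n. acts_as_frob v \<sigma> n}"

definition weil_deg :: "('k::field alg_closure \<Rightarrow> real) \<Rightarrow> ('k alg_closure \<Rightarrow> 'k alg_closure) \<Rightarrow> int"
  where "weil_deg v \<sigma> = (THE n. acts_as_frob v \<sigma> n)"

text \<open>The Krull topology: generated by the cosets of the groups of the finite extensions of \<open>K\<close>.\<close>

definition krull_topology :: "('k::field alg_closure \<Rightarrow> 'k alg_closure) topology"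
  where "krull_topology = topology_generated_by
    {{\<tau> \<in> abs_Gal. \<forall>x\<in>L. \<tau> x = \<sigma> x} |L \<sigma>. finite_intermediate L \<and> \<sigma> \<in> abs_Gal}"

text \<open>The group topology in which \<open>I\<^sub>K\<close>, with its topology from \<open>G\<^sub>K\<close>, is an open subgroup.\<close>

definition weil_topology ::
    "('k::field alg_closure \<Rightarrow> real) \<Rightarrow> ('k alg_closure \<Rightarrow> 'k alg_closure) topology"
  where "weil_topology v = topology_generated_by
    {(\<lambda>\<tau>. \<sigma> \<circ> \<tau>) ` U |\<sigma> U. \<sigma> \<in> weil_group v \<and>
       openin (subtopology krull_topology (inertia v)) U}"


section \<open>Weil-Deligne representations\<close>

text \<open>Representations on \<open>A\<^sup>n\<close>, as pairs \<open>(r, N)\<close> of matrices; only \<open>r\<close> on the Weil group matters.\<close>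

type_synonym ('k, 'a, 'n) wd =
  "(('k alg_closure \<Rightarrow> 'k alg_closure) \<Rightarrow> 'a ^ 'n ^ 'n) \<times> ('a ^ 'n ^ 'n)"

text \<open>The factor \<open>q\<close> to the power \<open>-v\<^sub>K(\<sigma>)\<close> need not lie in \<open>A\<close>, so we compare in the fraction field.\<close>

definition weil_deligne ::
    "('k::field alg_closure \<Rightarrow> real) \<Rightarrow> ('k, 'a::{idom, ring_char_0}, 'n::finite) wd \<Rightarrow> bool"
  where "weil_deligne v = (\<lambda>(r, N).
    (\<forall>\<sigma>\<in>weil_group v. invertible (r \<sigma>)) \<and>
    (\<forall>\<sigma>\<in>weil_group v. \<forall>\<tau>\<in>weil_group v. r (\<sigma> \<circ> \<tau>) = r \<sigma> ** r \<tau>) \<and>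
    openin (weil_topology v) {\<sigma> \<in> weil_group v. r \<sigma> = mat 1} \<and>
    (\<exists>m. ((\<lambda>A. N ** A) ^^ m) (mat 1) = 0) \<and>
    (\<forall>\<sigma>\<in>weil_group v.
       map_matrix to_fract (r \<sigma> ** N ** matrix_inv (r \<sigma>)) =
       map_matrix (\<lambda>x. of_nat (residue_card v) powi (- weil_deg v \<sigma>) * to_fract x) N))"

definition wd_map :: "('a \<Rightarrow> 'b) \<Rightarrow> ('k, 'a, 'n::finite) wd \<Rightarrow> ('k, 'b, 'n) wd"
  where "wd_map f = (\<lambda>(r, N). (\<lambda>\<sigma>. map_matrix f (r \<sigma>), map_matrix f N))"

definition fixed_space ::
    "('g \<Rightarrow> 'a::field ^ 'n ^ 'n::finite) \<Rightarrow> 'g set \<Rightarrow> ('a ^ 'n) set"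
  where "fixed_space r S = {x. \<forall>\<sigma>\<in>S. r \<sigma> *v x = x}"

definition codim :: "('a::field ^ 'n::finite) set \<Rightarrow> nat"
  where "codim W = CARD('n) - vec.dim W"

definition conductor ::
    "('k::field alg_closure \<Rightarrow> real) \<Rightarrow> ('k, 'a::alg_closed_field, 'n::finite) wd \<Rightarrow> real"
  where "conductor v = (\<lambda>(r, N).
    real (codim {x \<in> fixed_space r (inertia v). N *v x = 0}) +
    integral {0..} (\<lambda>u. real (codim (fixed_space r (abs_ram_upper v u)))))"


section \<open>Purity\<close>

definition is_eigenvalue :: "'a::field ^ 'n ^ 'n::finite \<Rightarrow> 'a \<Rightarrow> bool"
  where "is_eigenvalue A \<alpha> \<longleftrightarrow> (\<exists>x. x \<noteq> 0 \<and> A *v x = \<alpha> *s x)"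

definition gen_eigenspace :: "'a::field ^ 'n ^ 'n::finite \<Rightarrow> 'a \<Rightarrow> ('a ^ 'n) set"
  where "gen_eigenspace A \<alpha> = {x. \<exists>m. ((\<lambda>y. A *v y - \<alpha> *s y) ^^ m) x = 0}"

definition has_weight :: "nat \<Rightarrow> 'a::field_char_0 \<Rightarrow> int \<Rightarrow> bool"
  where "has_weight q \<alpha> k \<longleftrightarrow>
    (\<forall>\<iota> \<in> ring_hom (sub_ring (generate_field type_ring {\<alpha>})) (type_ring :: complex ring).
       (cmod (\<iota> \<alpha>))\<^sup>2 = real q powi k)"

definition weight_space ::
    "nat \<Rightarrow> 'a::field_char_0 ^ 'n ^ 'n::finite \<Rightarrow> int \<Rightarrow> ('a ^ 'n) set"
  where "weight_space q A k =
    vec.span (\<Union>\<alpha>\<in>{\<alpha>. is_eigenvalue A \<alpha> \<and> has_weight q \<alpha> k}. gen_eigenspace A \<alpha>)"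

definition pure_of_weight ::
    "('k::field alg_closure \<Rightarrow> real) \<Rightarrow> ('k alg_closure \<Rightarrow> 'k alg_closure) \<Rightarrow>
     ('k, 'a::field_char_0, 'n::finite) wd \<Rightarrow> int \<Rightarrow> bool"
  where "pure_of_weight v \<phi> = (\<lambda>(r, N) w.
    (\<forall>\<alpha>. is_eigenvalue (r \<phi>) \<alpha> \<longrightarrow>
       Polynomial.algebraic \<alpha> \<and> (\<exists>k. has_weight (residue_card v) \<alpha> k)) \<and>
    (\<forall>i::nat. bij_betw ((\<lambda>x. N *v x) ^^ i)
       (weight_space (residue_card v) (r \<phi>) (w + int i))
       (weight_space (residue_card v) (r \<phi>) (w - int i))))"

definition wd_pure ::
    "('k::field alg_closure \<Rightarrow> real) \<Rightarrow> ('k alg_closure \<Rightarrow> 'k alg_closure) \<Rightarrow>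
     ('k, 'a::field_char_0, 'n::finite) wd \<Rightarrow> bool"
  where "wd_pure v \<phi> \<rho> \<longleftrightarrow> (\<exists>w. pure_of_weight v \<phi> \<rho> w)"

end

theory Submission
  imports Defs
begin

text \<open>
  The image of inertia is finite, and so is that of \<open>G\<^sub>K\<^sup>u\<close> for \<open>u \<ge> 0\<close>, a subset of inertia.
  The fixed space of a finite matrix group is the kernel of \<open>m - E\<close> for the sum \<open>E\<close> of its
  \<open>m\<close> elements. Kernels can only grow under specialization, and those of \<open>E\<close> and \<open>m - E\<close> are
  complementary, so the dimensions of all the fixed spaces involved are preserved.

  For the monodromy operator, extend the specialization to the eigenvalues of Frobenius; this gives
  weights to the generic eigenvalues. \<open>N\<close> lowers weights by \<open>2\<close>, so the kernel of \<open>N\<close> on the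
  inertia invariants has dimension at least \<open>d(w + 1) - d(w - 1)\<close>, where \<open>d(k)\<close> is the
  dimension of the part of weights at most \<open>k\<close>. Purity makes this an equality after specialization,
  where the kernel is at least as large as before.
\<close>

hide_const (open) up_ring.coeff up_ring.monom Polynomials.lead_coeff Polynomials.degree
no_notation Formal_Power_Series.fps_nth (infixl \<open>$\<close> 75)

section \<open>Kernels of families of linear forms\<close>

text \<open>That the d(k) survive specialization is again a matter of complements: neither the part
  for a set of eigenvalues nor the part for the other eigenvalues can shrink, and the two dimensions
  have a fixed sum. The kernel of \<open>N\<close> has no such partner and is squeezed by weights
  instead. The thresholds are w + 1 and w - 1 because purity makes \<open>N\<close> injective on
  weights above w + 1 and puts all weights at most w - 1 into its image. Two obstacles shape the
  algebra. Generic eigenvalues need not lie in the coefficient ring, so homomorphisms live on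
  subrings of a field, which can be enlarged. And \<open>f\<close> may have a kernel, so nothing
  with denominators can be specialized: E / m and Bezout coefficients stay on one side, and only
  matrices and polynomials with coefficients in the subring cross over. The inclusion of the
  ramification groups in inertia needs the valuation on finite extensions to be discrete, so that
  \<open>uniformizer_abs\<close> is below 1, and the Herbrand function to reach u, so that
  \<open>inv_into\<close> in the upper numbering has a meaning.\<close>

lemma dim_kernel_image:
  fixes A :: "'a::field^'n^'m"
  assumes U: "vec.subspace U"
  shows "vec.dim U = vec.dim {x \<in> U. A *v x = 0} + vec.dim ((*v) A ` U)"
proof -
  define K where "K = {x \<in> U. A *v x = 0}"
  have K: "vec.subspace K"
    using U by (auto simp: K_def vec.subspace_def matrix_vector_right_distrib vec.scale)
  obtain B where B: "B \<subseteq> K" "vec.independent B" "K \<subseteq> vec.span B"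
    using vec.maximal_independent_subset by metis
  then have "B \<subseteq> U" by (auto simp: K_def)
  then obtain B' where B': "B \<subseteq> B'" "B' \<subseteq> U" "vec.independent B'" "U \<subseteq> vec.span B'"
    using vec.maximal_independent_subset_extend B(2) by metis
  \<comment> \<open>\<open>C\<close> completes a basis of the kernel to one of \<open>U\<close>; on
    its span \<open>A\<close> is injective and has the same image as on \<open>U\<close>.\<close>
  define C where "C = B' - B"
  have indC: "vec.independent C"
    unfolding C_def using B'(3) by (rule vec.independent_mono) auto
  have fin: "finite B'" using B'(3) by (rule vec.finiteI_independent)
  have spB: "vec.span B = K"
    using B K by (simp add: vec.span_subspace)
  have spB': "vec.span B' = U"
    using B' U by (simp add: vec.span_subspace)
  have BC: "B' = B \<union> C" using B' by (auto simp: C_def)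
  have "{x + y |x y. x \<in> vec.span B \<and> y \<in> vec.span C} = vec.span B'"
    unfolding BC vec.span_Un by auto
  then have "vec.dim U + vec.dim (vec.span B \<inter> vec.span C) = vec.dim (vec.span B) + vec.dim (vec.span C)"
    using vec.dim_sums_Int[of "vec.span B" "vec.span C"] spB' by simp
  moreover have "vec.dim U = card B'"
    using B' vec.dim_span_eq_card_independent spB' by metis
  moreover have "card B' = card B + card C"
    using fin B' by (simp add: C_def card_Diff_subset card_mono finite_subset)
  moreover have "vec.dim (vec.span B) = card B" "vec.dim (vec.span C) = card C"
    using B indC by (auto simp: vec.dim_span_eq_card_independent simp del: vec.dim_span)
  ultimately have eq: "vec.dim U = vec.dim K + vec.dim C" and "vec.dim (vec.span B \<inter> vec.span C) = 0"
    by (auto simp: spB)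
  then have int0: "K \<inter> vec.span C \<subseteq> {0}" by (simp add: spB)
  have inj: "inj_on ((*v) A) (vec.span C)"
  proof (rule inj_onI)
    fix x y assume xy: "x \<in> vec.span C" "y \<in> vec.span C" "A *v x = A *v y"
    have "C \<subseteq> U" using B' by (auto simp: C_def)
    then have "vec.span C \<subseteq> U" using U by (simp add: vec.span_minimal)
    with xy have "x - y \<in> K"
      using U by (auto simp: K_def vec.subspace_diff matrix_vector_mult_diff_distrib)
    moreover have "x - y \<in> vec.span C" using xy by (simp add: vec.span_diff)
    ultimately show "x = y" using int0 by auto
  qed
  have "(*v) A ` U = (*v) A ` vec.span C"
  proof -
    have "\<exists>y \<in> vec.span C. A *v x = A *v y" if "x \<in> U" for x
    proof -
      have "x \<in> vec.span (B \<union> C)" using that spB' BC by simp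
      then obtain b c where "b \<in> vec.span B" "c \<in> vec.span C" "x = b + c"
        unfolding vec.span_Un by auto
      then show ?thesis using spB by (auto simp: K_def matrix_vector_right_distrib intro!: bexI[of _ c])
    qed
    moreover have "vec.span C \<subseteq> U"
      using B'(2) U by (intro vec.span_minimal) (auto simp: C_def)
    ultimately show ?thesis by blast
  qed
  moreover have "vec.dim ((*v) A ` C) = vec.dim C"
    using inj by (intro vec.dim_image_eq) auto
  moreover have "(*v) A ` vec.span C = vec.span ((*v) A ` C)"
    by (simp add: vec.linear_span_image)
  ultimately show ?thesis using eq by (simp add: K_def)
qed

definition form :: "'a::comm_ring_1 ^ 'n::finite \<Rightarrow> 'a ^ 'n \<Rightarrow> 'a"
  where "form r x = (\<Sum>i\<in>UNIV. r $ i * x $ i)"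

definition null_space :: "('a::comm_ring_1 ^ 'n::finite) set \<Rightarrow> ('a ^ 'n) set"
  where "null_space R = {x. \<forall>r\<in>R. form r x = 0}"

lemma form_add: "form r (x + y) = form r x + form r y"
  and form_smult: "form r (c *s x) = c * form r x"
  and form_add_left: "form (r + s) x = form r x + form s x"
  and form_smult_left: "form (c *s r) x = c * form r x"
  and form_0_left [simp]: "form 0 x = 0"
  and form_0_right [simp]: "form r 0 = 0"
  by (simp_all add: form_def sum.distrib algebra_simps sum_distrib_left)

lemma form_axis [simp]: "form (axis j 1) x = x $ j"
  by (simp add: form_def axis_def if_distrib[of "\<lambda>t. t * _"] cong: if_cong)

lemma matrix_vector_mult_form: "(M *v x) $ i = form (M $ i) x"
  by (simp add: matrix_vector_mult_def form_def)

lemma subspace_null_space: "vec.subspace (null_space R)"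
  by (auto simp: vec.subspace_def null_space_def form_add form_smult)

lemma subspace_kernel: "vec.subspace {x. M *v x = 0}"
  by (auto simp: vec.subspace_def matrix_vector_right_distrib vec.scale)

text \<open>Imposing x_j = 0 at a coordinate where some vector of \<open>W\<close> is nonzero lowers
  the dimension, so at most dim W coordinates are used up. Coordinate forms are wanted because their
  entries 0 and 1 are fixed by every homomorphism.\<close>

lemma coordinates_separate_subspace:
  fixes W :: "('a::field ^ 'n) set"
  assumes "vec.subspace W"
  shows "\<exists>J. card J \<le> vec.dim W \<and> (\<forall>x\<in>W. (\<forall>j\<in>J. x $ j = 0) \<longrightarrow> x = 0)"
  using assms
proof (induction "vec.dim W" arbitrary: W rule: less_induct)
  case less
  show ?case
  proof (cases "W = {0}")
    case True
    then show ?thesis by (intro exI[of _ "{}"]) auto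
  next
    case False
    then obtain x where "x \<in> W" "x \<noteq> 0"
      using vec.subspace_0[OF less.prems] by blast
    then obtain j where x: "x \<in> W" "x $ j \<noteq> 0"
      by (auto simp: vec_eq_iff)
    define W' where "W' = {y \<in> W. y $ j = 0}"
    have W': "vec.subspace W'"
      using less.prems by (auto simp: W'_def vec.subspace_def)
    have "W' \<subset> W" using x by (auto simp: W'_def)
    then have lt: "vec.dim W' < vec.dim W"
      by (metis W' less.prems vec.dim_psubset vec.span_eq_iff)
    obtain J where J: "card J \<le> vec.dim W'" "\<forall>x\<in>W'. (\<forall>j\<in>J. x $ j = 0) \<longrightarrow> x = 0"
      using less.hyps[OF lt W'] by blast
    have "card (insert j J) \<le> vec.dim W"
      using J(1) lt card_insert_le_m1[of "vec.dim W" J j] by simp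
    moreover have "\<forall>x\<in>W. (\<forall>i\<in>insert j J. x $ i = 0) \<longrightarrow> x = 0"
      using J(2) by (auto simp: W'_def)
    ultimately show ?thesis by blast
  qed
qed

text \<open>A basis \<open>B\<close> of the span of \<open>R\<close>, placed in distinct rows, has
  the same null space as \<open>R\<close>. Rows not hit by \<open>h\<close> are filled with 0, which
  avoids showing that \<open>B\<close> has exactly n elements.\<close>

lemma exists_nonsingular_selection:
  fixes R :: "('a::field ^ 'n::finite) set"
  assumes "null_space R = {0}"
  shows "\<exists>g :: 'n \<Rightarrow> 'a ^ 'n. (\<forall>i. g i \<in> insert 0 R) \<and> det (\<chi> i. g i) \<noteq> 0"
proof -
  obtain B where B: "B \<subseteq> R" "vec.independent B" "R \<subseteq> vec.span B"
    using vec.maximal_independent_subset by metis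
  have finB: "finite B" using B(2) by (rule vec.finiteI_independent)
  have "card B \<le> CARD('n)"
    using vec.independent_card_le_dim[of B UNIV] B(2) by (simp add: card_cart_basis)
  then obtain h where h: "inj_on h B" "h ` B \<subseteq> (UNIV :: 'n set)"
    using card_le_inj[of B "UNIV :: 'n set"] finB by auto
  define g where "g i = (if i \<in> h ` B then inv_into B h i else 0)" for i
  have gR: "g i \<in> insert 0 R" for i
    using B(1) by (auto simp: g_def inv_into_into h)
  have gh: "g (h b) = b" if "b \<in> B" for b
    using that h by (simp add: g_def)
  have "x = 0" if "(\<chi> i. g i) *v x = 0" for x
  proof -
    have "form (g i) x = 0" for i
      using that matrix_vector_mult_form[of "\<chi> i. g i" x i] by simp
    then have *: "form b x = 0" if "b \<in> B" for b using gh that by metis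
    have "form r x = 0" if "r \<in> vec.span B" for r
      using that
      by (induction rule: vec.span_induct_alt) (auto simp: form_add_left form_smult_left *)
    then have "x \<in> null_space R" using B(3) by (auto simp: null_space_def)
    then show "x = 0" using assms by simp
  qed
  then have "\<exists>B. B ** (\<chi> i. g i) = mat 1"
    using matrix_left_invertible_ker by blast
  then have "det (\<chi> i. g i) \<noteq> 0"
    by (metis invertible_def invertible_det_nz matrix_left_right_inverse)
  then show ?thesis using gR by blast
qed

section \<open>Ring homomorphisms on a subring\<close>

text \<open>The ring is a set inside a type, so that eigenvalues can be adjoined to it without a
  change of type; of the values of \<open>f\<close> only those on \<open>A\<close> carry
  meaning.\<close>

locale subring_hom =
  fixes A :: "'a::comm_ring_1 set" and f :: "'a \<Rightarrow> 'b::comm_ring_1"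
  assumes one_mem [simp]: "1 \<in> A" and hom_one [simp]: "f 1 = 1"
    and minus_mem: "x \<in> A \<Longrightarrow> - x \<in> A"
    and add_mem: "\<lbrakk>x \<in> A; y \<in> A\<rbrakk> \<Longrightarrow> x + y \<in> A"
    and mult_mem: "\<lbrakk>x \<in> A; y \<in> A\<rbrakk> \<Longrightarrow> x * y \<in> A"
    and hom_add: "\<lbrakk>x \<in> A; y \<in> A\<rbrakk> \<Longrightarrow> f (x + y) = f x + f y"
    and hom_mult: "\<lbrakk>x \<in> A; y \<in> A\<rbrakk> \<Longrightarrow> f (x * y) = f x * f y"
begin

lemma zero_mem [simp]: "0 \<in> A"
  using add_mem[OF one_mem minus_mem[OF one_mem]] by simp

lemma hom_zero [simp]: "f 0 = 0"
  using hom_add[of 0 0] by simp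

lemma hom_minus: "x \<in> A \<Longrightarrow> f (- x) = - f x"
  using hom_add[of x "- x"] minus_mem[of x] by (simp add: eq_neg_iff_add_eq_0 add.commute)

lemma sum_mem: "(\<And>i. i \<in> I \<Longrightarrow> g i \<in> A) \<Longrightarrow> sum g I \<in> A"
  and hom_sum: "(\<And>i. i \<in> I \<Longrightarrow> g i \<in> A) \<Longrightarrow> f (sum g I) = (\<Sum>i\<in>I. f (g i))"
proof -
  have "(\<forall>i\<in>I. g i \<in> A) \<longrightarrow> sum g I \<in> A \<and> f (sum g I) = (\<Sum>i\<in>I. f (g i))"
    by (induction I rule: infinite_finite_induct) (auto simp: add_mem hom_add)
  then show "(\<And>i. i \<in> I \<Longrightarrow> g i \<in> A) \<Longrightarrow> sum g I \<in> A"
    "(\<And>i. i \<in> I \<Longrightarrow> g i \<in> A) \<Longrightarrow> f (sum g I) = (\<Sum>i\<in>I. f (g i))" by auto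
qed

lemma prod_mem: "(\<And>i. i \<in> I \<Longrightarrow> g i \<in> A) \<Longrightarrow> prod g I \<in> A"
  and hom_prod: "(\<And>i. i \<in> I \<Longrightarrow> g i \<in> A) \<Longrightarrow> f (prod g I) = (\<Prod>i\<in>I. f (g i))"
proof -
  have "(\<forall>i\<in>I. g i \<in> A) \<longrightarrow> prod g I \<in> A \<and> f (prod g I) = (\<Prod>i\<in>I. f (g i))"
    by (induction I rule: infinite_finite_induct) (auto simp: mult_mem hom_mult)
  then show "(\<And>i. i \<in> I \<Longrightarrow> g i \<in> A) \<Longrightarrow> prod g I \<in> A"
    "(\<And>i. i \<in> I \<Longrightarrow> g i \<in> A) \<Longrightarrow> f (prod g I) = (\<Prod>i\<in>I. f (g i))" by auto
qed

lemma of_nat_mem [simp]: "of_nat n \<in> A" and hom_of_nat [simp]: "f (of_nat n) = of_nat n"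
  by (induction n) (auto simp: add_mem hom_add)

lemma of_int_mem [simp]: "of_int n \<in> A" and hom_of_int [simp]: "f (of_int n) = of_int n"
  by (cases n rule: int_cases2; simp add: minus_mem hom_minus)+

lemma det_mem: "(\<And>i j. M $ i $ j \<in> A) \<Longrightarrow> det M \<in> A"
  and hom_det: "(\<And>i j. M $ i $ j \<in> A) \<Longrightarrow> f (det M) = det (map_matrix f M)"
  by (simp_all add: det_def sum_mem hom_sum prod_mem hom_prod mult_mem hom_mult)

lemma matrix_mult_mem:
  "\<lbrakk>\<And>i j. M $ i $ j \<in> A; \<And>i j. N $ i $ j \<in> A\<rbrakk> \<Longrightarrow> (M ** N) $ i $ j \<in> A"
  by (simp add: matrix_matrix_mult_def sum_mem mult_mem)

lemma map_matrix_mult: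
  "\<lbrakk>\<And>i j. M $ i $ j \<in> A; \<And>i j. N $ i $ j \<in> A\<rbrakk> \<Longrightarrow>
    map_matrix f (M ** N) = map_matrix f M ** map_matrix f N"
  by (simp add: vec_eq_iff matrix_matrix_mult_def hom_sum mult_mem hom_mult)

lemma map_matrix_add:
  "\<lbrakk>\<And>i j. M $ i $ j \<in> A; \<And>i j. N $ i $ j \<in> A\<rbrakk> \<Longrightarrow>
    map_matrix f (M + N) = map_matrix f M + map_matrix f N"
  by (simp add: vec_eq_iff hom_add)

lemma map_matrix_diff:
  "\<lbrakk>\<And>i j. M $ i $ j \<in> A; \<And>i j. N $ i $ j \<in> A\<rbrakk> \<Longrightarrow>
    map_matrix f (M - N) = map_matrix f M - map_matrix f N"
  using hom_add[OF _ minus_mem] by (simp add: vec_eq_iff hom_minus minus_mem)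

lemma map_matrix_mat: "a \<in> A \<Longrightarrow> map_matrix f (mat a) = mat (f a)"
  by (simp add: vec_eq_iff mat_def)

end

text \<open>
  Upper semicontinuity. Coordinates \<open>J\<close> separating the points of the special null space
  complete \<open>R\<close> to a system containing a nonsingular square one; the determinant of that one is
  nonzero before applying \<open>f\<close>, so \<open>J\<close> also separates the points of the generic null space.
\<close>

lemma dim_null_space_le:
  fixes R :: "('a::field ^ 'n::finite) set" and f :: "'a \<Rightarrow> 'b::field"
  assumes "subring_hom A f" and R: "\<And>r i. r \<in> R \<Longrightarrow> r $ i \<in> A"
  shows "vec.dim (null_space R) \<le> vec.dim (null_space ((\<lambda>r. \<chi> i. f (r $ i)) ` R))"
proof -
  interpret subring_hom A f by fact
  let ?f = "\<lambda>r :: 'a ^ 'n. (\<chi> i. f (r $ i)) :: 'b ^ 'n"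
  obtain J where J: "card J \<le> vec.dim (null_space (?f ` R))"
    "\<And>x. \<lbrakk>x \<in> null_space (?f ` R); \<And>j. j \<in> J \<Longrightarrow> x $ j = 0\<rbrakk> \<Longrightarrow> x = 0"
    using coordinates_separate_subspace[OF subspace_null_space] by metis
  let ?R = "R \<union> (\<lambda>j. axis j 1) ` J"
  have fax: "?f (axis j 1) = axis j 1" for j by (simp add: axis_def vec_eq_iff)
  have f0: "?f 0 = 0" by (simp add: vec_eq_iff)
  have RA: "r $ i \<in> A" if "r \<in> insert 0 ?R" for r i
    using that R by (auto simp: axis_def)
  have "null_space (?f ` ?R) = {0}"
  proof (rule subset_antisym; rule subsetI)
    fix x assume x: "x \<in> null_space (?f ` ?R)"
    then have "x \<in> null_space (?f ` R)" by (auto simp: null_space_def)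
    moreover have "x $ j = 0" if "j \<in> J" for j
    proof -
      have "?f (axis j 1) \<in> ?f ` ?R" using that by blast
      then have "form (?f (axis j 1)) x = 0" using x unfolding null_space_def by blast
      then show ?thesis by (simp add: fax)
    qed
    ultimately show "x \<in> {0}" using J(2) by auto
  qed (auto simp: null_space_def)
  then obtain g where g: "\<And>i. g i \<in> insert 0 (?f ` ?R)" "det (\<chi> i. g i) \<noteq> 0"
    using exists_nonsingular_selection by metis
  have "\<exists>s. s \<in> insert 0 ?R \<and> g i = ?f s" for i
  proof -
    have "insert 0 (?f ` ?R) = ?f ` insert 0 ?R" using f0 by simp
    then show ?thesis using g(1)[of i] by blast
  qed
  then obtain s where s: "\<And>i. s i \<in> insert 0 ?R" "\<And>i. g i = ?f (s i)" by metis
  have "map_matrix f (\<chi> i. s i) = (\<chi> i. g i)"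
    by (simp add: vec_eq_iff s(2))
  then have "f (det (\<chi> i. s i)) \<noteq> 0"
    using g(2) by (subst hom_det) (auto intro: RA[OF s(1)])
  then have "det (\<chi> i. s i) \<noteq> 0" by auto
  then have "invertible (\<chi> i. s i)" by (simp add: invertible_det_nz)
  then have inv: "x = 0" if "(\<chi> i. s i) *v x = 0" for x
    using that matrix_left_invertible_ker[of "\<chi> i. s i"] by (auto simp: invertible_def)
  \<comment> \<open>\<open>?P\<close> projects onto the coordinates in \<open>J\<close>. It is
    injective on the generic null space, whose dimension is therefore at most
    \<open>card J\<close>.\<close>
  let ?P = "(\<chi> i j. if i = j then if j \<in> J then 1 else 0 else 0) :: 'a ^ 'n ^ 'n"
  have P: "(?P *v x) $ i = (if i \<in> J then x $ i else 0)" for x i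
    by (auto simp: matrix_vector_mult_def if_distrib[of "\<lambda>t. t * _"] cong: if_cong)
  have "{x \<in> null_space R. ?P *v x = 0} \<subseteq> {0}"
  proof
    fix x assume x: "x \<in> {x \<in> null_space R. ?P *v x = 0}"
    have "x $ j = 0" if "j \<in> J" for j
      using x P[of x j] that by auto
    then have "form r x = 0" if "r \<in> insert 0 ?R" for r
      using x that by (auto simp: null_space_def)
    then have "(\<chi> i. s i) *v x = 0"
      using s(1) by (simp add: vec_eq_iff matrix_vector_mult_form)
    then show "x \<in> {0}" using inv by auto
  qed
  then have "vec.dim {x \<in> null_space R. ?P *v x = 0} = 0" by simp
  then have "vec.dim (null_space R) = vec.dim ((*v) ?P ` null_space R)"
    using dim_kernel_image[OF subspace_null_space, of R ?P] by simp
  also have "\<dots> \<le> card ((\<lambda>j. axis j (1::'a)) ` J)"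
  proof (rule vec.dim_le_card)
    have "?P *v x = (\<Sum>j\<in>J. x $ j *s axis j 1)" for x
      by (auto simp: vec_eq_iff P axis_def if_distrib[of "\<lambda>t. _ * t"] cong: if_cong)
    then show "(*v) ?P ` null_space R \<subseteq> vec.span ((\<lambda>j. axis j (1::'a)) ` J)"
      by (intro image_subsetI) (simp only:, intro vec.span_sum vec.span_scale vec.span_base imageI)
  qed simp
  also have "\<dots> \<le> card J" by (rule card_image_le) simp
  finally show ?thesis using J(1) by simp
qed

section \<open>Polynomials in a matrix\<close>

lemma mat_add: "mat (a + b) = mat a + (mat b :: 'a::comm_ring_1 ^ 'n ^ 'n::finite)"
  by (simp add: vec_eq_iff mat_def)

lemma mat_mult_left: "mat a ** M = (\<chi> i j. a * M $ i $ j)"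
  and mat_mult_right: "M ** mat a = (\<chi> i j. a * M $ i $ j)"
  for M :: "'a::comm_ring_1 ^ 'n ^ 'n::finite"
  by (simp_all add: vec_eq_iff mat_def matrix_matrix_mult_def
      if_distrib[of "\<lambda>t. t * _"] if_distrib[of "\<lambda>t. _ * t"] mult.commute cong: if_cong)

lemma mat_mult: "mat (a * b) = mat a ** (mat b :: 'a::comm_ring_1 ^ 'n ^ 'n::finite)"
  by (simp add: mat_mult_left vec_eq_iff) (simp add: mat_def)

lemma mat_commute: "mat a ** M = M ** mat a" for M :: "'a::comm_ring_1 ^ 'n ^ 'n::finite"
  by (simp add: mat_mult_left mat_mult_right)

lemma mat_vector_mult: "mat a *v x = a *s (x :: 'a::comm_ring_1 ^ 'n::finite)"
  by (simp add: vec_eq_iff mat_def matrix_vector_mult_def if_distrib[of "\<lambda>t. t * _"] cong: if_cong)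

lemma matrix_add_rdistrib: "(A + B) ** C = A ** C + B ** C"
  for A B :: "'a::comm_ring_1 ^ 'n ^ 'm::finite"
  by (simp add: vec_eq_iff matrix_matrix_mult_def sum.distrib algebra_simps)

definition matpoly :: "'a::comm_ring_1 ^ 'n ^ 'n::finite \<Rightarrow> 'a poly \<Rightarrow> 'a ^ 'n ^ 'n"
  where "matpoly M p = fold_coeffs (\<lambda>a B. mat a + M ** B) p 0"

lemma matpoly_0 [simp]: "matpoly M 0 = 0"
  by (simp add: matpoly_def)

lemma matpoly_pCons [simp]: "matpoly M (pCons a p) = mat a + M ** matpoly M p"
  by (cases "p = 0 \<and> a = 0") (auto simp: matpoly_def)

lemma matpoly_1 [simp]: "matpoly M 1 = mat 1"
  by (simp add: one_pCons)

lemma matpoly_add: "matpoly M (p + q) = matpoly M p + matpoly M q"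
  by (induction p q rule: poly_induct2) (simp_all add: mat_add matrix_add_ldistrib)

lemma matpoly_smult: "matpoly M (Polynomial.smult c p) = mat c ** matpoly M p"
proof (induction p)
  case (pCons a p)
  have "M ** (mat c ** matpoly M p) = mat c ** (M ** matpoly M p)"
    by (metis mat_commute matrix_mul_assoc)
  then show ?case using pCons by (simp add: mat_mult matrix_add_ldistrib)
qed simp

lemma matpoly_mult: "matpoly M (p * q) = matpoly M p ** matpoly M q"
  by (induction p)
    (simp_all add: matpoly_add matpoly_smult matrix_add_rdistrib matrix_mul_assoc)

lemma matpoly_mult_vector: "matpoly M (p * q) *v x = matpoly M p *v (matpoly M q *v x)"
  by (simp add: matpoly_mult matrix_vector_mul_assoc)

lemma matpoly_mult_vector_eq_0:
  assumes "matpoly M p *v x = 0 \<or> matpoly M q *v x = 0"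
  shows "matpoly M (p * q) *v x = 0"
  using assms matpoly_mult_vector[of M p q x] matpoly_mult_vector[of M q p x]
  by (auto simp: mult.commute[of p q])

lemma matpoly_add_vector: "matpoly M (p + q) *v x = matpoly M p *v x + matpoly M q *v x"
  by (simp add: matpoly_add matrix_vector_mult_add_rdistrib)

lemma matpoly_linear_vector:
  "matpoly M [:- a, 1:] *v x = M *v x - a *s (x :: 'a::comm_ring_1 ^ 'n::finite)"
proof -
  have "mat (- a) *v x = - (a *s x)" by (simp add: mat_vector_mult vec_eq_iff)
  then show ?thesis by (simp add: matrix_vector_mult_add_rdistrib)
qed

lemma matpoly_commute:
  assumes "M ** B = B ** M"
  shows "matpoly M p ** B = B ** matpoly M p"
proof (induction p)
  case (pCons a p)
  have "M ** matpoly M p ** B = B ** (M ** matpoly M p)"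
    by (metis assms matrix_mul_assoc pCons.IH)
  then show ?case by (simp add: matrix_add_ldistrib matrix_add_rdistrib mat_commute[of _ B])
qed simp

lemma matpoly_eigenvector:
  fixes x :: "'a::field ^ 'n::finite"
  assumes "M *v x = a *s x"
  shows "matpoly M p *v x = poly p a *s x"
proof (induction p)
  case (pCons b p)
  have "matpoly M (pCons b p) *v x = b *s x + M *v (poly p a *s x)"
    using pCons.IH by (simp add: matrix_vector_mult_add_rdistrib mat_vector_mult flip: matrix_vector_mul_assoc)
  also have "\<dots> = b *s x + poly p a *s (a *s x)"
    by (simp only: assms vec.scale)
  finally show ?case by (simp add: vec_eq_iff algebra_simps)
qed simp

text \<open>The relation c M N = N M moves a polynomial in cM past N, and this turns it into a
  polynomial in M again.\<close>

lemma matpoly_pcompose: "matpoly M (pcompose p [:0, c:]) = matpoly (mat c ** M) p"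
proof (induction p)
  case (pCons a p)
  then show ?case
    by (simp add: pcompose_pCons matpoly_add matpoly_smult matrix_mul_assoc mat_commute[of c M])
qed simp

context subring_hom
begin

lemma map_poly_add:
  assumes "\<And>i. coeff p i \<in> A" "\<And>i. coeff q i \<in> A"
  shows "map_poly f (p + q) = map_poly f p + map_poly f q"
  using assms by (simp add: poly_eq_iff coeff_map_poly hom_add)

lemma coeff_mult_mem:
  assumes "\<And>i. coeff p i \<in> A" "\<And>i. coeff q i \<in> A"
  shows "coeff (p * q) i \<in> A"
  using assms by (simp add: coeff_mult sum_mem mult_mem)

lemma map_poly_mult:
  assumes "\<And>i. coeff p i \<in> A" "\<And>i. coeff q i \<in> A"
  shows "map_poly f (p * q) = map_poly f p * map_poly f q"
  using assms by (simp add: poly_eq_iff coeff_map_poly coeff_mult hom_sum mult_mem hom_mult)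

lemma map_poly_diff:
  assumes "\<And>i. coeff p i \<in> A" "\<And>i. coeff q i \<in> A"
  shows "map_poly f (p - q) = map_poly f p - map_poly f q"
  using assms hom_add[OF _ minus_mem] by (simp add: poly_eq_iff coeff_map_poly hom_minus)

lemma matpoly_mem_hom:
  assumes "\<And>i j. M $ i $ j \<in> A" "\<And>i. coeff p i \<in> A"
  shows "matpoly M p $ i $ j \<in> A \<and>
    map_matrix f (matpoly M p) = matpoly (map_matrix f M) (map_poly f p)"
proof -
  have "(\<forall>i. coeff p i \<in> A) \<longrightarrow> (\<forall>i j. matpoly M p $ i $ j \<in> A) \<and>
    map_matrix f (matpoly M p) = matpoly (map_matrix f M) (map_poly f p)"
  proof (induction p)
    case 0
    then show ?case by (simp add: vec_eq_iff)
  next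
    case (pCons a p)
    show ?case
    proof (intro impI)
      assume *: "\<forall>i. coeff (pCons a p) i \<in> A"
      have a: "a \<in> A" using *[rule_format, of 0] by simp
      have p: "coeff p i \<in> A" for i using *[rule_format, of "Suc i"] by simp
      have IH: "\<And>i j. matpoly M p $ i $ j \<in> A"
        "map_matrix f (matpoly M p) = matpoly (map_matrix f M) (map_poly f p)"
        using pCons p by auto
      have m: "mat a $ i $ j \<in> A" for i j :: 'c using a by (simp add: mat_def)
      have mm: "(M ** matpoly M p) $ i $ j \<in> A" for i j
        using assms(1) IH(1) by (rule matrix_mult_mem)
      show "(\<forall>i j. matpoly M (pCons a p) $ i $ j \<in> A) \<and>
        map_matrix f (matpoly M (pCons a p)) = matpoly (map_matrix f M) (map_poly f (pCons a p))"
        using m mm a IH assms(1)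
        by (simp add: map_matrix_add map_matrix_mult map_matrix_mat map_poly_pCons add_mem)
    qed
  qed
  then show ?thesis using assms(2) by blast
qed

end

section \<open>Annihilating polynomials and coprime factorizations\<close>

lemma annihilating_poly_vector:
  fixes M :: "'a::field ^ 'n ^ 'n::finite"
  shows "\<exists>p. p \<noteq> 0 \<and> matpoly M p *v x = 0"
proof (rule ccontr)
  assume "\<not> ?thesis"
  then have *: "p = 0" if "matpoly M p *v x = 0" for p using that by blast
  define y where "y i = matpoly M (monom 1 i) *v x" for i
  have comb: "(\<Sum>i\<le>n. c i *s y i) = matpoly M (\<Sum>i\<le>n. monom (c i) i) *v x" for c and n :: nat
  proof (induction n)
    case 0
    show ?case by (simp add: y_def mat_vector_mult monom_0)
  next
    case (Suc n)
    have "matpoly M (monom (c (Suc n)) (Suc n)) = mat (c (Suc n)) ** matpoly M (monom 1 (Suc n))"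
      by (simp only: matpoly_smult[symmetric] Polynomial.smult_monom mult_1_right)
    then have "c (Suc n) *s y (Suc n) = matpoly M (monom (c (Suc n)) (Suc n)) *v x"
      by (simp add: y_def mat_vector_mult flip: matrix_vector_mul_assoc)
    then show ?case using Suc by (simp add: matpoly_add_vector)
  qed
  have coef: "c k = 0" if "(\<Sum>i\<le>n. c i *s y i) = 0" "k \<le> n" for c k and n :: nat
  proof -
    have "(\<Sum>i\<le>n. monom (c i) i) = 0" using * comb that(1) by metis
    then have "coeff (\<Sum>i\<le>n. monom (c i) i) k = 0" by simp
    then show ?thesis using that(2) by (simp add: coeff_sum if_distrib cong: if_cong)
  qed
  \<comment> \<open>Independence is a property of the set of iterates M^i x, where repetitions would
    collapse; to contradict the dimension, the n + 1 iterates must also be distinct.\<close>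
  have inj: "inj y"
  proof (rule injI, rule ccontr)
    fix i j assume ij: "y i = y j" "i \<noteq> j"
    have "matpoly M (monom 1 i - monom 1 j) *v x = 0"
      using ij(1) matpoly_add_vector[of M "monom 1 i - monom 1 j" "monom 1 j" x] by (simp add: y_def)
    then have "monom (1::'a) i = monom 1 j" using * by fastforce
    then show False using ij(2) by (metis degree_monom_eq one_neq_zero)
  qed
  let ?n = "CARD('n)"
  have "vec.independent (y ` {..?n})"
  proof (rule vec.independent_if_scalars_zero)
    fix c b assume c: "(\<Sum>b\<in>y ` {..?n}. c b *s b) = 0" "b \<in> y ` {..?n}"
    then have "(\<Sum>i\<le>?n. c (y i) *s y i) = 0"
      using inj by (simp add: sum.reindex inj_on_subset)
    then show "c b = 0" using coef[of "\<lambda>i. c (y i)"] c(2) by auto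
  qed simp
  then have "card (y ` {..?n}) \<le> ?n"
    using vec.independent_card_le_dim[of "y ` {..?n}" UNIV] by (simp add: card_cart_basis)
  then show False using inj by (simp add: card_image inj_on_subset)
qed

text \<open>Linear factors are removed from \<open>p\<close> until the rest \<open>q\<close> no
  longer kills \<open>y\<close>; the last factor removed gives the eigenvalue. The eigenvector is a
  polynomial in \<open>M\<close> applied to \<open>y\<close>, so it inherits from \<open>y\<close>
  membership in every subspace stable under \<open>M\<close>.\<close>

lemma eigenvector_from_annihilating_poly:
  fixes M :: "'a::alg_closed_field ^ 'n ^ 'n::finite"
  assumes "p \<noteq> 0" "matpoly M p *v y = 0" "y \<noteq> 0"
  shows "\<exists>q a. poly p a = 0 \<and> matpoly M q *v y \<noteq> 0 \<and>
    M *v (matpoly M q *v y) = a *s (matpoly M q *v y)"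
  using assms
proof (induction "degree p" arbitrary: p rule: less_induct)
  case less
  show ?case
  proof (cases "degree p = 0")
    case True
    then obtain c where "p = [:c:]" by (auto elim: degree_eq_zeroE)
    then show ?thesis using less.prems by (auto simp: mat_vector_mult)
  next
    case False
    then obtain a where a: "poly p a = 0" using alg_closed_imp_poly_has_root by blast
    then obtain q where q: "p = [:- a, 1:] * q" by (auto simp: poly_eq_0_iff_dvd)
    show ?thesis
    proof (cases "matpoly M q *v y = 0")
      case True
      have "q \<noteq> 0" using q less.prems by auto
      then have "degree q < degree p" unfolding q by (subst degree_mult_eq) auto
      with less True \<open>q \<noteq> 0\<close> show ?thesis by (fastforce simp: q)
    next
      case False
      have "M *v (matpoly M q *v y) - a *s (matpoly M q *v y) = 0"
        using less.prems(2) unfolding q matpoly_mult_vector matpoly_linear_vector .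
      with a False show ?thesis by (intro exI[of _ q] exI[of _ a]) simp
    qed
  qed
qed

lemma exists_eigenvalue: "\<exists>a. is_eigenvalue (M :: 'a::alg_closed_field ^ 'n ^ 'n::finite) a"
proof -
  obtain y :: "'a ^ 'n" where "y \<noteq> 0" using zero_neq_one by metis
  moreover obtain p where "p \<noteq> 0" "matpoly M p *v y = 0" using annihilating_poly_vector by blast
  ultimately show ?thesis
    using eigenvector_from_annihilating_poly unfolding is_eigenvalue_def by metis
qed

text \<open>Euclid's algorithm: passing from (a, b) to (b, a mod b) keeps the common roots, and once
  b = 0 the polynomial \<open>a\<close> has no root and is constant.\<close>

lemma bezout_no_common_root:
  fixes a b :: "'a::alg_closed_field poly"
  assumes "a \<noteq> 0 \<or> b \<noteq> 0" "\<And>x. \<not> (poly a x = 0 \<and> poly b x = 0)"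
  shows "\<exists>u v. u * a + v * b = 1"
  using assms
\<comment> \<open>The measure must put b = 0 strictly below the nonzero constants, which have the
  same degree.\<close>
proof (induction "if b = 0 then 0 else Suc (degree b)" arbitrary: a b rule: less_induct)
  case less
  show ?case
  proof (cases "b = 0")
    case True
    then have "degree a = 0" using less.prems(2) alg_closed_imp_poly_has_root by fastforce
    then obtain c where c: "a = [:c:]" by (auto elim: degree_eq_zeroE)
    then have "[:inverse c:] * a + 0 * b = 1"
      using True less.prems(1) by (simp add: one_pCons)
    then show ?thesis by blast
  next
    case False
    have eq: "a = a div b * b + a mod b" by simp
    have "poly a x = poly (a div b) x * poly b x + poly (a mod b) x" for x
      by (metis eq poly_add poly_mult)
    then have "\<not> (poly b x = 0 \<and> poly (a mod b) x = 0)" for x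
      using less.prems(2)[of x] by (metis add.right_neutral mult_zero_right)
    moreover have "(if a mod b = 0 then 0 else Suc (degree (a mod b))) < Suc (degree b)"
      using degree_mod_less[OF False] by auto
    ultimately obtain u v where uv: "u * b + v * (a mod b) = 1"
      using less.hyps[of "a mod b" b] False by auto
    have "v * (k * b + m) + (u - v * k) * b = u * b + v * m" for k m
      by (simp add: algebra_simps)
    from this[of "a div b" "a mod b"] have "v * a + (u - v * (a div b)) * b = 1"
      using uv by simp
    then show ?thesis by blast
  qed
qed

lemma poly_split_roots:
  fixes p :: "'a::alg_closed_field poly"
  assumes "p \<noteq> 0"
  shows "\<exists>p1 p2. p = p1 * p2 \<and> (\<forall>x. poly p1 x = 0 \<longrightarrow> S x) \<and> (\<forall>x. poly p2 x = 0 \<longrightarrow> \<not> S x)"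
  using assms
proof (induction "degree p" arbitrary: p rule: less_induct)
  case less
  show ?case
  proof (cases "degree p = 0")
    case True
    then obtain c where "p = [:c:]" by (auto elim: degree_eq_zeroE)
    then show ?thesis using less.prems by (intro exI[of _ p] exI[of _ 1]) auto
  next
    case False
    then obtain a where a: "poly p a = 0" using alg_closed_imp_poly_has_root by blast
    then obtain q where q: "p = [:- a, 1:] * q" by (auto simp: poly_eq_0_iff_dvd)
    have "q \<noteq> 0" using q less.prems by auto
    then have "degree q < degree p" unfolding q by (subst degree_mult_eq) auto
    with less.hyps \<open>q \<noteq> 0\<close> obtain q1 q2 where
      q12: "q = q1 * q2" "\<forall>x. poly q1 x = 0 \<longrightarrow> S x" "\<forall>x. poly q2 x = 0 \<longrightarrow> \<not> S x" by metis
    show ?thesis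
    proof (cases "S a")
      case True
      with q q12 show ?thesis by (intro exI[of _ "[:- a, 1:] * q1"] exI[of _ q2]) (auto simp: algebra_simps)
    next
      case False
      with q q12 show ?thesis by (intro exI[of _ q1] exI[of _ "[:- a, 1:] * q2"]) (auto simp: algebra_simps)
    qed
  qed
qed

section \<open>Sums of generalized eigenspaces\<close>

text \<open>Over an algebraically closed field this is the sum of the generalized eigenspaces for
  the eigenvalues in \<open>S\<close> (see \<open>span_gen_eigenspaces\<close>). A single
  annihilating polynomial per vector replaces the decomposition into summands, and \<open>S\<close>
  may be any predicate, so that complements are available.\<close>

definition gen_space :: "'a::field ^ 'n ^ 'n::finite \<Rightarrow> ('a \<Rightarrow> bool) \<Rightarrow> ('a ^ 'n) set"
  where "gen_space M S =
    {x. \<exists>p. p \<noteq> 0 \<and> (\<forall>a. poly p a = 0 \<longrightarrow> S a) \<and> matpoly M p *v x = 0}"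

lemma subspace_gen_space: "vec.subspace (gen_space M S)"
  unfolding vec.subspace_def
proof (intro conjI ballI allI)
  show "0 \<in> gen_space M S" by (auto simp: gen_space_def intro!: exI[of _ 1])
  fix x y assume "x \<in> gen_space M S" "y \<in> gen_space M S"
  then obtain p q where "p \<noteq> 0" "q \<noteq> 0" "\<forall>a. poly p a = 0 \<longrightarrow> S a" "\<forall>a. poly q a = 0 \<longrightarrow> S a"
    and pq: "matpoly M p *v x = 0" "matpoly M q *v y = 0"
    by (auto simp: gen_space_def)
  moreover have "matpoly M (p * q) *v (x + y) = 0"
    using pq by (simp add: matrix_vector_right_distrib matpoly_mult_vector_eq_0)
  ultimately show "x + y \<in> gen_space M S"
    by (auto simp: gen_space_def intro!: exI[of _ "p * q"])
next
  fix c x assume "x \<in> gen_space M S"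
  then show "c *s x \<in> gen_space M S" by (auto simp: gen_space_def vec.scale)
qed

lemma gen_space_commute:
  assumes "M ** B = B ** M" "x \<in> gen_space M S"
  shows "B *v x \<in> gen_space M S"
proof -
  obtain p where p: "p \<noteq> 0" "\<forall>a. poly p a = 0 \<longrightarrow> S a" "matpoly M p *v x = 0"
    using assms(2) by (auto simp: gen_space_def)
  have "matpoly M p *v (B *v x) = 0"
    using matpoly_commute[OF assms(1), of p] p(3)
    by (metis matrix_vector_mul_assoc matrix_vector_mult_0_right)
  with p show ?thesis by (auto simp: gen_space_def)
qed

text \<open>Split an annihilating polynomial of \<open>x\<close> into coprime factors p1 and p2 by
  their roots. With u p1 + v p2 = 1, the component v p2 applied to \<open>x\<close> is killed by p1,
  and the other one by p2.\<close>

lemma gen_space_decomp: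
  fixes M :: "'a::alg_closed_field ^ 'n ^ 'n::finite"
  shows "\<exists>y z. x = y + z \<and> y \<in> gen_space M S \<and> z \<in> gen_space M (\<lambda>a. \<not> S a)"
proof -
  obtain p where p: "p \<noteq> 0" "matpoly M p *v x = 0" using annihilating_poly_vector by blast
  then obtain p1 p2 where p12: "p = p1 * p2" "\<forall>x. poly p1 x = 0 \<longrightarrow> S x" "\<forall>x. poly p2 x = 0 \<longrightarrow> \<not> S x"
    using poly_split_roots by metis
  then obtain u v where uv: "u * p1 + v * p2 = 1"
    using bezout_no_common_root[of p1 p2] p(1) by auto
  have "x = matpoly M (v * p2) *v x + matpoly M (u * p1) *v x"
    by (simp only: matpoly_add_vector[symmetric] add.commute[of "v * p2"] uv matpoly_1 matrix_vector_mul_lid)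
  moreover have "p1 * (v * p2) = v * p" "p2 * (u * p1) = u * p"
    by (simp_all add: p12(1))
  then have "matpoly M p1 *v (matpoly M (v * p2) *v x) = 0" "matpoly M p2 *v (matpoly M (u * p1) *v x) = 0"
    using p(2) by (simp_all only: matpoly_mult_vector[symmetric]) (simp_all add: matpoly_mult_vector_eq_0)
  then have "matpoly M (v * p2) *v x \<in> gen_space M S" "matpoly M (u * p1) *v x \<in> gen_space M (\<lambda>a. \<not> S a)"
    using p p12 by (auto simp: gen_space_def)
  ultimately show ?thesis by blast
qed

lemma gen_space_disjoint:
  fixes M :: "'a::alg_closed_field ^ 'n ^ 'n::finite"
  assumes "x \<in> gen_space M S" "x \<in> gen_space M (\<lambda>a. \<not> S a)"
  shows "x = 0"
proof -
  obtain p q where p: "p \<noteq> 0" "\<forall>a. poly p a = 0 \<longrightarrow> S a" "matpoly M p *v x = 0"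
    and q: "q \<noteq> 0" "\<forall>a. poly q a = 0 \<longrightarrow> \<not> S a" "matpoly M q *v x = 0"
    using assms by (auto simp: gen_space_def)
  then obtain u v where uv: "u * p + v * q = 1"
    using bezout_no_common_root[of p q] by auto
  have "x = matpoly M (u * p + v * q) *v x" by (simp add: uv)
  also have "\<dots> = 0" by (simp add: matpoly_add_vector matpoly_mult_vector p q)
  finally show ?thesis .
qed

text \<open>From c M N = N M follows p(cM) N = N p(M). So if p(M) kills \<open>x\<close>, then
  p(cX), whose roots are those of \<open>p\<close> divided by c, kills N x.\<close>

lemma gen_space_shift:
  fixes M N :: "'a::field_char_0 ^ 'n ^ 'n::finite"
  assumes MN: "mat c ** M ** N = N ** M" and "c \<noteq> 0"
    and S: "\<And>a. S (c * a) \<Longrightarrow> T a" and x: "x \<in> gen_space M S"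
  shows "N *v x \<in> gen_space M T"
proof -
  obtain p where p: "p \<noteq> 0" "\<forall>a. poly p a = 0 \<longrightarrow> S a" "matpoly M p *v x = 0"
    using x by (auto simp: gen_space_def)
  have "matpoly (mat c ** M) r ** N = N ** matpoly M r" for r
  proof (induction r)
    case (pCons a r)
    have "mat c ** M ** matpoly (mat c ** M) r ** N = N ** (M ** matpoly M r)"
      by (metis MN matrix_mul_assoc pCons.IH)
    then show ?case by (simp add: matrix_add_ldistrib matrix_add_rdistrib mat_commute[of _ N])
  qed simp
  then have "matpoly M (pcompose p [:0, c:]) *v (N *v x) = 0"
    using p(3) unfolding matpoly_pcompose by (metis matrix_vector_mul_assoc matrix_vector_mult_0_right)
  \<comment> \<open>At z / c the composite takes the value p(z), so its vanishing would make
    \<open>p\<close> zero on an infinite field.\<close>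
  moreover have "pcompose p [:0, c:] \<noteq> 0"
  proof
    assume "pcompose p [:0, c:] = 0"
    then have "poly p (c * (z / c)) = 0" for z
      by (metis poly_pcompose poly_0 poly_pCons mult.commute add_0 mult_zero_right add_0_right)
    then show False using p(1) \<open>c \<noteq> 0\<close> poly_all_0_iff_0 by auto
  qed
  moreover have "poly (pcompose p [:0, c:]) a = 0 \<Longrightarrow> T a" for a
    using p(2) S by (simp add: poly_pcompose mult.commute)
  ultimately show ?thesis by (auto simp: gen_space_def)
qed

text \<open>For the inclusion from right to left, a root \<open>a\<close> is split off with its full
  multiplicity k. The cofactor is then coprime to (X - a)^k, and Bezout writes \<open>x\<close> as a
  vector killed by that power plus one killed by a polynomial of smaller degree.\<close>

lemma span_gen_eigenspaces:
  fixes M :: "'a::alg_closed_field ^ 'n ^ 'n::finite"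
  shows "vec.span (\<Union>a\<in>{a. is_eigenvalue M a \<and> S a}. gen_eigenspace M a) = gen_space M S"
    (is "vec.span ?U = _")
proof
  have pow: "matpoly M ([:- a, 1:] ^ m) *v x = ((\<lambda>y. M *v y - a *s y) ^^ m) x" for a m x
    by (induction m) (simp_all add: matpoly_mult_vector matpoly_linear_vector del: matpoly_pCons mult_pCons_left)
  have root: "b = a" if "poly ([:- a, 1:] ^ m) b = 0" for a b :: 'a and m
    using that by (simp add: poly_power)
  show "vec.span ?U \<subseteq> gen_space M S"
  proof (rule vec.span_minimal[OF _ subspace_gen_space], safe)
    fix x a assume "S a" "x \<in> gen_eigenspace M a"
    then obtain m where "matpoly M ([:- a, 1:] ^ m) *v x = 0" by (auto simp: gen_eigenspace_def pow)
    then show "x \<in> gen_space M S"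
      unfolding gen_space_def using \<open>S a\<close> root by (auto intro!: exI[of _ "[:- a, 1:] ^ m"])
  qed
  have "x \<in> vec.span ?U"
    if "p \<noteq> 0" "\<forall>a. poly p a = 0 \<longrightarrow> S a" "matpoly M p *v x = 0" for p x
    using that
  proof (induction "degree p" arbitrary: p x rule: less_induct)
    case less
    show ?case
    proof (cases "degree p = 0")
      case True
      then obtain c where "p = [:c:]" by (auto elim: degree_eq_zeroE)
      then show ?thesis using less.prems by (auto simp: mat_vector_mult vec.span_zero)
    next
      case False
      then obtain a where a: "poly p a = 0" using alg_closed_imp_poly_has_root by blast
      define k where "k = Polynomial.order a p"
      have k: "k > 0" using a less.prems(1) by (simp add: k_def order_root)
      obtain q where q: "p = [:- a, 1:] ^ k * q" "\<not> [:- a, 1:] dvd q"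
        using order_decomp[OF less.prems(1), of a] by (auto simp: k_def)
      have "q \<noteq> 0" using q less.prems by auto
      have "degree q < degree p"
        unfolding q(1) using k \<open>q \<noteq> 0\<close> by (subst degree_mult_eq) (auto simp: degree_power_eq)
      have "poly q a \<noteq> 0" using q(2) by (simp add: poly_eq_0_iff_dvd)
      then obtain u v where uv: "u * [:- a, 1:] ^ k + v * q = 1"
        using bezout_no_common_root[of "[:- a, 1:] ^ k" q] \<open>q \<noteq> 0\<close> root by blast
      define y z where "y = matpoly M (u * [:- a, 1:] ^ k) *v x" and "z = matpoly M (v * q) *v x"
      have xyz: "x = y + z"
        unfolding y_def z_def by (simp only: matpoly_add_vector[symmetric] uv matpoly_1 matrix_vector_mul_lid)
      have "q * (u * [:- a, 1:] ^ k) = u * p" "[:- a, 1:] ^ k * (v * q) = v * p"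
        by (simp_all add: q(1) mult_ac)
      then have y: "matpoly M q *v y = 0" and z: "matpoly M ([:- a, 1:] ^ k) *v z = 0"
        unfolding y_def z_def using less.prems(3) by (simp_all only: matpoly_mult_vector[symmetric]) (simp_all add: matpoly_mult_vector_eq_0)
      have "y \<in> vec.span ?U"
        using less.hyps[OF \<open>degree q < degree p\<close> \<open>q \<noteq> 0\<close> _ y] less.prems(2) by (simp add: q(1))
      moreover have "z \<in> vec.span ?U"
      \<comment> \<open>A root of \<open>p\<close> need not be an eigenvalue of \<open>M\<close>; it
        is one as soon as its component \<open>z\<close> is nonzero.\<close>
      proof (cases "z = 0")
        case True
        then show ?thesis by (simp add: vec.span_zero)
      next
        case False
        then have "is_eigenvalue M a"
          using eigenvector_from_annihilating_poly[OF _ z False] root unfolding is_eigenvalue_def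
          by (metis pCons_eq_0_iff one_neq_zero power_not_zero)
        moreover have "z \<in> gen_eigenspace M a" using z by (auto simp: pow gen_eigenspace_def)
        ultimately show ?thesis using a less.prems(2) by (intro vec.span_base) auto
      qed
      ultimately show ?thesis unfolding xyz by (rule vec.span_add)
    qed
  qed
  then show "gen_space M S \<subseteq> vec.span ?U" by (auto simp: gen_space_def)
qed

text \<open>The product of annihilators over a basis kills the whole space. In one of minimal degree
  every root is an eigenvalue, since any other linear factor could be cancelled. Monic with all
  roots eigenvalues is what specialization requires: the coefficients lie in any ring containing the
  eigenvalues, and the image is nonzero.\<close>

lemma gen_space_annihilating_poly:
  fixes M :: "'a::alg_closed_field ^ 'n ^ 'n::finite"
  shows "\<exists>p. lead_coeff p = 1 \<and> (\<forall>a. poly p a = 0 \<longrightarrow> S a \<and> is_eigenvalue M a) \<and>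
    gen_space M S = {x. matpoly M p *v x = 0}"
proof -
  define P where "P p \<longleftrightarrow> p \<noteq> 0 \<and> (\<forall>a. poly p a = 0 \<longrightarrow> S a) \<and> (\<forall>x\<in>gen_space M S. matpoly M p *v x = 0)" for p
  obtain B where B: "B \<subseteq> gen_space M S" "vec.independent B" "gen_space M S \<subseteq> vec.span B"
    using vec.maximal_independent_subset by metis
  have "finite B" using B(2) by (rule vec.finiteI_independent)
  then have "\<exists>p. p \<noteq> 0 \<and> (\<forall>a. poly p a = 0 \<longrightarrow> S a) \<and> (\<forall>x\<in>B. matpoly M p *v x = 0)"
    using B(1)
  proof (induction B rule: finite_induct)
    case empty
    show ?case by (intro exI[of _ 1]) auto
  next
    case (insert b B)
    then obtain p q where p: "p \<noteq> 0" "\<forall>a. poly p a = 0 \<longrightarrow> S a" "\<forall>x\<in>B. matpoly M p *v x = 0"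
      and q: "q \<noteq> 0" "\<forall>a. poly q a = 0 \<longrightarrow> S a" "matpoly M q *v b = 0"
      by (auto simp: gen_space_def)
    have "matpoly M (p * q) *v x = 0" if "x \<in> insert b B" for x
      using that p(3) q(3) by (metis insert_iff matpoly_mult_vector mult.commute matrix_vector_mult_0_right)
    with p q show ?case by (intro exI[of _ "p * q"]) auto
  qed
  then obtain p where p: "p \<noteq> 0" "\<forall>a. poly p a = 0 \<longrightarrow> S a" "\<forall>x\<in>B. matpoly M p *v x = 0" by blast
  have "vec.span B \<subseteq> {x. matpoly M p *v x = 0}"
    using p(3) by (intro vec.span_minimal subspace_kernel) auto
  then have "P p" using p B(3) by (auto simp: P_def)
  then obtain p where p: "P p" "\<And>q. P q \<Longrightarrow> degree p \<le> degree q"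
    using ex_has_least_nat[of P p degree] by blast
  have ev: "is_eigenvalue M a" if a: "poly p a = 0" for a
  proof (rule ccontr)
    assume ne: "\<not> is_eigenvalue M a"
    obtain q where q: "p = [:- a, 1:] * q" using a by (auto simp: poly_eq_0_iff_dvd)
    have "q \<noteq> 0" using q p(1) by (auto simp: P_def)
    have "matpoly M q *v x = 0" if "x \<in> gen_space M S" for x
    proof (rule ccontr)
      assume "matpoly M q *v x \<noteq> 0"
      moreover have "M *v (matpoly M q *v x) - a *s (matpoly M q *v x) = 0"
        using that p(1) unfolding P_def q matpoly_mult_vector matpoly_linear_vector by blast
      ultimately show False using ne by (auto simp: is_eigenvalue_def)
    qed
    then have "P q" using p(1) \<open>q \<noteq> 0\<close> by (auto simp: P_def q)
    then have "degree p \<le> degree q" by (rule p(2))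
    then show False unfolding q using \<open>q \<noteq> 0\<close> by (subst (asm) degree_mult_eq) auto
  qed
  let ?p = "Polynomial.smult (inverse (lead_coeff p)) p"
  have "lead_coeff p \<noteq> 0" using p(1) by (simp add: P_def)
  then have "lead_coeff ?p = 1" "\<forall>a. poly ?p a = 0 \<longrightarrow> S a \<and> is_eigenvalue M a" "P ?p"
    using p(1) ev by (auto simp: P_def matpoly_smult simp flip: matrix_vector_mul_assoc)
  moreover from this have "gen_space M S = {x. matpoly M ?p *v x = 0}"
    unfolding P_def gen_space_def by blast
  ultimately show ?thesis by blast
qed

lemma finite_eigenvalues: "finite {a. is_eigenvalue (M :: 'a::alg_closed_field ^ 'n ^ 'n::finite) a}"
proof -
  obtain p where p: "lead_coeff p = 1" "gen_space M (\<lambda>_. True) = {x. matpoly M p *v x = 0}"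
    using gen_space_annihilating_poly[of "\<lambda>_. True" M] by blast
  have "poly p a = 0" if a: "is_eigenvalue M a" for a
  proof -
    obtain x where x: "x \<noteq> 0" "M *v x = a *s x" using a unfolding is_eigenvalue_def by blast
    have "x \<in> gen_space M (\<lambda>_. True)" using annihilating_poly_vector by (auto simp: gen_space_def)
    then show ?thesis using p(2) matpoly_eigenvector[OF x(2), of p] x(1) by auto
  qed
  moreover have "p \<noteq> 0" using p(1) by auto
  ultimately show ?thesis using poly_roots_finite[of p] by (auto intro: finite_subset[of _ "{x. poly p x = 0}"])
qed

section \<open>Extension of homomorphisms to eigenvalues\<close>

text \<open>Lets a natural number t be chosen such that g + t h stays nonzero at each of finitely
  many points where \<open>g\<close> or \<open>h\<close> is nonzero.\<close>

lemma finite_zeros_affine: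
  fixes a b :: "'b::field_char_0"
  assumes "a \<noteq> 0 \<or> b \<noteq> 0"
  shows "finite {t :: nat. a + of_nat t * b = 0}"
proof (cases "b = 0")
  case False
  have "s = t" if "a + of_nat s * b = 0" "a + of_nat t * b = 0" for s t :: nat
  proof -
    have "of_nat s * b = of_nat t * b" using that by (metis add_left_cancel)
    then show ?thesis using False by simp
  qed
  then have "{t :: nat. a + of_nat t * b = 0} \<subseteq> {SOME t. a + of_nat t * b = 0}"
    by (auto intro: someI2)
  then show ?thesis by (rule finite_subset) simp
qed (use assms in auto)

text \<open>
  If \<open>\<alpha>\<close> is an eigenvalue of \<open>M\<close> and \<open>g(\<alpha>) = 0\<close>, then \<open>det g(M) = 0\<close>, hence
  \<open>det (f g)(f M) = 0\<close> and \<open>f g\<close> vanishes at an eigenvalue of \<open>f M\<close>. As \<open>f M\<close> has finitely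
  many eigenvalues, one of them is a zero of \<open>f g\<close> for all such \<open>g\<close>, and \<open>\<alpha>\<close> may be sent to it.
\<close>

lemma extend_subring_hom:
  fixes M :: "'a::field ^ 'n ^ 'n::finite" and f :: "'a \<Rightarrow> 'b::{alg_closed_field, field_char_0}"
  assumes "subring_hom A f" and M: "\<And>i j. M $ i $ j \<in> A" and \<alpha>: "is_eigenvalue M \<alpha>"
  shows "\<exists>A' f'. subring_hom A' f' \<and> A \<subseteq> A' \<and> \<alpha> \<in> A' \<and> (\<forall>x\<in>A. f' x = f x)"
proof -
  interpret subring_hom A f by fact
  let ?fM = "map_matrix f M" and ?f = "map_poly f"
  define J where "J = {g. (\<forall>i. coeff g i \<in> A) \<and> poly g \<alpha> = 0}"
  define E where "E = {\<beta>. is_eigenvalue ?fM \<beta>}"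
  have root: "\<exists>\<beta>\<in>E. poly (?f g) \<beta> = 0" if g: "g \<in> J" for g
  proof (cases "?f g = 0")
    case True
    then show ?thesis using exists_eigenvalue[of ?fM] by (auto simp: E_def)
  next
    case False
    obtain x where x: "x \<noteq> 0" "M *v x = \<alpha> *s x" using \<alpha> by (auto simp: is_eigenvalue_def)
    have "matpoly M g *v x = 0" using matpoly_eigenvector[OF x(2), of g] g by (simp add: J_def)
    then have "\<not> invertible (matpoly M g)"
      using x(1) matrix_left_invertible_ker[of "matpoly M g"] by (auto simp: invertible_def)
    then have "det (matpoly M g) = 0" by (simp add: invertible_det_nz)
    moreover have "matpoly M g $ i $ j \<in> A" "map_matrix f (matpoly M g) = matpoly ?fM (?f g)" for i j
      using matpoly_mem_hom[of M g] M g by (auto simp: J_def)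
    ultimately have "det (matpoly ?fM (?f g)) = 0"
      using hom_det[of "matpoly M g"] by simp
    then have "\<nexists>B. B ** matpoly ?fM (?f g) = mat 1"
      by (metis invertible_det_nz invertible_left_inverse)
    then obtain y where "matpoly ?fM (?f g) *v y = 0" "y \<noteq> 0"
      using matrix_left_invertible_ker by blast
    then show ?thesis
      using eigenvector_from_annihilating_poly[OF False] unfolding E_def is_eigenvalue_def by blast
  qed
  have finE: "finite E" unfolding E_def by (rule finite_eigenvalues)
  \<comment> \<open>If every point of \<open>E\<close> were missed by some member of
    \<open>J\<close>, one member would miss all of them, against \<open>root\<close>. The
    coefficient t is a natural number because these lie in every subring.\<close>
  have comb: "\<exists>g\<in>J. \<forall>\<beta>\<in>T. poly (?f g) \<beta> \<noteq> 0"
    if "finite T" "\<And>\<beta>. \<beta> \<in> T \<Longrightarrow> \<exists>g\<in>J. poly (?f g) \<beta> \<noteq> 0" for T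
    using that
  proof (induction T rule: finite_induct)
    case empty
    have "0 \<in> J" by (simp add: J_def)
    then show ?case by blast
  next
    case (insert b T)
    then obtain g h where g: "g \<in> J" "\<forall>\<beta>\<in>T. poly (?f g) \<beta> \<noteq> 0" and h: "h \<in> J" "poly (?f h) b \<noteq> 0"
      by blast
    have "finite (\<Union>\<beta>\<in>insert b T. {t :: nat. poly (?f g) \<beta> + of_nat t * poly (?f h) \<beta> = 0})"
      using insert.hyps(1) g(2) h(2) by (intro finite_UN_I finite_zeros_affine) auto
    then obtain t :: nat where t: "\<And>\<beta>. \<beta> \<in> insert b T \<Longrightarrow> poly (?f g) \<beta> + of_nat t * poly (?f h) \<beta> \<noteq> 0"
      using ex_new_if_finite[OF infinite_UNIV_nat] by (metis (mono_tags, lifting) UN_I mem_Collect_eq)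
    let ?k = "g + [:of_nat t:] * h"
    have t': "coeff [:of_nat t:] i \<in> A" for i by (simp add: coeff_pCons split: nat.splits)
    have gA: "coeff g i \<in> A" and hA: "coeff h i \<in> A" for i using g h by (auto simp: J_def)
    note thA = coeff_mult_mem[OF t' hA]
    have "?f ?k = ?f g + ?f [:of_nat t:] * ?f h"
      by (simp only: map_poly_add[OF gA thA] map_poly_mult[OF t' hA])
    then have "?f ?k = ?f g + [:of_nat t:] * ?f h" by (simp add: map_poly_pCons)
    moreover have "?k \<in> J"
      using g h add_mem[OF gA thA] unfolding J_def by (simp del: mult_pCons_left)
    ultimately show ?case using t by (intro bexI[of _ ?k]) auto
  qed
  have "\<exists>\<beta>. \<forall>g\<in>J. poly (?f g) \<beta> = 0"
    using comb[OF finE] root by blast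
  then obtain \<beta> where \<beta>: "\<And>g. g \<in> J \<Longrightarrow> poly (?f g) \<beta> = 0" by blast
  define C where "C = {g. \<forall>i. coeff g i \<in> A}"
  define A' where "A' = (\<lambda>g. poly g \<alpha>) ` C"
  \<comment> \<open>Evaluate at \<open>\<beta>\<close> the image of any polynomial representing x at
    \<open>\<alpha>\<close>; the choice is harmless because two representatives differ by a member
    of \<open>J\<close>.\<close>
  define f' where "f' x = poly (?f (SOME g. g \<in> C \<and> poly g \<alpha> = x)) \<beta>" for x
  have f': "f' (poly g \<alpha>) = poly (?f g) \<beta>" if g: "g \<in> C" for g
  proof -
    define h where "h = (SOME h. h \<in> C \<and> poly h \<alpha> = poly g \<alpha>)"
    have h: "h \<in> C \<and> poly h \<alpha> = poly g \<alpha>" unfolding h_def by (rule someI[of _ g]) (use g in auto)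
    have "h - g \<in> J" using g h add_mem[OF _ minus_mem] by (force simp: J_def C_def)
    then have "poly (?f h - ?f g) \<beta> = 0" using g h \<beta> by (auto simp: C_def simp flip: map_poly_diff)
    then show ?thesis by (simp add: f'_def h_def)
  qed
  have C_add: "g + h \<in> C" and C_mult: "g * h \<in> C" if "g \<in> C" "h \<in> C" for g h
    using that by (auto simp: C_def add_mem coeff_mult_mem)
  have C_const: "[:a:] \<in> C" if "a \<in> A" for a
    using that by (simp add: C_def coeff_pCons split: nat.splits)
  have C_minus: "- g \<in> C" if "g \<in> C" for g
    using that by (auto simp: C_def minus_mem)
  have C_map: "?f (g + h) = ?f g + ?f h" "?f (g * h) = ?f g * ?f h" if "g \<in> C" "h \<in> C" for g h
    using that by (auto simp: C_def map_poly_add map_poly_mult)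
  have "subring_hom A' f'"
  proof
    show "1 \<in> A'" unfolding A'_def using C_const[of 1] by (auto intro!: image_eqI[of _ _ "[:1:]"])
    show "f' 1 = 1" using f'[OF C_const[of 1]] by (simp add: map_poly_pCons)
    show "- x \<in> A'" if x: "x \<in> A'" for x
    proof -
      obtain g where "g \<in> C" "x = poly g \<alpha>" using x by (auto simp: A'_def)
      then show ?thesis unfolding A'_def by (intro image_eqI[of _ _ "- g"]) (auto simp: C_minus)
    qed
    fix x y assume "x \<in> A'" "y \<in> A'"
    then obtain g h where gh: "g \<in> C" "h \<in> C" "x = poly g \<alpha>" "y = poly h \<alpha>" by (auto simp: A'_def)
    show "x + y \<in> A'" unfolding A'_def gh by (rule image_eqI[of _ _ "g + h"]) (auto simp: C_add gh)
    show "x * y \<in> A'" unfolding A'_def gh by (rule image_eqI[of _ _ "g * h"]) (auto simp: C_mult gh)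
    have "f' (x + y) = poly (?f (g + h)) \<beta>" "f' (x * y) = poly (?f (g * h)) \<beta>"
      unfolding gh by (simp_all only: poly_add[symmetric] poly_mult[symmetric] f' C_add C_mult gh)
    then show "f' (x + y) = f' x + f' y" "f' (x * y) = f' x * f' y"
      using gh by (simp_all add: C_map f')
  qed
  moreover have "A \<subseteq> A'"
  proof
    fix a assume "a \<in> A"
    then show "a \<in> A'" unfolding A'_def using C_const by (intro image_eqI[of _ _ "[:a:]"]) auto
  qed
  moreover have "f' a = f a" if "a \<in> A" for a
    using f'[OF C_const[OF that]] by (simp add: map_poly_pCons)
  moreover have "\<alpha> \<in> A'"
    unfolding A'_def by (rule image_eqI[of _ _ "[:0, 1:]"]) (auto simp: C_def coeff_pCons split: nat.splits)
  ultimately show ?thesis by blast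
qed

lemma extend_subring_hom_eigenvalues:
  fixes M :: "'a::alg_closed_field ^ 'n ^ 'n::finite" and f :: "'a \<Rightarrow> 'b::{alg_closed_field, field_char_0}"
  assumes f: "subring_hom A f" and M: "\<And>i j. M $ i $ j \<in> A"
  shows "\<exists>A' f'. subring_hom A' f' \<and> A \<subseteq> A' \<and> {a. is_eigenvalue M a} \<subseteq> A' \<and> (\<forall>x\<in>A. f' x = f x)"
proof -
  have "\<exists>A' f'. subring_hom A' f' \<and> A \<subseteq> A' \<and> T \<subseteq> A' \<and> (\<forall>x\<in>A. f' x = f x)"
    if "finite T" "T \<subseteq> {a. is_eigenvalue M a}" for T
    using that
  proof (induction T rule: finite_induct)
    case empty
    then show ?case using f by blast
  next
    case (insert a T)
    then obtain A1 f1 where 1: "subring_hom A1 f1" "A \<subseteq> A1" "T \<subseteq> A1" "\<forall>x\<in>A. f1 x = (f x :: 'b)" by auto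
    then obtain A2 f2 where "subring_hom A2 f2" "A1 \<subseteq> A2" "a \<in> A2" "\<forall>x\<in>A1. f2 x = (f1 x :: 'b)"
      using extend_subring_hom[OF 1(1), of M a] M insert.prems by blast
    with 1 show ?case by (intro exI[of _ A2] exI[of _ f2]) auto
  qed
  then show ?thesis using finite_eigenvalues[of M] by blast
qed

section \<open>Specialization of kernels\<close>

lemma dim_kernels_le:
  fixes f :: "'a::field \<Rightarrow> 'b::field" and \<B> :: "('a ^ 'n ^ 'n::finite) set"
  assumes "subring_hom A f" and \<B>: "\<And>B i j. B \<in> \<B> \<Longrightarrow> B $ i $ j \<in> A"
  shows "vec.dim {x. \<forall>B\<in>\<B>. B *v x = 0} \<le> vec.dim {x. \<forall>B\<in>\<B>. map_matrix f B *v x = 0}"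
proof -
  define R where "R = (\<Union>B\<in>\<B>. range (($) B))"
  have 1: "{x. \<forall>B\<in>\<B>. B *v x = 0} = null_space R"
    by (auto simp: null_space_def R_def vec_eq_iff matrix_vector_mult_form)
  have row: "map_matrix f B $ i = (\<chi> j. f (B $ i $ j))" for B :: "'a ^ 'n ^ 'n" and i
    by (simp add: vec_eq_iff)
  have 2: "{x. \<forall>B\<in>\<B>. map_matrix f B *v x = 0} = null_space ((\<lambda>r. \<chi> i. f (r $ i)) ` R)"
    by (auto simp: null_space_def R_def vec_eq_iff[where 'b = 'n and 'a = 'b] matrix_vector_mult_form row)
  show ?thesis unfolding 1 2 using \<B> by (intro dim_null_space_le[OF assms(1)]) (auto simp: R_def)
qed

text \<open>A monic split polynomial is the product of its factors X - a, and \<open>f\<close> sends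
  it to the product of the X - f a.\<close>

lemma monic_split_map_poly:
  fixes f :: "'a::alg_closed_field \<Rightarrow> 'b::field"
  assumes "subring_hom A f" "lead_coeff p = 1" "\<And>a. poly p a = 0 \<Longrightarrow> a \<in> A"
  shows "(\<forall>i. coeff p i \<in> A) \<and> map_poly f p \<noteq> 0 \<and>
    (\<forall>b. poly (map_poly f p) b = 0 \<longrightarrow> (\<exists>a. poly p a = 0 \<and> b = f a))"
  using assms(2,3)
proof (induction "degree p" arbitrary: p rule: less_induct)
  case less
  interpret subring_hom A f by fact
  show ?case
  proof (cases "degree p = 0")
    case True
    then have "p = 1" using less.prems(1) by (metis degree_eq_zeroE lead_coeff_pCons(2) one_pCons)
    then show ?thesis by (simp add: one_pCons coeff_pCons map_poly_pCons split: nat.splits)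
  next
    case False
    then obtain a where a: "poly p a = 0" using alg_closed_imp_poly_has_root by blast
    then obtain q where q: "p = [:- a, 1:] * q" by (auto simp: poly_eq_0_iff_dvd)
    have lq: "lead_coeff q = 1" using less.prems(1) unfolding q lead_coeff_mult by simp
    then have "q \<noteq> 0" by auto
    then have "degree q < degree p" unfolding q by (subst degree_mult_eq) auto
    then have IH: "\<And>i. coeff q i \<in> A" "map_poly f q \<noteq> 0"
      "\<And>b. poly (map_poly f q) b = 0 \<Longrightarrow> \<exists>a. poly q a = 0 \<and> b = f a"
      using less.hyps[of q] lq less.prems(2) by (auto simp: q)
    have "a \<in> A" using a less.prems(2) by blast
    then have lin: "coeff [:- a, 1:] i \<in> A" for i
      by (auto simp: coeff_pCons minus_mem split: nat.splits)
    have map: "map_poly f p = [:- f a, 1:] * map_poly f q"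
      unfolding q using \<open>a \<in> A\<close> by (subst map_poly_mult[OF lin IH(1)]) (simp add: map_poly_pCons hom_minus)
    have "coeff p i \<in> A" for i unfolding q using lin IH(1) by (rule coeff_mult_mem)
    moreover have "map_poly f p \<noteq> 0" unfolding map using IH(2) by (simp del: mult_pCons_left)
    moreover have "\<exists>c. poly p c = 0 \<and> b = f c" if "poly (map_poly f p) b = 0" for b
    proof -
      have "poly (map_poly f p) b = (b - f a) * poly (map_poly f q) b"
        by (simp add: map algebra_simps)
      then show ?thesis using that IH(3)[of b] a by (auto simp: q)
    qed
    ultimately show ?thesis by blast
  qed
qed

text \<open>Semicontinuity applies once the generic space is the kernel of p(M) for one monic
  \<open>p\<close> over \<open>A\<close>. The special kernel lies in the space for \<open>S\<close>
  because the roots of the image of \<open>p\<close> are images of roots of \<open>p\<close>. The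
  matrix \<open>D\<close> will cut out the inertia invariants.\<close>

lemma dim_gen_space_le:
  fixes f :: "'a::alg_closed_field \<Rightarrow> 'b::field" and M D :: "'a ^ 'n ^ 'n::finite"
  assumes "subring_hom A f" and M: "\<And>i j. M $ i $ j \<in> A" and D: "\<And>i j. D $ i $ j \<in> A"
    and ev: "{a. is_eigenvalue M a} \<subseteq> A"
  shows "vec.dim {x \<in> gen_space M (\<lambda>a. S (f a)). D *v x = 0}
    \<le> vec.dim {x \<in> gen_space (map_matrix f M) S. map_matrix f D *v x = 0}"
proof -
  interpret subring_hom A f by fact
  obtain p where p: "lead_coeff p = 1" "\<And>a. poly p a = 0 \<Longrightarrow> S (f a) \<and> is_eigenvalue M a"
    "gen_space M (\<lambda>a. S (f a)) = {x. matpoly M p *v x = 0}"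
    using gen_space_annihilating_poly[of "\<lambda>a. S (f a)" M] by blast
  have q: "\<And>i. coeff p i \<in> A" "map_poly f p \<noteq> 0"
    "\<And>b. poly (map_poly f p) b = 0 \<Longrightarrow> \<exists>a. poly p a = 0 \<and> b = f a"
    using monic_split_map_poly[OF assms(1) p(1)] p(2) ev by blast+
  have PM: "matpoly M p $ i $ j \<in> A" "map_matrix f (matpoly M p) = matpoly (map_matrix f M) (map_poly f p)" for i j
    using matpoly_mem_hom[of M p] M q(1) by auto
  have "vec.dim {x \<in> gen_space M (\<lambda>a. S (f a)). D *v x = 0} = vec.dim {x. \<forall>B\<in>{matpoly M p, D}. B *v x = 0}"
    unfolding p(3) by simp
  also have "\<dots> \<le> vec.dim {x. \<forall>B\<in>{matpoly M p, D}. map_matrix f B *v x = 0}"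
    by (rule dim_kernels_le[OF assms(1)]) (use PM D in auto)
  also have "\<dots> \<le> vec.dim {x \<in> gen_space (map_matrix f M) S. map_matrix f D *v x = 0}"
    using PM(2) q(2,3) p(2) by (intro vec.dim_subset) (force simp: gen_space_def)
  finally show ?thesis .
qed

section \<open>Averaging operators and complementary kernels\<close>

lemma dim_direct_sum:
  fixes U W :: "('a::field ^ 'n::finite) set"
  assumes "vec.subspace U" "vec.subspace W" "\<And>x. \<lbrakk>x \<in> U; x \<in> W\<rbrakk> \<Longrightarrow> x = 0"
  shows "vec.dim {x + y |x y. x \<in> U \<and> y \<in> W} = vec.dim U + vec.dim W"
proof -
  have "U \<inter> W \<subseteq> {0}" using assms(3) by auto
  then have "vec.dim (U \<inter> W) = 0" by simp
  then show ?thesis using vec.dim_sums_Int[OF assms(1,2)] by linarith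
qed

text \<open>\<open>E\<close> is m times a projector, like the sum over a group of order m. It is
  kept undivided so that its entries stay in the subring being specialized. The kernel of
  \<open>D\<close> is the image of the projector.\<close>

locale quasi_idempotent =
  fixes E :: "'a::field_char_0 ^ 'n ^ 'n::finite" and m :: nat
  assumes square: "E ** E = mat (of_nat m) ** E" and m_pos: "m > 0"
begin

definition "D = mat (of_nat m) - E"

lemma square_vector: "E *v (E *v x) = of_nat m *s (E *v x)"
  using square by (metis matrix_vector_mul_assoc mat_vector_mult)

lemma D_vector: "D *v x = of_nat m *s x - E *v x"
  by (simp add: D_def matrix_vector_mult_diff_rdistrib mat_vector_mult)

lemma dim_ker_sum: "vec.dim {x. D *v x = 0} + vec.dim {x. E *v x = 0} = CARD('n)"
proof -
  have "x \<in> {x + y |x y. x \<in> {x. D *v x = 0} \<and> y \<in> {x. E *v x = 0}}" for x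
  proof -
    \<comment> \<open>The image of x under the projector E / m.\<close>
    let ?y = "inverse (of_nat m) *s (E *v x)"
    have y: "E *v ?y = E *v x" using m_pos by (simp add: vec.scale square_vector)
    have "D *v ?y = 0" using y m_pos by (simp add: D_vector)
    moreover have "E *v (x - ?y) = 0" using y by (simp add: matrix_vector_mult_diff_distrib)
    moreover have "x = ?y + (x - ?y)" by simp
    ultimately show ?thesis by blast
  qed
  then have "{x + y |x y. x \<in> {x. D *v x = 0} \<and> y \<in> {x. E *v x = 0}} = UNIV" by blast
  moreover have "x = 0" if "D *v x = 0" "E *v x = 0" for x
    using that m_pos by (simp add: D_vector)
  ultimately show ?thesis
    using dim_direct_sum[OF subspace_kernel[of D] subspace_kernel[of E]] by (simp add: card_cart_basis)
qed

end

lemma D_commute: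
  fixes M :: "'a::field_char_0 ^ 'n ^ 'n::finite"
  assumes "quasi_idempotent E m" "E ** M = M ** E"
  shows "M ** quasi_idempotent.D E m = quasi_idempotent.D E m ** M"
proof -
  interpret quasi_idempotent E m by fact
  have "(M ** D) *v x = (D ** M) *v x" for x
  proof -
    have "M *v (E *v x) = E *v (M *v x)" using assms(2) by (metis matrix_vector_mul_assoc)
    then show ?thesis
      by (simp add: D_vector matrix_vector_mult_diff_distrib vec.scale flip: matrix_vector_mul_assoc)
  qed
  then show ?thesis by (simp add: matrix_eq)
qed

text \<open>If D (y + z) = 0 with y and z in the two complementary parts, then D y = - D z lies in
  both parts and vanishes, so the kernel of \<open>D\<close> splits along them.\<close>

lemma dim_gen_space_sum:
  fixes M :: "'a::{alg_closed_field, field_char_0} ^ 'n ^ 'n::finite"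
  assumes comm: "M ** D = D ** M"
  shows "vec.dim {x \<in> gen_space M S. D *v x = 0} + vec.dim {x \<in> gen_space M (\<lambda>a. \<not> S a). D *v x = 0}
    = vec.dim {x. D *v x = 0}"
proof -
  let ?U = "\<lambda>S. {x \<in> gen_space M S. D *v x = 0}"
  have sub: "vec.subspace (?U S)" for S
    using vec.subspace_inter[OF subspace_gen_space subspace_kernel[of D]] by (simp add: Int_def)
  have eq: "{x. D *v x = 0} = {x + y |x y. x \<in> ?U S \<and> y \<in> ?U (\<lambda>a. \<not> S a)}"
  proof (intro subset_antisym subsetI)
    fix x assume "x \<in> {x. D *v x = 0}"
    moreover obtain y z where yz: "x = y + z" "y \<in> gen_space M S" "z \<in> gen_space M (\<lambda>a. \<not> S a)"
      using gen_space_decomp by blast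
    ultimately have "D *v y + D *v z = 0" by (simp add: matrix_vector_right_distrib)
    moreover have D: "D *v y \<in> gen_space M S" "D *v z \<in> gen_space M (\<lambda>a. \<not> S a)"
      using gen_space_commute[OF comm] yz by auto
    ultimately have "D *v y \<in> gen_space M (\<lambda>a. \<not> S a)"
      using vec.subspace_neg[OF subspace_gen_space D(2)] by (metis eq_neg_iff_add_eq_0)
    then have "D *v y = 0" using D(1) gen_space_disjoint by blast
    with \<open>D *v y + D *v z = 0\<close> yz show "x \<in> {x + y |x y. x \<in> ?U S \<and> y \<in> ?U (\<lambda>a. \<not> S a)}" by auto
  qed (auto simp: matrix_vector_right_distrib)
  have "\<lbrakk>x \<in> ?U S; x \<in> ?U (\<lambda>a. \<not> S a)\<rbrakk> \<Longrightarrow> x = 0" for x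
    using gen_space_disjoint by blast
  then show ?thesis unfolding eq by (rule dim_direct_sum[OF sub sub, symmetric])
qed

lemma gen_space_mono_eigenvalues:
  fixes M :: "'a::alg_closed_field ^ 'n ^ 'n::finite"
  assumes "\<And>a. \<lbrakk>is_eigenvalue M a; S a\<rbrakk> \<Longrightarrow> T a"
  shows "gen_space M S \<subseteq> gen_space M T"
proof -
  obtain p where p: "lead_coeff p = 1" "\<And>a. poly p a = 0 \<Longrightarrow> S a \<and> is_eigenvalue M a"
    "gen_space M S = {x. matpoly M p *v x = 0}"
    using gen_space_annihilating_poly[of S M] by blast
  moreover have "p \<noteq> 0" using p(1) by auto
  ultimately show ?thesis using assms unfolding gen_space_def by blast
qed

section \<open>Weights and monodromy in the pure case\<close>

lemma matpoly_kernel_stable: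
  fixes M N :: "'a::field ^ 'n ^ 'n::finite"
  assumes MN: "mat c ** M ** N = N ** M" and z: "N *v z = 0"
  shows "N *v (matpoly M p *v z) = 0"
proof (induction p)
  case (pCons a p)
  have "N *v (M *v u) = c *s (M *v (N *v u))" for u
    by (metis MN mat_vector_mult matrix_vector_mul_assoc)
  then show ?case using pCons z
    by (simp add: matrix_vector_mult_add_rdistrib matrix_vector_right_distrib mat_vector_mult vec.scale
        flip: matrix_vector_mul_assoc)
qed simp

text \<open>The content of purity with an abstract notion of weight. If M x = a x, then c M N x = a
  N x, so \<open>N\<close> divides eigenvalues by c; as multiplication by c adds 2 to weights,
  \<open>N\<close> lowers them by 2.\<close>

locale weighted_monodromy =
  fixes M N :: "'a::{alg_closed_field, field_char_0} ^ 'n ^ 'n::finite"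
    and c :: 'a and wt :: "'a \<Rightarrow> int \<Rightarrow> bool" and w :: int
  assumes MN: "mat c ** M ** N = N ** M" and c: "c \<noteq> 0"
    and wt_shift: "\<And>a k. wt (c * a) k \<longleftrightarrow> wt a (k - 2)"
    and wt_exists: "\<And>a. is_eigenvalue M a \<Longrightarrow> \<exists>k. wt a k"
    and monodromy_bij: "\<And>i::nat. bij_betw ((\<lambda>x. N *v x) ^^ i)
      (gen_space M (\<lambda>a. wt a (w + int i))) (gen_space M (\<lambda>a. wt a (w - int i)))"
begin

text \<open>The two thresholds differ by the drop under \<open>N\<close>. Hence \<open>N\<close>
  maps the part for \<open>upper\<close> to that for \<open>lower\<close>, and the complement of the
  first to the complement of the second.\<close>

definition "upper a \<longleftrightarrow> (\<exists>k. k \<le> w + 1 \<and> wt a k)"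
definition "lower a \<longleftrightarrow> (\<exists>k. k \<le> w - 1 \<and> wt a k)"

lemma lower_iff: "lower a \<longleftrightarrow> upper (c * a)"
proof
  assume "lower a"
  then obtain k where "k \<le> w - 1" "wt a k" by (auto simp: lower_def)
  then show "upper (c * a)" using wt_shift[of a "k + 2"] unfolding upper_def by (intro exI[of _ "k + 2"]) auto
next
  assume "upper (c * a)"
  then obtain k where "k \<le> w + 1" "wt (c * a) k" by (auto simp: upper_def)
  then show "lower a" using wt_shift[of a k] unfolding lower_def by (intro exI[of _ "k - 2"]) auto
qed

lemma N_upper: "x \<in> gen_space M upper \<Longrightarrow> N *v x \<in> gen_space M lower"
  and N_not_upper: "x \<in> gen_space M (\<lambda>a. \<not> upper a) \<Longrightarrow> N *v x \<in> gen_space M (\<lambda>a. \<not> lower a)"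
  by (erule gen_space_shift[OF MN c, rotated], simp add: lower_iff)+

lemma N_decomp:
  assumes "N *v (y + z) \<in> gen_space M lower" "y \<in> gen_space M upper" "z \<in> gen_space M (\<lambda>a. \<not> upper a)"
  shows "N *v z = 0"
proof -
  have "N *v z = N *v (y + z) - N *v y" by (simp add: matrix_vector_right_distrib)
  then have "N *v z \<in> gen_space M lower"
    using assms(1) N_upper[OF assms(2)] by (simp add: vec.subspace_diff[OF subspace_gen_space])
  then show ?thesis using N_not_upper[OF assms(3)] gen_space_disjoint by blast
qed

text \<open>The kernel of \<open>N\<close> is stable under \<open>M\<close>, so a nonzero
  \<open>z\<close> would give an eigenvector \<open>e\<close> of \<open>M\<close> with N e = 0. Its
  weight k exceeds w + 1, and then the power k - w of \<open>N\<close> is injective on the part of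
  weight k, which contains \<open>e\<close>.\<close>

lemma N_inj_not_upper:
  assumes z: "z \<in> gen_space M (\<lambda>a. \<not> upper a)" "N *v z = 0"
  shows "z = 0"
proof (rule ccontr)
  assume "z \<noteq> 0"
  obtain p where "p \<noteq> 0" "matpoly M p *v z = 0" using annihilating_poly_vector by blast
  then obtain q a where qa: "matpoly M q *v z \<noteq> 0" "M *v (matpoly M q *v z) = a *s (matpoly M q *v z)"
    using eigenvector_from_annihilating_poly \<open>z \<noteq> 0\<close> by metis
  define e where "e = matpoly M q *v z"
  have e: "e \<noteq> 0" "M *v e = a *s e" using qa by (auto simp: e_def)
  have Ne: "N *v e = 0" unfolding e_def by (rule matpoly_kernel_stable[OF MN z(2)])
  have "M ** matpoly M q = matpoly M q ** M" using matpoly_commute[of M M q] by simp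
  then have e_not: "e \<in> gen_space M (\<lambda>a. \<not> upper a)"
    unfolding e_def using z(1) by (rule gen_space_commute)
  have e_mem: "e \<in> gen_space M S" if "S a" for S
    using e(2) that unfolding gen_space_def
    by (auto intro!: exI[of _ "[:- a, 1:]"] simp: matpoly_linear_vector simp del: matpoly_pCons)
  obtain k where k: "wt a k" using wt_exists e by (auto simp: is_eigenvalue_def)
  show False
  proof (cases "k \<le> w + 1")
    case True
    then have "e \<in> gen_space M upper" using k by (intro e_mem) (auto simp: upper_def)
    then show False using e_not e(1) gen_space_disjoint by blast
  next
    case False
    \<comment> \<open>Writing k - w as \<open>Suc i\<close> shows that \<open>N\<close> is applied
      to \<open>e\<close> at least once.\<close>
    define i where "i = nat (k - w - 1)"
    have k_eq: "k = w + int (Suc i)" using False by (simp add: i_def)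
    have "e \<in> gen_space M (\<lambda>a. wt a (w + int (Suc i)))" using k k_eq by (intro e_mem) auto
    moreover have "0 \<in> gen_space M (\<lambda>a. wt a (w + int (Suc i)))"
      by (rule vec.subspace_0[OF subspace_gen_space])
    moreover have N0: "((\<lambda>x. N *v x) ^^ n) 0 = 0" for n by (induction n) auto
    then have "((\<lambda>x. N *v x) ^^ Suc i) e = ((\<lambda>x. N *v x) ^^ Suc i) 0"
      by (simp add: funpow_Suc_right Ne del: funpow.simps)
    ultimately show False
      using monodromy_bij[of "Suc i"] e(1) unfolding bij_betw_def inj_on_def by blast
  qed
qed

lemma kernel_subset_upper: "N *v x = 0 \<Longrightarrow> x \<in> gen_space M upper"
proof -
  assume x: "N *v x = 0"
  obtain y z where yz: "x = y + z" "y \<in> gen_space M upper" "z \<in> gen_space M (\<lambda>a. \<not> upper a)"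
    using gen_space_decomp by blast
  have "N *v z = 0"
    using N_decomp[of y z] x yz vec.subspace_0[OF subspace_gen_space[of M lower]] by simp
  then have "z = 0" using N_inj_not_upper yz(3) by blast
  then show ?thesis using yz by simp
qed

lemma lower_subset_range: "gen_space M lower \<subseteq> range ((*v) N)"
proof -
  have "vec.span (\<Union>a\<in>{a. is_eigenvalue M a \<and> lower a}. gen_eigenspace M a) \<subseteq> range ((*v) N)"
  proof (rule vec.span_minimal)
    show "vec.subspace (range ((*v) N))"
      by (intro vec.linear_subspace_image matrix_vector_mul_linear_gen vec.subspace_UNIV)
    show "(\<Union>a\<in>{a. is_eigenvalue M a \<and> lower a}. gen_eigenspace M a) \<subseteq> range ((*v) N)"
    proof safe
      fix x a assume x: "is_eigenvalue M a" "lower a" "x \<in> gen_eigenspace M a"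
      then obtain k where k: "k \<le> w - 1" "wt a k" by (auto simp: lower_def)
      define i where "i = nat (w - k - 1)"
      have k_eq: "k = w - int (Suc i)" using k(1) by (simp add: i_def)
      have "x \<in> gen_space M (\<lambda>a. wt a (w - int (Suc i)))"
        using x k(2) unfolding span_gen_eigenspaces[symmetric] k_eq by (intro vec.span_base) auto
      then obtain y where "x = ((\<lambda>x. N *v x) ^^ Suc i) y"
        using monodromy_bij[of "Suc i"] unfolding bij_betw_def by blast
      then show "x \<in> range ((*v) N)" by simp
    qed
  qed
  then show ?thesis by (simp add: span_gen_eigenspaces)
qed

text \<open>Rank-nullity for \<open>N\<close> on the invariant vectors of \<open>upper\<close>.
  Purity speaks of all vectors only, so an invariant preimage has to be made: the
  \<open>upper\<close> component of any preimage still maps to y, and E / m, which commutes with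
  \<open>M\<close> and \<open>N\<close>, turns it into an invariant one.\<close>

lemma dim_upper_ge:
  assumes E: "quasi_idempotent E m" and comm: "E ** M = M ** E" "E ** N = N ** E"
  defines "K \<equiv> quasi_idempotent.D E m"
  shows "vec.dim {x. K *v x = 0 \<and> N *v x = 0} + vec.dim {x \<in> gen_space M lower. K *v x = 0}
    \<le> vec.dim {x \<in> gen_space M upper. K *v x = 0}" (is "_ + vec.dim ?V2 \<le> vec.dim ?V1")
proof -
  interpret quasi_idempotent E m by fact
  have K_vector: "K *v x = of_nat m *s x - E *v x" for x
    unfolding K_def by (rule D_vector)
  have ENv: "E *v (N *v x) = N *v (E *v x)" for x using comm(2) by (metis matrix_vector_mul_assoc)
  have sub: "vec.subspace ?V1"
    using vec.subspace_inter[OF subspace_gen_space subspace_kernel[of K]] by (simp add: Int_def)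
  have "?V2 \<subseteq> (*v) N ` ?V1"
  proof
    fix y assume y: "y \<in> ?V2"
    then obtain x where x: "y = N *v x" using lower_subset_range by blast
    obtain x1 x2 where x12: "x = x1 + x2" "x1 \<in> gen_space M upper" "x2 \<in> gen_space M (\<lambda>a. \<not> upper a)"
      using gen_space_decomp by blast
    have "N *v x2 = 0" using N_decomp[of x1 x2] x x12 y by auto
    then have Nx1: "N *v x1 = y" using x x12 by (simp add: matrix_vector_right_distrib)
    let ?x = "inverse (of_nat m) *s (E *v x1)"
    have "E *v y = of_nat m *s y" using y by (simp add: K_vector)
    then have "N *v ?x = y"
      using m_pos by (simp add: vec.scale ENv[symmetric] Nx1)
    moreover have "?x \<in> gen_space M upper"
      using gen_space_commute[OF comm(1)[symmetric] x12(2)] by (intro vec.subspace_scale subspace_gen_space)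
    moreover have "K *v ?x = 0" using m_pos by (simp add: K_vector vec.scale square_vector)
    ultimately show "y \<in> (*v) N ` ?V1" by blast
  qed
  then have "vec.dim ?V2 \<le> vec.dim ((*v) N ` ?V1)" by (rule vec.dim_subset)
  moreover have "{x \<in> ?V1. N *v x = 0} = {x. K *v x = 0 \<and> N *v x = 0}"
    using kernel_subset_upper by blast
  ultimately show ?thesis using dim_kernel_image[OF sub, of N] by simp
qed

end

lemma quasi_idempotent_specialization:
  fixes E :: "'a::field_char_0 ^ 'n ^ 'n::finite" and f :: "'a \<Rightarrow> 'b::field_char_0"
  assumes f: "subring_hom A f" and EA: "\<And>i j. E $ i $ j \<in> A" and E: "quasi_idempotent E m"
  shows quasi_idempotent_map: "quasi_idempotent (map_matrix f E) m"
    and D_mem: "quasi_idempotent.D E m $ i $ j \<in> A"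
    and map_D: "map_matrix f (quasi_idempotent.D E m) = quasi_idempotent.D (map_matrix f E) m"
    and dim_ker_D_map: "vec.dim {x. quasi_idempotent.D E m *v x = 0} =
      vec.dim {x. quasi_idempotent.D (map_matrix f E) m *v x = 0}"
proof -
  interpret subring_hom A f by fact
  interpret E: quasi_idempotent E m by fact
  have matA: "mat (of_nat m) $ i $ j \<in> A" for i j :: 'n by (simp add: mat_def)
  have "map_matrix f (mat (of_nat m) ** E) = mat (of_nat m) ** map_matrix f E"
    using map_matrix_mult[OF matA EA] by (simp add: map_matrix_mat)
  then show E': "quasi_idempotent (map_matrix f E) m"
    using E.m_pos E.square map_matrix_mult[OF EA EA] by unfold_locales simp_all
  interpret E': quasi_idempotent "map_matrix f E" m by fact
  show DA: "E.D $ i $ j \<in> A" for i j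
    unfolding E.D_def using add_mem[OF matA[of i j] minus_mem[OF EA[of i j]]] by simp
  show mapD: "map_matrix f E.D = E'.D"
    unfolding E.D_def E'.D_def using map_matrix_diff[OF matA EA] by (simp add: map_matrix_mat)
  have "vec.dim {x. E.D *v x = 0} \<le> vec.dim {x. E'.D *v x = 0}"
    using dim_kernels_le[OF f, of "{E.D}"] DA mapD by simp
  moreover have "vec.dim {x. E *v x = 0} \<le> vec.dim {x. map_matrix f E *v x = 0}"
    using dim_kernels_le[OF f, of "{E}"] EA by simp
  ultimately show "vec.dim {x. E.D *v x = 0} = vec.dim {x. E'.D *v x = 0}"
    using E.dim_ker_sum E'.dim_ker_sum by linarith
qed

text \<open>
  The eigenvalues of \<open>M\<close> get the weights of their images, so that the parts of weights at most
  \<open>w + 1\<close> and at most \<open>w - 1\<close> have the same dimensions before and after specialization. As \<open>N\<close>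
  maps the first part to the second, this bounds the generic kernel from below; purity makes the
  special kernel as small as the bound allows.
\<close>

theorem dim_kernel_specialization:
  fixes M N E :: "'a::{alg_closed_field, field_char_0} ^ 'n ^ 'n::finite"
    and f :: "'a \<Rightarrow> 'b::{alg_closed_field, field_char_0}"
  assumes f: "subring_hom A f"
    and MA: "\<And>i j. M $ i $ j \<in> A" and NA: "\<And>i j. N $ i $ j \<in> A" and EA: "\<And>i j. E $ i $ j \<in> A"
    and E: "quasi_idempotent E m" and comm: "E ** M = M ** E" "E ** N = N ** E"
    and MN: "mat (of_nat q) ** M ** N = N ** M"
    and pure: "weighted_monodromy (map_matrix f M) (map_matrix f N) (of_nat q) wt w"
  shows "vec.dim {x. E *v x = of_nat m *s x \<and> N *v x = 0} =
    vec.dim {x. map_matrix f E *v x = of_nat m *s x \<and> map_matrix f N *v x = 0}"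
proof -
  obtain A' f' where ext: "subring_hom A' f'" "A \<subseteq> A'" "{a. is_eigenvalue M a} \<subseteq> A'" "\<And>x. x \<in> A \<Longrightarrow> f' x = f x"
    using extend_subring_hom_eigenvalues[OF f MA] by metis
  interpret f': subring_hom A' f' by fact
  have same: "map_matrix f B = map_matrix f' B" if "\<And>i j. B $ i $ j \<in> A" for B :: "'a ^ 'n ^ 'n"
    using that ext(4) by (simp add: vec_eq_iff)
  let ?M = "map_matrix f' M" and ?N = "map_matrix f' N" and ?E = "map_matrix f' E"
  have maps: "map_matrix f M = ?M" "map_matrix f N = ?N" "map_matrix f E = ?E"
    using same MA NA EA by auto
  have MA': "M $ i $ j \<in> A'" and NA': "N $ i $ j \<in> A'" and EA': "E $ i $ j \<in> A'" for i j
    using MA NA EA ext(2) by auto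
  interpret pure: weighted_monodromy ?M ?N "of_nat q" wt w using pure unfolding maps .
  interpret E: quasi_idempotent E m by fact
  note spec = quasi_idempotent_specialization[OF ext(1) EA' E]
  note E' = spec(1) and DA' = spec(2) and mapD = spec(3)
  interpret E': quasi_idempotent ?E m by fact
  have comm': "?E ** ?M = ?M ** ?E" "?E ** ?N = ?N ** ?E"
    using comm f'.map_matrix_mult[OF EA' MA'] f'.map_matrix_mult[OF MA' EA']
      f'.map_matrix_mult[OF EA' NA'] f'.map_matrix_mult[OF NA' EA'] by simp_all
  have eigD: "{x. E *v x = of_nat m *s x \<and> N *v x = 0} = {x. E.D *v x = 0 \<and> N *v x = 0}"
    "{x. ?E *v x = of_nat m *s x \<and> ?N *v x = 0} = {x. E'.D *v x = 0 \<and> ?N *v x = 0}"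
    by (auto simp: E.D_vector E'.D_vector)
  define U where "U S = vec.dim {x \<in> gen_space M (\<lambda>a. S (f' a)). E.D *v x = 0}" for S
  define V where "V S = vec.dim {x \<in> gen_space ?M S. E'.D *v x = 0}" for S
  have le: "U S \<le> V S" for S
    unfolding U_def V_def mapD[symmetric] by (rule dim_gen_space_le[OF ext(1) MA' DA' ext(3)])
  have sums: "U S + U (\<lambda>a. \<not> S a) = V S + V (\<lambda>a. \<not> S a)" for S
    unfolding U_def V_def
    by (simp add: dim_gen_space_sum D_commute[OF E comm(1)] D_commute[OF E' comm'(1)] spec(4))
  \<comment> \<open>\<open>S\<close> and its complement satisfy the same inequality, and the two
    sides have equal sums.\<close>
  have UV: "U S = V S" for S
    using sums[of S] le[of S] le[of "\<lambda>a. \<not> S a"] by linarith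
  let ?U1 = "{x \<in> gen_space M (\<lambda>a. pure.upper (f' a)). E.D *v x = 0}"
  have sub: "vec.subspace ?U1"
    using vec.subspace_inter[OF subspace_gen_space subspace_kernel[of E.D]] by (simp add: Int_def)
  have "N *v x \<in> {x \<in> gen_space M (\<lambda>a. pure.lower (f' a)). E.D *v x = 0}" if x: "x \<in> ?U1" for x
  proof -
    have "of_nat q \<noteq> (0::'a)" using pure.c by simp
    then have "N *v x \<in> gen_space M (\<lambda>a. pure.upper (f' (of_nat q * a)))"
      using x by (intro gen_space_shift[OF MN, where S = "\<lambda>a. pure.upper (f' a)"]) auto
    \<comment> \<open>The values of f' are controlled on A' only, so the two predicates are compared
      just at the eigenvalues of \<open>M\<close>, which lie there.\<close>
    moreover have "gen_space M (\<lambda>a. pure.upper (f' (of_nat q * a))) \<subseteq> gen_space M (\<lambda>a. pure.lower (f' a))"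
      using ext(3) by (intro gen_space_mono_eigenvalues) (auto simp: pure.lower_iff f'.hom_mult)
    moreover have "E.D *v (N *v x) = 0"
    proof -
      have "E.D *v (N *v x) = N *v (E.D *v x)"
        using D_commute[OF E comm(2)] by (metis matrix_vector_mul_assoc)
      then show ?thesis using x by simp
    qed
    ultimately show ?thesis by blast
  qed
  then have "vec.dim ((*v) N ` ?U1) \<le> U pure.lower"
    unfolding U_def by (intro vec.dim_subset) blast
  moreover have "vec.dim {x \<in> ?U1. N *v x = 0} \<le> vec.dim {x. E.D *v x = 0 \<and> N *v x = 0}"
    by (rule vec.dim_subset) blast
  ultimately have "U pure.upper \<le> vec.dim {x. E.D *v x = 0 \<and> N *v x = 0} + U pure.lower"
    using dim_kernel_image[OF sub, of N] unfolding U_def by linarith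
  moreover have "vec.dim {x. E'.D *v x = 0 \<and> ?N *v x = 0} + V pure.lower \<le> V pure.upper"
    unfolding V_def using pure.dim_upper_ge[OF E' comm'] .
  moreover have "vec.dim {x. E.D *v x = 0 \<and> N *v x = 0} \<le> vec.dim {x. E'.D *v x = 0 \<and> ?N *v x = 0}"
    using dim_kernels_le[OF ext(1), of "{E.D, N}"] DA' NA' mapD by auto
  \<comment> \<open>The generic kernel has dimension at least
    \<open>V pure.upper - V pure.lower\<close>, the special one at most this, and semicontinuity
    makes the generic one no larger than the special one.\<close>
  ultimately show ?thesis unfolding maps eigD UV by linarith
qed

section \<open>Fixed spaces of finite matrix groups\<close>

locale finite_matrix_group =
  fixes H :: "('a::field_char_0 ^ 'n ^ 'n::finite) set"
  assumes finite: "finite H" and one: "mat 1 \<in> H"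
    and closed: "\<lbrakk>g \<in> H; h \<in> H\<rbrakk> \<Longrightarrow> g ** h \<in> H" and inv: "h \<in> H \<Longrightarrow> invertible h"
begin

text \<open>Left multiplication by \<open>h\<close> is injective and maps the finite set
  \<open>H\<close> into itself, so it permutes the summands.\<close>

lemma left_mult_sum: "h \<in> H \<Longrightarrow> h ** (\<Sum>H) = \<Sum>H"
proof -
  assume h: "h \<in> H"
  have "inj_on ((**) h) H"
    using inv[OF h] by (intro inj_onI) (metis invertible_def matrix_mul_assoc matrix_mul_lid)
  moreover have "(**) h ` H \<subseteq> H" using closed h by auto
  ultimately have "(**) h ` H = H" using finite by (simp add: card_image card_subset_eq)
  have "h ** (\<Sum>k\<in>K. k) = (\<Sum>k\<in>K. h ** k)" for K
    by (induction K rule: infinite_finite_induct) (simp_all add: matrix_add_ldistrib)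
  then have "h ** (\<Sum>H) = (\<Sum>k\<in>H. h ** k)" .
  also have "\<dots> = \<Sum>((**) h ` H)" using \<open>inj_on _ _\<close> by (simp add: sum.reindex)
  finally show ?thesis using \<open>_ ` H = H\<close> by simp
qed

lemma sum_mult: "(\<Sum>k\<in>K. F k) ** B = (\<Sum>k\<in>K. F k ** B)" for F :: "'c \<Rightarrow> 'a ^ 'n ^ 'n" and B :: "'a ^ 'n ^ 'n"
  by (induction K rule: infinite_finite_induct) (simp_all add: matrix_add_rdistrib)

lemma mult_sum: "B ** (\<Sum>k\<in>K. F k) = (\<Sum>k\<in>K. B ** F k)" for F :: "'c \<Rightarrow> 'a ^ 'n ^ 'n" and B :: "'a ^ 'n ^ 'n"
  by (induction K rule: infinite_finite_induct) (simp_all add: matrix_add_ldistrib)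

lemma quasi_idempotent_sum: "quasi_idempotent (\<Sum>H) (card H)"
proof
  have const: "(\<Sum>h\<in>K. B) = mat (of_nat (card K)) ** B" for K :: "('a ^ 'n ^ 'n) set" and B :: "'a ^ 'n ^ 'n"
    by (induction K rule: infinite_finite_induct)
      (simp_all add: mat_add matrix_add_rdistrib del: sum_constant)
  have "\<Sum>H ** \<Sum>H = (\<Sum>h\<in>H. h ** \<Sum>H)" by (rule sum_mult)
  also have "\<dots> = (\<Sum>h\<in>H. \<Sum>H)" by (simp add: left_mult_sum del: sum_constant)
  also have "\<dots> = mat (of_nat (card H)) ** \<Sum>H"
    by (rule const)
  finally show "\<Sum>H ** \<Sum>H = mat (of_nat (card H)) ** \<Sum>H" .
  show "card H > 0" using finite one by (auto simp: card_gt_0_iff)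
qed

lemma sum_commute:
  assumes "(\<lambda>h. B ** h) ` H = (\<lambda>h. h ** B) ` H" "invertible B"
  shows "\<Sum>H ** B = B ** \<Sum>H"
proof -
  have "inj_on (\<lambda>h. B ** h) H" "inj_on (\<lambda>h. h ** B) H"
    using assms(2) unfolding invertible_def inj_on_def
    by (metis matrix_mul_assoc matrix_mul_lid matrix_mul_rid)+
  then have "(\<Sum>h\<in>H. B ** h) = \<Sum>((\<lambda>h. B ** h) ` H)" "(\<Sum>h\<in>H. h ** B) = \<Sum>((\<lambda>h. h ** B) ` H)"
    by (simp_all add: sum.reindex)
  then show ?thesis using assms(1) by (simp add: sum_mult mult_sum)
qed

text \<open>A common fixed vector is multiplied by \<open>card H\<close>; conversely h E = E and
  \<open>card H\<close> is invertible. The sum is formed before \<open>f\<close> is applied: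
  distinct elements of \<open>H\<close> may get the same image, and they have to be counted
  separately to keep the factor \<open>card H\<close>. The identity as \<open>f\<close> gives the
  generic case.\<close>

lemma fixed_space_eq_ker:
  fixes f :: "'a \<Rightarrow> 'b::field_char_0"
  assumes "subring_hom A f" and HA: "\<And>h i j. h \<in> H \<Longrightarrow> h $ i $ j \<in> A"
  shows "{x. \<forall>h\<in>H. map_matrix f h *v x = x} = {x. map_matrix f (\<Sum>H) *v x = of_nat (card H) *s x}"
proof -
  interpret subring_hom A f by fact
  have EA: "(\<Sum>H) $ i $ j \<in> A" for i j using HA by (auto intro: sum_mem)
  have mapE: "map_matrix f (\<Sum>H) = (\<Sum>h\<in>H. map_matrix f h)"
    using HA by (simp add: vec_eq_iff hom_sum)
  have sum_vec: "(\<Sum>k\<in>K. F k) *v x = (\<Sum>k\<in>K. F k *v x)" for F :: "'a ^ 'n ^ 'n \<Rightarrow> 'b ^ 'n ^ 'n" and K x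
    by (induction K rule: infinite_finite_induct) (simp_all add: matrix_vector_mult_add_rdistrib)
  show ?thesis
  proof (intro subset_antisym subsetI CollectI ballI)
    fix x assume x: "x \<in> {x. \<forall>h\<in>H. map_matrix f h *v x = x}"
    have const: "(\<Sum>k\<in>K. x) = of_nat (card K) *s x" for K :: "('a ^ 'n ^ 'n) set"
      by (induction K rule: infinite_finite_induct)
        (simp_all add: vec_eq_iff algebra_simps del: sum_constant)
    have "map_matrix f (\<Sum>H) *v x = (\<Sum>h\<in>H. map_matrix f h *v x)" by (simp add: mapE sum_vec)
    also have "\<dots> = (\<Sum>h\<in>H. x)" using x by (intro sum.cong) auto
    finally show "map_matrix f (\<Sum>H) *v x = of_nat (card H) *s x" by (simp only: const)
  next
    fix x h assume x: "x \<in> {x. map_matrix f (\<Sum>H) *v x = of_nat (card H) *s x}" and h: "h \<in> H"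
    have hE: "map_matrix f h ** map_matrix f (\<Sum>H) = map_matrix f (\<Sum>H)"
      using map_matrix_mult[OF HA[OF h] EA] left_mult_sum[OF h] by simp
    have "of_nat (card H) *s (map_matrix f h *v x) = map_matrix f h *v (map_matrix f (\<Sum>H) *v x)"
      using x by (simp add: vec.scale)
    also have "\<dots> = map_matrix f (\<Sum>H) *v x"
      by (simp only: matrix_vector_mul_assoc hE)
    also have "\<dots> = of_nat (card H) *s x" using x by simp
    finally have "of_nat (card H) *s (map_matrix f h *v x) = of_nat (card H) *s x" .
    moreover have "of_nat (card H) \<noteq> (0::'b)" using finite one by auto
    ultimately show "map_matrix f h *v x = x" by simp
  qed
qed

end

text \<open>
  The fixed space of \<open>T\<close> is that of the monoid generated by \<open>T\<close>, which is a group as \<open>H\<close> is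
  finite. By semicontinuity neither the kernel of the averaging operator nor that of its
  complement can shrink under \<open>f\<close>, and their dimensions always add up to \<open>n\<close>.
\<close>

lemma (in finite_matrix_group) dim_fixed_space_map:
  fixes f :: "'a \<Rightarrow> 'b::field_char_0"
  assumes f: "subring_hom A f" and HA: "\<And>h i j. h \<in> H \<Longrightarrow> h $ i $ j \<in> A" and T: "T \<subseteq> H"
  shows "vec.dim {x. \<forall>h\<in>T. h *v x = x} = vec.dim {x. \<forall>h\<in>T. map_matrix f h *v x = x}"
proof -
  interpret subring_hom A f by fact
  define \<K> where "\<K> = {K. K \<subseteq> H \<and> T \<subseteq> K \<and> mat 1 \<in> K \<and> (\<forall>g\<in>K. \<forall>h\<in>K. g ** h \<in> K)}"
  define K where "K = \<Inter>\<K>"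
  have "H \<in> \<K>" using T one closed by (auto simp: \<K>_def)
  then have KH: "K \<subseteq> H" by (auto simp: K_def)
  interpret K: finite_matrix_group K
  proof
    show "finite K" using KH finite by (rule finite_subset)
    show "invertible h" if "h \<in> K" for h using that KH inv by auto
  qed (auto simp: K_def \<K>_def)
  have TK: "T \<subseteq> K" by (auto simp: K_def \<K>_def)
  have id: "map_matrix (\<lambda>x. x) B = B" for B :: "'a ^ 'n ^ 'n" by (simp add: vec_eq_iff)
  have gen: "{x. \<forall>h\<in>T. map_matrix g h *v x = x} = {x. \<forall>h\<in>K. map_matrix g h *v x = x}"
    if g: "subring_hom A g" for g :: "'a \<Rightarrow> 'c::field_char_0"
  proof (intro subset_antisym subsetI CollectI ballI)
    interpret g: subring_hom A g by fact
    fix x h assume x: "x \<in> {x. \<forall>h\<in>T. map_matrix g h *v x = x}" and h: "h \<in> K"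
    have "map_matrix g (a ** b) *v x = map_matrix g a *v (map_matrix g b *v x)"
      if "a \<in> H" "b \<in> H" for a b
      using g.map_matrix_mult[OF HA[OF that(1)] HA[OF that(2)]] by (simp add: matrix_vector_mul_assoc)
    \<comment> \<open>Minimality of \<open>K\<close> replaces an induction over words in
      \<open>T\<close>.\<close>
    then have "{h \<in> H. map_matrix g h *v x = x} \<in> \<K>"
      using x T one closed unfolding \<K>_def by (auto simp: g.map_matrix_mat)
    then show "map_matrix g h *v x = x" using h by (auto simp: K_def)
  qed (use TK in auto)
  have idh: "subring_hom A (\<lambda>x. x)"
    by unfold_locales (auto intro: minus_mem add_mem mult_mem)
  have KA: "\<And>h i j. h \<in> K \<Longrightarrow> h $ i $ j \<in> A" using KH HA by auto
  have EA: "(\<Sum>K) $ i $ j \<in> A" for i j using KA by (auto intro: sum_mem)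
  interpret E: quasi_idempotent "\<Sum>K" "card K" by (rule K.quasi_idempotent_sum)
  interpret E': quasi_idempotent "map_matrix f (\<Sum>K)" "card K"
    by (rule quasi_idempotent_map[OF f EA K.quasi_idempotent_sum])
  have "{x. \<forall>h\<in>T. h *v x = x} = {x. E.D *v x = 0}"
    using gen[OF idh] K.fixed_space_eq_ker[OF idh KA] by (auto simp: id E.D_vector)
  moreover have "{x. \<forall>h\<in>T. map_matrix f h *v x = x} = {x. E'.D *v x = 0}"
    using gen[OF f] K.fixed_space_eq_ker[OF f KA] by (auto simp: E'.D_vector)
  ultimately show ?thesis using dim_ker_D_map[OF f EA K.quasi_idempotent_sum] by simp
qed

section \<open>Non-archimedean absolute values\<close>

locale nonarch_field =
  fixes v :: "'a::field \<Rightarrow> real"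
  assumes nonarch: "nonarch_abs v"
begin

lemma nonneg [simp]: "0 \<le> v x"
  and eq_0_iff [simp]: "v x = 0 \<longleftrightarrow> x = 0"
  and mult: "v (x * y) = v x * v y"
  and add_le_max: "v (x + y) \<le> max (v x) (v y)"
  using nonarch by (auto simp: nonarch_abs_def)

lemma zero [simp]: "v 0 = 0" by simp

lemma one [simp]: "v 1 = 1"
  using mult[of 1 1] by simp

lemma power: "v (x ^ n) = v x ^ n"
  by (induction n) (auto simp: mult)

lemma minus [simp]: "v (- x) = v x"
proof -
  have "v (- 1) * v (- 1) = 1" using mult[of "- 1" "- 1"] by simp
  then have "v (- 1) = 1" using nonneg[of "- 1"] by (metis abs_of_nonneg abs_square_eq_1 power2_eq_square)
  then show ?thesis using mult[of "- 1" x] by simp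
qed

lemma diff_le_max: "v (x - y) \<le> max (v x) (v y)"
  using add_le_max[of x "- y"] by simp

lemma diff_commute: "v (x - y) = v (y - x)"
  using minus[of "x - y"] by simp

lemma pos_iff: "0 < v x \<longleftrightarrow> x \<noteq> 0"
  using nonneg[of x] eq_0_iff[of x] by linarith

lemma inverse: "v (inverse x) = inverse (v x)"
proof (cases "x = 0")
  case False
  then have "v (inverse x) * v x = 1" using mult[of "inverse x" x] by simp
  then show ?thesis using False by (simp add: field_simps)
qed simp

lemma add_eq_of_less: "v x < v y \<Longrightarrow> v (x + y) = v y"
  using add_le_max[of x y] diff_le_max[of "x + y" x] by auto

lemma sum_less: "\<lbrakk>0 < M; \<And>i. i \<in> I \<Longrightarrow> v (g i) < M\<rbrakk> \<Longrightarrow> v (sum g I) < M"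
proof (induction I rule: infinite_finite_induct)
  case (insert i I)
  then have "max (v (g i)) (v (sum g I)) < M" by simp
  with add_le_max[of "g i" "sum g I"] have "v (g i + sum g I) < M" by (rule le_less_trans)
  then show ?case using insert by simp
qed auto

text \<open>If the largest absolute value belonged to one term only, that term would dominate the
  others and the sum would be nonzero.\<close>

lemma two_maximal_terms:
  assumes I: "finite I" and sum: "sum g I = 0" and i0: "i0 \<in> I" "g i0 \<noteq> 0"
  shows "\<exists>i\<in>I. \<exists>j\<in>I. i \<noteq> j \<and> v (g i) = v (g j) \<and> g i \<noteq> 0"
proof -
  define m where "m = Max ((\<lambda>i. v (g i)) ` I)"
  have m: "v (g i) \<le> m" if "i \<in> I" for i using I that by (auto simp: m_def)
  have "m \<in> (\<lambda>i. v (g i)) ` I" unfolding m_def using I i0 by (intro Max_in) auto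
  then obtain i where i: "i \<in> I" "v (g i) = m" by auto
  have "0 < v (g i0)" using i0 by (simp add: pos_iff)
  then have m0: "0 < m" using m[OF i0(1)] by linarith
  show ?thesis
  proof (rule ccontr)
    assume "\<not> ?thesis"
    then have "v (g j) \<noteq> m" if "j \<in> I - {i}" for j using that i m0 by (metis DiffD1 DiffD2 eq_0_iff insertI1 less_irrefl)
    then have "v (sum g (I - {i})) < m" using m m0 by (intro sum_less) (auto simp: order.strict_iff_order)
    moreover have "g i + sum g (I - {i}) = 0" using sum I i(1) by (simp add: sum.remove)
    then have "v (sum g (I - {i})) = v (g i)" by (metis add_eq_0_iff minus)
    ultimately show False using i(2) by simp
  qed
qed

lemma power_cong:
  assumes "v (x - y) < 1" "v x \<le> 1" "v y \<le> 1"
  shows "v (x ^ n - y ^ n) < 1"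
proof (induction n)
  case (Suc n)
  have "x ^ Suc n - y ^ Suc n = x * (x ^ n - y ^ n) + (x - y) * y ^ n" by (simp add: algebra_simps)
  moreover have "v (x * (x ^ n - y ^ n)) < 1"
    using Suc assms(2) by (metis mult mult_left_le_one_le nonneg order.strict_trans1)
  moreover have "v ((x - y) * y ^ n) < 1"
    using assms by (metis mult mult_right_le_one_le nonneg order.strict_trans1 power power_le_one)
  ultimately show ?case using add_le_max[of "x * (x ^ n - y ^ n)" "(x - y) * y ^ n"] by auto
qed simp

lemma cong_trans: "\<lbrakk>v (x - y) < 1; v (y - z) < 1\<rbrakk> \<Longrightarrow> v (x - z) < 1"
  using add_le_max[of "x - y" "y - z"] by auto

lemma le_one_cong: "v (x - y) < 1 \<Longrightarrow> v x \<le> 1 \<longleftrightarrow> v y \<le> 1"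
  using add_le_max[of "x - y" y] diff_le_max[of x "x - y"] by auto

lemma less_one_cong: "v (x - y) < 1 \<Longrightarrow> v x < 1 \<longleftrightarrow> v y < 1"
  using add_le_max[of "x - y" y] diff_le_max[of x "x - y"] by auto

lemma power_le_one_iff: "n > 0 \<Longrightarrow> v (x ^ n) \<le> 1 \<longleftrightarrow> v x \<le> 1"
  by (metis nonneg not_le one_less_power power power_le_one)

lemma power_less_one_iff: "n > 0 \<Longrightarrow> v (x ^ n) < 1 \<longleftrightarrow> v x < 1"
  by (metis nonneg not_le one_le_power power power_less_one_iff)

end

text \<open>A rational number closer to \<open>x\<close> than \<open>a x\<close> has the same
  absolute value as \<open>x\<close>.\<close>

lemma padic_abs_value:
  assumes "padic_field l a" "x \<noteq> 0"
  shows "\<exists>e::int. a x = real l powi e"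
proof -
  interpret nonarch_field a using assms(1) by unfold_locales (simp add: padic_field_def)
  have "0 < a x" using assms(2) by (simp add: pos_iff)
  then obtain r where r: "a (x - of_rat r) < a x"
    using assms(1) unfolding padic_field_def by blast
  have "a (of_rat r) = a x"
    using add_eq_of_less[of "- (x - of_rat r)" x] r minus[of "x - of_rat r"] by simp
  moreover from this have "r \<noteq> 0" using assms(2) pos_iff[of x] by auto
  moreover have "a (of_rat r) = padic_abs_rat l r" using assms(1) by (simp add: padic_field_def)
  ultimately have "a x = real l powi (int (multiplicity (int l) (snd (quotient_of r)))
      - int (multiplicity (int l) (fst (quotient_of r))))" by (simp add: padic_abs_rat_def)
  then show ?thesis by blast
qed

section \<open>Automorphisms of the algebraic closure\<close>

lemma Gal_iff:
  "\<tau> \<in> Gal L \<longleftrightarrow> \<tau> \<in> extensional L \<and> bij_betw \<tau> L L \<and>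
    (\<forall>x\<in>L. \<forall>y\<in>L. \<tau> (x + y) = \<tau> x + \<tau> y \<and> \<tau> (x * y) = \<tau> x * \<tau> y) \<and> \<tau> 1 = 1 \<and>
    (\<forall>a. \<tau> (to_ac a) = to_ac a)"
  by (auto simp: Gal_def ring_iso_def ring_hom_def ring_of_type_algebra_def bij_betw_def)

lemma abs_GalD:
  assumes "\<sigma> \<in> abs_Gal"
  shows "bij \<sigma>" "\<sigma> (x + y) = \<sigma> x + \<sigma> y" "\<sigma> (x * y) = \<sigma> x * \<sigma> y" "\<sigma> 1 = 1"
    "\<sigma> (to_ac a) = to_ac a" "\<sigma> 0 = 0" "\<sigma> (- x) = - \<sigma> x" "\<sigma> (x - y) = \<sigma> x - \<sigma> y" "\<sigma> (x ^ n) = \<sigma> x ^ n"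
proof -
  show add: "\<sigma> (x + y) = \<sigma> x + \<sigma> y" for x y using assms by (simp add: Gal_iff)
  show "bij \<sigma>" "\<sigma> (to_ac a) = to_ac a" using assms by (auto simp: Gal_iff)
  show mult: "\<sigma> (x * y) = \<sigma> x * \<sigma> y" "\<sigma> 1 = 1" for x y using assms by (auto simp: Gal_iff)
  show zero: "\<sigma> 0 = 0" by (metis add add.right_neutral add_left_imp_eq)
  show neg: "\<sigma> (- x) = - \<sigma> x" for x using add[of x "- x"] zero by (metis add.right_inverse minus_unique)
  show "\<sigma> (x - y) = \<sigma> x - \<sigma> y" using add[of x "- y"] neg by simp
  show "\<sigma> (x ^ n) = \<sigma> x ^ n" by (induction n) (auto simp: mult)
qed

lemma id_abs_Gal: "(\<lambda>x. x) \<in> abs_Gal"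
  by (auto simp: Gal_iff bij_betw_def)

lemma comp_abs_Gal: "\<lbrakk>\<sigma> \<in> abs_Gal; \<tau> \<in> abs_Gal\<rbrakk> \<Longrightarrow> \<sigma> \<circ> \<tau> \<in> abs_Gal"
  by (auto simp: Gal_iff bij_comp)

lemma inv_abs_Gal:
  assumes "\<sigma> \<in> abs_Gal"
  shows "inv_into UNIV \<sigma> \<in> abs_Gal"
proof -
  note \<sigma> = abs_GalD[OF assms]
  have ieq: "inv_into UNIV \<sigma> y = x \<longleftrightarrow> y = \<sigma> x" for x y
    using \<sigma>(1) by (metis bij_inv_eq_iff)
  have \<sigma>i: "\<sigma> (inv_into UNIV \<sigma> y) = y" for y using ieq by metis
  show ?thesis
    using bij_imp_bij_inv[OF \<sigma>(1)] by (auto simp: Gal_iff ieq \<sigma>i \<sigma>)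
qed

lemma abs_Gal_poly:
  assumes "\<sigma> \<in> abs_Gal"
  shows "\<sigma> (poly (map_poly to_ac p) x) = poly (map_poly to_ac p) (\<sigma> x)"
  by (induction p) (auto simp: map_poly_pCons abs_GalD[OF assms])

definition annihilator :: "'k::field alg_closure \<Rightarrow> 'k poly"
  where "annihilator b = (SOME p. p \<noteq> 0 \<and> poly (map_poly to_ac p) b = 0)"

text \<open>The annihilator need not be the minimal polynomial, so this set may be larger than the
  Galois orbit; it serves as a finite set containing b and stable under automorphisms.\<close>

definition conjugates :: "'k::field alg_closure \<Rightarrow> 'k alg_closure set"
  where "conjugates b = {x. poly (map_poly to_ac (annihilator b)) x = 0}"

lemma annihilator: "annihilator b \<noteq> 0" "poly (map_poly to_ac (annihilator b)) b = 0"
proof -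
  have "\<exists>p. p \<noteq> 0 \<and> poly (map_poly to_ac p) b = 0"
    using alg_closure_algebraic[of b] by metis
  from someI_ex[OF this] show "annihilator b \<noteq> 0" "poly (map_poly to_ac (annihilator b)) b = 0"
    by (auto simp: annihilator_def)
qed

lemma map_poly_to_ac_eq_0_iff [simp]: "map_poly to_ac p = 0 \<longleftrightarrow> p = 0"
  by (metis coeff_map_poly to_ac_0 to_ac_eq_0_iff poly_eqI coeff_0)

lemma finite_conjugates [simp]: "finite (conjugates b)"
  unfolding conjugates_def by (rule poly_roots_finite) (simp add: annihilator)

lemma mem_conjugates: "b \<in> conjugates b"
  by (simp add: conjugates_def annihilator)

lemma Gal_mem_conjugates:
  assumes \<tau>: "\<tau> \<in> Gal L" and b: "b \<in> L" and L: "range to_ac \<subseteq> L"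
    "\<And>x y. \<lbrakk>x \<in> L; y \<in> L\<rbrakk> \<Longrightarrow> x + y \<in> L" "\<And>x y. \<lbrakk>x \<in> L; y \<in> L\<rbrakk> \<Longrightarrow> x * y \<in> L"
  shows "\<tau> b \<in> conjugates b"
proof -
  have "poly (map_poly to_ac p) b \<in> L \<and> \<tau> (poly (map_poly to_ac p) b) = poly (map_poly to_ac p) (\<tau> b)" for p
  proof (induction p)
    case 0
    have "to_ac 0 \<in> L" "\<tau> (to_ac 0) = to_ac 0" using \<tau> L by (auto simp: Gal_iff simp del: to_ac_0)
    then show ?case by simp
  next
    case (pCons a p)
    have "to_ac a \<in> L" "\<tau> (to_ac a) = to_ac a" using \<tau> L(1) by (auto simp: Gal_iff)
    moreover have "\<tau> (x + y) = \<tau> x + \<tau> y" "\<tau> (x * y) = \<tau> x * \<tau> y" if "x \<in> L" "y \<in> L" for x y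
      using \<tau> that by (auto simp: Gal_iff)
    ultimately show ?case using L(2,3) b pCons by (simp add: map_poly_pCons)
  qed
  from this[of "annihilator b"] have "poly (map_poly to_ac (annihilator b)) (\<tau> b) = \<tau> (to_ac 0)"
    by (simp add: annihilator)
  moreover have "\<tau> (to_ac 0) = to_ac 0" using \<tau> by (simp add: Gal_iff del: to_ac_0)
  ultimately show ?thesis by (simp add: conjugates_def)
qed

lemma abs_Gal_mem_conjugates: "\<tau> \<in> abs_Gal \<Longrightarrow> x \<in> conjugates b \<Longrightarrow> \<tau> x \<in> conjugates b"
  by (metis (mono_tags, lifting) abs_GalD(6) abs_Gal_poly conjugates_def mem_Collect_eq)

lemma vector_space_to_ac: "vector_space (\<lambda>(a::'k::field) x. to_ac a * x)"
  by unfold_locales (auto simp: algebra_simps)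

lemma span_agree:
  fixes \<sigma> \<tau> :: "'k::field alg_closure \<Rightarrow> 'k alg_closure"
  assumes "Modules.module.span (\<lambda>a x. to_ac a * x) B = L"
    and lin: "\<And>x y. \<lbrakk>x \<in> L; y \<in> L\<rbrakk> \<Longrightarrow> \<sigma> (x + y) = \<sigma> x + \<sigma> y"
      "\<And>a x. x \<in> L \<Longrightarrow> \<sigma> (to_ac a * x) = to_ac a * \<sigma> x" "\<sigma> 0 = 0"
      "\<And>x y. \<lbrakk>x \<in> L; y \<in> L\<rbrakk> \<Longrightarrow> \<tau> (x + y) = \<tau> x + \<tau> y"
      "\<And>a x. x \<in> L \<Longrightarrow> \<tau> (to_ac a * x) = to_ac a * \<tau> x" "\<tau> 0 = 0"
    and B: "\<And>b. b \<in> B \<Longrightarrow> \<sigma> b = \<tau> b" and x: "x \<in> L"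
  shows "\<sigma> x = \<tau> x"
proof -
  interpret K: vector_space "\<lambda>(a::'k) (x :: 'k alg_closure). to_ac a * x"
    by (rule vector_space_to_ac)
  have L: "L = K.span B" using assms(1) by simp
  have "x \<in> K.span B" using x L by simp
  then have "x \<in> L \<and> \<sigma> x = \<tau> x"
  proof (induction rule: K.span_induct_alt)
    case base
    show ?case using lin L K.span_zero by simp
  next
    case (step c b y)
    then have "b \<in> L" "y \<in> L" unfolding L by (auto intro: K.span_base)
    moreover from this have "to_ac c * b \<in> L" "to_ac c * b + y \<in> L"
      unfolding L by (auto intro: K.span_scale K.span_add)
    ultimately show ?case using step B lin by simp
  qed
  then show ?thesis by simp
qed

section \<open>The Weil group\<close>

locale local_field_frobenius = nonarch_field v for v :: "'k::field alg_closure \<Rightarrow> real" +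
  fixes \<phi> :: "'k alg_closure \<Rightarrow> 'k alg_closure"
  assumes \<phi>: "\<phi> \<in> abs_Gal" and frob: "acts_as_frob v \<phi> 1"
begin

definition "q = residue_card v"

text \<open>The value 0, which \<open>card\<close> gives to an infinite set, is excluded by
  Frobenius: the power x^(q^1) would be x^0 = 1, and the condition at x = 0 would read v 1 < 1. Then
  the classes of 0 and 1 give two elements.\<close>

lemma q_ge_2: "q \<ge> 2"
proof -
  have "q \<noteq> 0"
  proof
    assume "q = 0"
    then show False using frob[unfolded acts_as_frob_def, rule_format, of 0] by (simp add: q_def)
  qed
  define R where "R = {(x, y). v (to_ac x) \<le> 1 \<and> v (to_ac y) \<le> 1 \<and> v (to_ac (x - y)) < 1}"
  let ?Q = "{x :: 'k. v (to_ac x) \<le> 1} // R"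
  have q: "q = card ?Q" by (simp add: q_def residue_card_def R_def)
  have "R `` {0} \<in> ?Q" "R `` {1} \<in> ?Q" by (auto intro!: quotientI)
  moreover have "R `` {0} \<noteq> R `` {1}"
  proof -
    have "1 \<in> R `` {1}" "1 \<notin> R `` {0}" by (auto simp: R_def)
    then show ?thesis by auto
  qed
  moreover have "finite ?Q" using \<open>q \<noteq> 0\<close> q card.infinite by metis
  ultimately show ?thesis unfolding q
    by (metis card_le_Suc0_iff_eq not_less_eq_eq numeral_2_eq_2)
qed

text \<open>One formula for both signs of n: raising to a large power of q clears the negative
  exponents.\<close>

lemma acts_as_frob_power:
  assumes \<sigma>: "acts_as_frob v \<sigma> n" and K: "int K + n \<ge> 0" and x: "v x \<le> 1"
  shows "v (\<sigma> x ^ (q ^ nat (int K + n)) - x ^ (q ^ K)) < 1"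
proof (cases "n \<ge> 0")
  case True
  let ?N = "q ^ nat n"
  have "?N > 0" using q_ge_2 by simp
  have *: "v (\<sigma> x ^ ?N - x) < 1" using \<sigma> x True by (auto simp: acts_as_frob_def q_def)
  then have "v (\<sigma> x ^ ?N) \<le> 1" using x le_one_cong by blast
  then have "v ((\<sigma> x ^ ?N) ^ (q ^ K) - x ^ (q ^ K)) < 1" using * x by (intro power_cong)
  moreover have "nat (int K + n) = nat n + K" using True by simp
  ultimately show ?thesis by (simp add: power_add flip: power_mult)
next
  case False
  let ?N = "q ^ nat (- n)"
  have *: "v (\<sigma> x - x ^ ?N) < 1" using \<sigma> x False by (auto simp: acts_as_frob_def q_def)
  moreover have xN: "v (x ^ ?N) \<le> 1" using x by (simp add: power power_le_one)
  ultimately have "v (\<sigma> x) \<le> 1" using le_one_cong by blast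
  then have "v (\<sigma> x ^ (q ^ nat (int K + n)) - (x ^ ?N) ^ (q ^ nat (int K + n))) < 1"
    using * xN by (intro power_cong)
  moreover have "K = nat (- n) + nat (int K + n)" using False K by simp
  then have "q ^ K = ?N * q ^ nat (int K + n)" by (metis power_add)
  ultimately show ?thesis by (simp add: power_mult)
qed

lemma acts_as_frob_le_one:
  assumes \<sigma>: "acts_as_frob v \<sigma> n" and x: "v x \<le> 1"
  shows "v (\<sigma> x) \<le> 1"
proof -
  let ?K = "nat (- n)"
  have "v (\<sigma> x ^ (q ^ nat (int ?K + n)) - x ^ (q ^ ?K)) < 1"
    using \<sigma> x by (intro acts_as_frob_power) auto
  moreover have "v (x ^ (q ^ ?K)) \<le> 1" using x by (simp add: power power_le_one)
  ultimately have "v (\<sigma> x ^ (q ^ nat (int ?K + n))) \<le> 1" using le_one_cong by blast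
  moreover have "q ^ nat (int ?K + n) > 0" using q_ge_2 by simp
  ultimately show ?thesis by (simp add: power_le_one_iff)
qed

text \<open>
  If \<open>\<sigma>\<close> induced two different powers of Frobenius, then a power of Frobenius would be trivial
  on the residue field of the algebraic closure, contradicting the existence of a root of
  \<open>X\<^sup>a - X\<^sup>b - 1\<close> for powers \<open>a > b\<close> of \<open>q\<close>.
\<close>

lemma acts_as_frob_unique_less:
  assumes \<sigma>: "acts_as_frob v \<sigma> m" "acts_as_frob v \<sigma> n" and less: "m < n"
  shows False
proof -
  \<comment> \<open>Large enough for all exponents to be nonnegative. The congruence for m with
    exponent K + n - m and the one for n with exponent K involve the same power of
    \<open>\<sigma> x\<close>, which is thus congruent to both x^a and x^b.\<close>
  define K where "K = nat (- m)"
  define a b where "a = q ^ nat (int K + (n - m))" and "b = q ^ K"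
  have "b < a" unfolding a_def b_def
    using q_ge_2 less by (intro power_strict_increasing) auto
  define p :: "'k alg_closure poly" where "p = Polynomial.monom 1 a - Polynomial.monom 1 b - 1"
  have "b > 0" using q_ge_2 by (simp add: b_def)
  have "coeff p a = 1" using \<open>b < a\<close> \<open>b > 0\<close> by (simp add: p_def)
  then have "a \<le> degree p" by (intro le_degree) simp
  then have "degree p > 0" using \<open>b < a\<close> by simp
  then obtain x where "poly p x = 0" using alg_closed_imp_poly_has_root by blast
  then have x: "x ^ a = x ^ b + 1" by (simp add: p_def poly_monom algebra_simps)
  have vx: "v x \<le> 1"
  proof (rule ccontr)
    assume "\<not> v x \<le> 1"
    then have "v x ^ b < v x ^ a" "1 \<le> v x ^ b" using \<open>b < a\<close> by auto
    moreover have "v x ^ a \<le> max (v x ^ b) 1" using add_le_max[of "x ^ b" 1] by (simp add: x flip: power)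
    ultimately show False by simp
  qed
  let ?s = "\<sigma> x ^ (q ^ nat (int K + m))"
  have 1: "v (?s - x ^ b) < 1" unfolding b_def
    using \<sigma>(1) vx by (intro acts_as_frob_power) (auto simp: K_def)
  have 2: "v (\<sigma> x ^ (q ^ nat (int (nat (int K + (n - m))) + m)) - x ^ a) < 1" unfolding a_def
    using \<sigma>(1) vx less by (intro acts_as_frob_power) (auto simp: K_def)
  have 3: "v (\<sigma> x ^ (q ^ nat (int K + n)) - x ^ b) < 1" unfolding b_def
    using \<sigma>(2) vx less by (intro acts_as_frob_power) (auto simp: K_def)
  have "int (nat (int K + (n - m))) + m = int K + n" using less by simp
  then have "v (x ^ a - x ^ b) < 1"
    using 2 3 cong_trans diff_commute by metis
  then show False by (simp add: x)
qed

lemma acts_as_frob_unique: "\<lbrakk>acts_as_frob v \<sigma> m; acts_as_frob v \<sigma> n\<rbrakk> \<Longrightarrow> m = n"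
  using acts_as_frob_unique_less by (metis linorder_less_linear)

lemma weil_degI: "acts_as_frob v \<sigma> n \<Longrightarrow> weil_deg v \<sigma> = n"
  unfolding weil_deg_def by (blast intro: acts_as_frob_unique)

section \<open>Inertia and its conjugates under Frobenius\<close>

lemma inertia_acts_as_frob: "\<sigma> \<in> inertia v \<Longrightarrow> acts_as_frob v \<sigma> 0"
  by (auto simp: inertia_def acts_as_frob_def)

lemma inertia_subset_weil_group: "inertia v \<subseteq> weil_group v"
  using inertia_acts_as_frob by (auto simp: weil_group_def inertia_def)

lemma inertia_subset_abs_Gal: "inertia v \<subseteq> abs_Gal"
  by (auto simp: inertia_def)

lemma frobenius_mem_weil_group: "\<phi> \<in> weil_group v"
  using \<phi> frob by (auto simp: weil_group_def)

text \<open>Stands in for the invariance of \<open>v\<close> under automorphisms: if v x > 1, then 1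
  / x lies in the maximal ideal, hence so does its image, and the image of x is not
  integral.\<close>

lemma le_one_iff_of_le_one:
  assumes \<sigma>: "\<sigma> \<in> abs_Gal" and less: "\<And>x. v x < 1 \<Longrightarrow> v (\<sigma> x) < 1" and v: "v (\<sigma> x) \<le> 1"
  shows "v x \<le> 1"
proof (rule ccontr)
  assume "\<not> v x \<le> 1"
  then have "x \<noteq> 0" "v (inverse x) < 1" by (auto simp: inverse inverse_less_1_iff)
  then have "v (\<sigma> (inverse x)) < 1" using less by blast
  moreover have "\<sigma> (inverse x) * \<sigma> x = 1"
    using \<open>x \<noteq> 0\<close> abs_GalD(3,4)[OF \<sigma>] by (metis left_inverse)
  then have "v (\<sigma> (inverse x)) * v (\<sigma> x) = 1" by (simp flip: mult)
  ultimately show False using v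
    by (metis linorder_not_less mult_le_one mult_less_cancel_right1 nonneg order_less_le_trans mult_left_le less_irrefl)
qed

lemma inertia_less_one: "\<lbrakk>\<sigma> \<in> inertia v; v x < 1\<rbrakk> \<Longrightarrow> v (\<sigma> x) < 1"
  using less_one_cong[of "\<sigma> x" x] by (auto simp: inertia_def)

lemma frobenius_less_one_iff: "v x \<le> 1 \<Longrightarrow> v (\<phi> x) < 1 \<longleftrightarrow> v x < 1"
proof -
  assume x: "v x \<le> 1"
  then have "v (\<phi> x ^ q - x) < 1" using frob by (auto simp: acts_as_frob_def q_def)
  then have "v (\<phi> x ^ q) < 1 \<longleftrightarrow> v x < 1" by (rule less_one_cong)
  then show ?thesis using q_ge_2 by (simp add: power_less_one_iff)
qed

lemma frobenius_le_one_iff: "v (\<phi> x) \<le> 1 \<longleftrightarrow> v x \<le> 1"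
  using le_one_iff_of_le_one[OF \<phi>, of x] acts_as_frob_le_one[OF frob] frobenius_less_one_iff by force

lemma id_inertia: "(\<lambda>x. x) \<in> inertia v"
  using id_abs_Gal by (auto simp: inertia_def)

lemma comp_inertia:
  assumes "\<sigma> \<in> inertia v" "\<tau> \<in> inertia v"
  shows "\<sigma> \<circ> \<tau> \<in> inertia v"
proof -
  have "v (\<sigma> (\<tau> x) - x) < 1" if x: "v x \<le> 1" for x
  proof -
    have t: "v (\<tau> x - x) < 1" using assms(2) x by (auto simp: inertia_def)
    then have "v (\<tau> x) \<le> 1" using x le_one_cong by blast
    then have "v (\<sigma> (\<tau> x) - \<tau> x) < 1" using assms(1) by (auto simp: inertia_def)
    then show ?thesis using t cong_trans by blast
  qed
  then show ?thesis using assms comp_abs_Gal by (auto simp: inertia_def)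
qed

lemma abs_Gal_inv:
  assumes "\<sigma> \<in> abs_Gal"
  shows "\<sigma> (inv_into UNIV \<sigma> x) = x" "inv_into UNIV \<sigma> (\<sigma> x) = x"
  using abs_GalD(1)[OF assms] by (auto simp: bij_def surj_f_inv_f)

lemma inv_inertia:
  assumes "\<sigma> \<in> inertia v"
  shows "inv_into UNIV \<sigma> \<in> inertia v"
proof -
  have \<sigma>: "\<sigma> \<in> abs_Gal" using assms by (simp add: inertia_def)
  have "v (inv_into UNIV \<sigma> x - x) < 1" if x: "v x \<le> 1" for x
  proof -
    have "v (inv_into UNIV \<sigma> x) \<le> 1"
      using le_one_iff_of_le_one[OF \<sigma> inertia_less_one[OF assms], of "inv_into UNIV \<sigma> x"] x by (simp add: abs_Gal_inv[OF \<sigma>])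
    then have "v (\<sigma> (inv_into UNIV \<sigma> x) - inv_into UNIV \<sigma> x) < 1" using assms by (auto simp: inertia_def)
    then show ?thesis by (simp add: abs_Gal_inv[OF \<sigma>] diff_commute)
  qed
  then show ?thesis using inv_abs_Gal[OF \<sigma>] by (auto simp: inertia_def)
qed

lemma conj_inertia:
  assumes "\<sigma> \<in> inertia v"
  shows "\<phi> \<circ> \<sigma> \<circ> inv_into UNIV \<phi> \<in> inertia v" "inv_into UNIV \<phi> \<circ> \<sigma> \<circ> \<phi> \<in> inertia v"
proof -
  have \<sigma>: "\<sigma> \<in> abs_Gal" using assms by (simp add: inertia_def)
  note i = abs_Gal_inv[OF \<phi>] and \<phi>D = abs_GalD[OF \<phi>]
  have "v (\<phi> (\<sigma> (inv_into UNIV \<phi> x)) - x) < 1" if x: "v x \<le> 1" for x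
  proof -
    have "v (inv_into UNIV \<phi> x) \<le> 1" using x frobenius_le_one_iff[of "inv_into UNIV \<phi> x"] by (simp add: i)
    then have "v (\<sigma> (inv_into UNIV \<phi> x) - inv_into UNIV \<phi> x) < 1" using assms by (auto simp: inertia_def)
    then have "v (\<phi> (\<sigma> (inv_into UNIV \<phi> x) - inv_into UNIV \<phi> x)) < 1" by (subst frobenius_less_one_iff) auto
    then show ?thesis by (simp add: \<phi>D i)
  qed
  moreover have "v (inv_into UNIV \<phi> (\<sigma> (\<phi> x)) - x) < 1" if x: "v x \<le> 1" for x
  proof -
    let ?z = "inv_into UNIV \<phi> (\<sigma> (\<phi> x)) - x"
    have z: "\<phi> ?z = \<sigma> (\<phi> x) - \<phi> x" by (simp add: \<phi>D i)
    have "v (\<phi> x) \<le> 1" using x frobenius_le_one_iff by blast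
    then have "v (\<phi> ?z) < 1" unfolding z using assms by (auto simp: inertia_def)
    moreover from this have "v ?z \<le> 1" using frobenius_le_one_iff[of ?z] by simp
    ultimately show ?thesis using frobenius_less_one_iff by blast
  qed
  ultimately show "\<phi> \<circ> \<sigma> \<circ> inv_into UNIV \<phi> \<in> inertia v" "inv_into UNIV \<phi> \<circ> \<sigma> \<circ> \<phi> \<in> inertia v"
    using comp_abs_Gal[OF comp_abs_Gal[OF \<phi> \<sigma>] inv_abs_Gal[OF \<phi>]]
      comp_abs_Gal[OF comp_abs_Gal[OF inv_abs_Gal[OF \<phi>] \<sigma>] \<phi>] by (simp_all add: inertia_def)
qed

text \<open>
  Open sets of the Weil group have this property. Working with the fixators of finite sets instead
  of finite extensions avoids forming composita.
\<close>

definition locally_const :: "('k alg_closure \<Rightarrow> 'k alg_closure) set \<Rightarrow> bool"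
  where "locally_const U \<longleftrightarrow>
    (\<forall>u\<in>U. \<exists>B. finite B \<and> (\<forall>\<tau>\<in>inertia v. (\<forall>b\<in>B. \<tau> b = b) \<longrightarrow> u \<circ> \<tau> \<in> U))"

lemma generate_topology_locally_const:
  assumes "generate_topology_on \<S> U" "\<And>S. S \<in> \<S> \<Longrightarrow> locally_const S"
  shows "locally_const U"
  using assms(1)
proof (induction rule: generate_topology_on.induct)
  case Empty
  show ?case by (simp add: locally_const_def)
next
  case (Int a b)
  show ?case unfolding locally_const_def
  proof
    fix u assume "u \<in> a \<inter> b"
    then obtain B C where "finite B" "\<forall>\<tau>\<in>inertia v. (\<forall>b\<in>B. \<tau> b = b) \<longrightarrow> u \<circ> \<tau> \<in> a"
      "finite C" "\<forall>\<tau>\<in>inertia v. (\<forall>b\<in>C. \<tau> b = b) \<longrightarrow> u \<circ> \<tau> \<in> b"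
      using Int.IH unfolding locally_const_def by blast
    then show "\<exists>B. finite B \<and> (\<forall>\<tau>\<in>inertia v. (\<forall>b\<in>B. \<tau> b = b) \<longrightarrow> u \<circ> \<tau> \<in> a \<inter> b)"
      by (intro exI[of _ "B \<union> C"]) auto
  qed
next
  case (UN K)
  then show ?case unfolding locally_const_def by (meson UnionE UnionI)
next
  case (Basis s)
  then show ?case by (rule assms(2))
qed

lemma krull_locally_const: "openin krull_topology U \<Longrightarrow> locally_const U"
  unfolding krull_topology_def
proof (drule openin_topology_generated_by, erule generate_topology_locally_const, safe)
  fix L :: "'k alg_closure set" and \<sigma> :: "'k alg_closure \<Rightarrow> 'k alg_closure"
  assume L: "finite_intermediate L" and \<sigma>: "\<sigma> \<in> abs_Gal"
  obtain B where B: "finite B" "Modules.module.span (\<lambda>a x. to_ac a * x) B = L"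
    using L by (auto simp: finite_intermediate_def)
  show "locally_const {\<tau> \<in> abs_Gal. \<forall>x\<in>L. \<tau> x = \<sigma> x}"
    unfolding locally_const_def
  proof
    fix u assume u: "u \<in> {\<tau> \<in> abs_Gal. \<forall>x\<in>L. \<tau> x = \<sigma> x}"
    have "u \<circ> \<tau> \<in> {\<tau> \<in> abs_Gal. \<forall>x\<in>L. \<tau> x = \<sigma> x}"
      if \<tau>: "\<tau> \<in> inertia v" "\<forall>b\<in>B. \<tau> b = b" for \<tau>
    proof -
      have \<tau>G: "\<tau> \<in> abs_Gal" using \<tau> by (simp add: inertia_def)
      have "\<tau> x = x" if "x \<in> L" for x
        using span_agree[OF B(2), of \<tau> "\<lambda>x. x"] \<tau>(2) that by (simp add: abs_GalD[OF \<tau>G])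
      then show ?thesis using u comp_abs_Gal[OF _ \<tau>G] by auto
    qed
    then show "\<exists>B. finite B \<and> (\<forall>\<tau>\<in>inertia v. (\<forall>b\<in>B. \<tau> b = b) \<longrightarrow> u \<circ> \<tau> \<in> {\<tau> \<in> abs_Gal. \<forall>x\<in>L. \<tau> x = \<sigma> x})"
      using B(1) by blast
  qed
qed

lemma weil_locally_const: "openin (weil_topology v) U \<Longrightarrow> locally_const U"
  unfolding weil_topology_def
proof (drule openin_topology_generated_by, erule generate_topology_locally_const, safe)
  fix \<sigma> U assume "openin (subtopology krull_topology (inertia v)) U"
  then obtain T where T: "openin krull_topology T" "U = T \<inter> inertia v"
    by (auto simp: openin_subtopology)
  show "locally_const ((\<lambda>\<tau>. \<sigma> \<circ> \<tau>) ` U)"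
    unfolding locally_const_def
  proof safe
    fix t assume t: "t \<in> U"
    then obtain B where B: "finite B" "\<forall>\<tau>\<in>inertia v. (\<forall>b\<in>B. \<tau> b = b) \<longrightarrow> t \<circ> \<tau> \<in> T"
      using krull_locally_const[OF T(1)] T(2) unfolding locally_const_def by blast
    have "\<sigma> \<circ> t \<circ> \<tau> \<in> (\<lambda>\<tau>. \<sigma> \<circ> \<tau>) ` U" if \<tau>: "\<tau> \<in> inertia v" "\<forall>b\<in>B. \<tau> b = b" for \<tau>
    proof -
      have "t \<circ> \<tau> \<in> U" using t \<tau> B(2) comp_inertia T(2) by auto
      then show ?thesis by (auto simp: comp_assoc)
    qed
    then show "\<exists>B. finite B \<and> (\<forall>\<tau>\<in>inertia v. (\<forall>b\<in>B. \<tau> b = b) \<longrightarrow> \<sigma> \<circ> t \<circ> \<tau> \<in> (\<lambda>\<tau>. \<sigma> \<circ> \<tau>) ` U)"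
      using B(1) by blast
  qed
qed

text \<open>An open kernel contains the elements of inertia that fix some finite set
  \<open>B\<close>. So r on inertia depends only on the restriction to \<open>B\<close>, whose
  values are conjugates and leave finitely many possibilities.\<close>

lemma finite_image_inertia:
  assumes hom: "\<And>\<sigma> \<tau>. \<lbrakk>\<sigma> \<in> weil_group v; \<tau> \<in> weil_group v\<rbrakk> \<Longrightarrow> r (\<sigma> \<circ> \<tau>) = r \<sigma> ** (r \<tau> :: 'b::comm_ring_1 ^ 'n ^ 'n::finite)"
    and one: "r (\<lambda>x. x) = mat 1"
    and op: "openin (weil_topology v) {\<sigma> \<in> weil_group v. r \<sigma> = mat 1}"
  shows "finite (r ` inertia v)"
proof -
  have "(\<lambda>x. x) \<in> {\<sigma> \<in> weil_group v. r \<sigma> = mat 1}"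
    using id_inertia inertia_subset_weil_group one by auto
  then obtain B where finB: "finite B" and B': "\<forall>\<tau>\<in>inertia v. (\<forall>b\<in>B. \<tau> b = b) \<longrightarrow>
      (\<lambda>x. x) \<circ> \<tau> \<in> {\<sigma> \<in> weil_group v. r \<sigma> = mat 1}"
    using weil_locally_const[OF op] unfolding locally_const_def by blast
  have B: "r \<tau> = mat 1" if "\<tau> \<in> inertia v" "\<forall>b\<in>B. \<tau> b = b" for \<tau>
  proof -
    have "(\<lambda>x. x) \<circ> \<tau> \<in> {\<sigma> \<in> weil_group v. r \<sigma> = mat 1}"
      using B'[rule_format, OF that(1)] that(2) by blast
    then show ?thesis by (simp add: comp_def)
  qed
  have "(\<lambda>\<tau>. restrict \<tau> B) ` inertia v \<subseteq> PiE B conjugates"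
    using abs_Gal_mem_conjugates[OF subsetD[OF inertia_subset_abs_Gal] mem_conjugates]
    by (simp add: image_subset_iff restrict_PiE_iff)
  then have fin: "finite ((\<lambda>\<tau>. restrict \<tau> B) ` inertia v)"
    by (rule finite_subset) (use finB in \<open>auto intro: finite_PiE\<close>)
  have same: "r \<sigma> = r \<tau>" if st: "\<sigma> \<in> inertia v" "\<tau> \<in> inertia v" "restrict \<sigma> B = restrict \<tau> B" for \<sigma> \<tau>
  proof -
    have \<sigma>: "\<sigma> \<in> abs_Gal" using st by (simp add: inertia_def)
    let ?d = "inv_into UNIV \<sigma> \<circ> \<tau>"
    have d: "?d \<in> inertia v" by (rule comp_inertia[OF inv_inertia[OF st(1)] st(2)])
    have "?d b = b" if "b \<in> B" for b
    proof -
      have "\<tau> b = \<sigma> b" using fun_cong[OF st(3), of b] that by simp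
      then show ?thesis by (simp add: abs_Gal_inv[OF \<sigma>])
    qed
    then have "r ?d = mat 1" using B d by blast
    moreover have "\<tau> = \<sigma> \<circ> ?d" by (auto simp: abs_Gal_inv[OF \<sigma>])
    then have "r \<tau> = r \<sigma> ** r ?d"
      using hom[of \<sigma> ?d] st d inertia_subset_weil_group by auto
    ultimately show ?thesis by simp
  qed
  have "r ` inertia v \<subseteq> (\<lambda>c. r (SOME \<tau>. \<tau> \<in> inertia v \<and> restrict \<tau> B = c)) ` (\<lambda>\<tau>. restrict \<tau> B) ` inertia v"
  proof safe
    fix \<tau> assume \<tau>: "\<tau> \<in> inertia v"
    define \<tau>' where "\<tau>' = (SOME \<tau>'. \<tau>' \<in> inertia v \<and> restrict \<tau>' B = restrict \<tau> B)"
    have "\<tau>' \<in> inertia v \<and> restrict \<tau>' B = restrict \<tau> B"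
      unfolding \<tau>'_def by (rule someI[of _ \<tau>]) (use \<tau> in auto)
    then have "r \<tau> = r \<tau>'" using same[OF \<tau>] by metis
    then show "r \<tau> \<in> (\<lambda>c. r (SOME \<tau>. \<tau> \<in> inertia v \<and> restrict \<tau> B = c)) ` (\<lambda>\<tau>. restrict \<tau> B) ` inertia v"
      using \<tau> unfolding \<tau>'_def by blast
  qed
  then show ?thesis using fin finite_surj by blast
qed

end

section \<open>Finite Galois extensions\<close>

lemma type_ring_simps:
  "carrier (type_ring :: 'a::ring_1 ring) = UNIV" "\<one>\<^bsub>type_ring :: 'a ring\<^esub> = 1"
  "\<zero>\<^bsub>type_ring :: 'a ring\<^esub> = 0"
  "x \<oplus>\<^bsub>type_ring\<^esub> y = x + (y :: 'a)" "x \<otimes>\<^bsub>type_ring\<^esub> y = x * (y :: 'a)"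
  by (simp_all add: ring_of_type_algebra_def)

lemma type_ring_inverse:
  fixes x :: "'a::field"
  assumes "x \<noteq> 0"
  shows "inv\<^bsub>type_ring\<^esub> x = inverse x"
proof -
  interpret R: field "type_ring :: 'a ring" by (rule field_from_type_algebra)
  have "x * inv\<^bsub>type_ring\<^esub> x = 1"
    using R.Units_r_inv[of x] assms by (simp add: R.field_Units type_ring_simps)
  then show ?thesis by (metis inverse_unique)
qed

text \<open>After division by a power of y, an algebraic equation for y has a nonzero constant term,
  and solving for it expresses the inverse as a polynomial in y.\<close>

lemma inverse_mem_algebra:
  fixes y :: "'k::field alg_closure"
  assumes L: "range to_ac \<subseteq> L" "\<And>x y. \<lbrakk>x \<in> L; y \<in> L\<rbrakk> \<Longrightarrow> x + y \<in> L" "\<And>x y. \<lbrakk>x \<in> L; y \<in> L\<rbrakk> \<Longrightarrow> x * y \<in> L"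
    and y: "y \<in> L" "y \<noteq> 0"
  shows "inverse y \<in> L"
proof -
  have poly: "poly (map_poly to_ac p) y \<in> L" for p
  proof (induction p)
    case 0
    have "to_ac 0 \<in> L" using L(1) by blast
    then show ?case by simp
  next
    case (pCons a p)
    have "to_ac a \<in> L" using L(1) by blast
    then show ?case using L(2,3) y(1) pCons by (simp add: map_poly_pCons)
  qed
  have "\<exists>a q. a \<noteq> 0 \<and> to_ac a + y * poly (map_poly to_ac q) y = 0"
    if "p \<noteq> 0" "poly (map_poly to_ac p) y = 0" for p
    using that
  proof (induction p)
    case (pCons a p)
    show ?case
    proof (cases "a = 0")
      case True
      then show ?thesis using pCons y by (simp add: map_poly_pCons)
    next
      case False
      then show ?thesis using pCons.prems by (auto simp: map_poly_pCons)
    qed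
  qed simp
  then obtain a q where aq: "a \<noteq> 0" "to_ac a + y * poly (map_poly to_ac q) y = 0"
    using annihilator by metis
  have "inverse y = to_ac (- inverse a) * poly (map_poly to_ac q) y"
  proof -
    have "y * poly (map_poly to_ac q) y = - to_ac a" using aq(2) by (simp add: add_eq_0_iff)
    then have "y * (to_ac (- inverse a) * poly (map_poly to_ac q) y) = 1"
      using aq(1) by (simp add: mult.left_commute[of y])
    then show ?thesis by (rule inverse_unique)
  qed
  then show ?thesis using L poly by (metis rangeI subsetD)
qed

lemma subfield_type_ring:
  fixes L :: "'k::field alg_closure set"
  assumes L: "range to_ac \<subseteq> L" "\<And>x y. \<lbrakk>x \<in> L; y \<in> L\<rbrakk> \<Longrightarrow> x + y \<in> L" "\<And>x y. \<lbrakk>x \<in> L; y \<in> L\<rbrakk> \<Longrightarrow> x * y \<in> L"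
  shows "subfield L type_ring"
proof -
  interpret R: field "type_ring :: 'k alg_closure ring" by (rule field_from_type_algebra)
  note [simp] = type_ring_simps
  have minus: "\<ominus>\<^bsub>type_ring\<^esub> x = - x" for x :: "'k alg_closure"
    using R.l_neg[of x] by (simp add: eq_neg_iff_add_eq_0)
  have "to_ac 1 \<in> L" "to_ac (- 1) \<in> L" using L(1) by blast+
  then have "1 \<in> L" "- x \<in> L" if "x \<in> L" for x using L(3)[of "to_ac (- 1)" x] that by simp_all
  then have "subring L type_ring" using L \<open>to_ac 1 \<in> L\<close> by (intro R.subringI) (auto simp: minus)
  then show ?thesis
    using inverse_mem_algebra[OF L] by (intro R.subfieldI') (auto simp: type_ring_inverse)
qed

lemma subfield_closed:
  fixes L :: "'k::field alg_closure set"
  assumes "subfield L type_ring" "x \<in> L" "y \<in> L"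
  shows "x + y \<in> L" "x * y \<in> L"
  using subringE(6,7)[OF subfieldE(1)[OF assms(1)] assms(2,3)]
  by (simp_all add: ring_of_type_algebra_def)

text \<open>\<open>L\<close> is generated by all roots of one polynomial for x, so it is stable
  under automorphisms, and monomials in these roots with exponents below the degree d span
  it.\<close>

lemma finite_Galois_containing: "\<exists>L. finite_Galois L \<and> x \<in> L"
  for x :: "'k::field alg_closure"
proof -
  interpret K: vector_space "\<lambda>(a::'k) (x :: 'k alg_closure). to_ac a * x"
    by (rule vector_space_to_ac)
  define R where "R = conjugates x"
  define P where "P = annihilator x"
  define d where "d = degree P"
  have root: "poly (map_poly to_ac P) r = 0" if "r \<in> R" for r
    using that by (simp add: R_def P_def conjugates_def)
  have xR: "x \<in> R" and finR: "finite R" by (simp_all add: R_def mem_conjugates)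
  have P0: "P \<noteq> 0" by (simp add: P_def annihilator)
  have "d > 0"
  proof (rule ccontr)
    assume "\<not> d > 0"
    then obtain c where "P = [:c:]" by (auto simp: d_def elim: degree_eq_zeroE)
    then show False using root[OF xR] P0 by (simp add: map_poly_pCons)
  qed
  define mon where "mon e = (\<Prod>r\<in>R. r ^ e r)" for e :: "'k alg_closure \<Rightarrow> nat"
  define T where "T = {mon e |e. \<forall>r\<in>R. e r < d}"
  have "T \<subseteq> mon ` PiE R (\<lambda>_. {..<d})"
  proof
    fix t assume "t \<in> T"
    then obtain e where e: "t = mon e" "\<forall>r\<in>R. e r < d" by (auto simp: T_def)
    then have "t = mon (restrict e R)" by (simp add: mon_def)
    moreover have "restrict e R \<in> PiE R (\<lambda>_. {..<d})" using e(2) by (simp add: restrict_PiE_iff)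
    ultimately show "t \<in> mon ` PiE R (\<lambda>_. {..<d})" by blast
  qed
  then have finT: "finite T"
    by (rule finite_subset) (use finR in \<open>auto intro: finite_PiE\<close>)
  have split: "mon (e(r := i)) = r ^ i * (\<Prod>s\<in>R - {r}. s ^ e s)" if "r \<in> R" for e r i
    using finR that by (simp add: mon_def prod.remove[of R r])
  \<comment> \<open>Multiplication by r raises one exponent; if it reaches d, the equation of r
    rewrites r^d by lower powers.\<close>
  have r_t: "r * t \<in> K.span T" if r: "r \<in> R" and t: "t \<in> T" for r t
  proof -
    obtain e where e: "t = mon e" "\<And>r. r \<in> R \<Longrightarrow> e r < d" using t by (auto simp: T_def)
    have te: "t = r ^ e r * (\<Prod>s\<in>R - {r}. s ^ e s)" using split[OF r, of e "e r"] e(1) by simp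
    have upd: "mon (e(r := i)) \<in> T" if "i < d" for i
      using e(2) that by (auto simp: T_def)
    show ?thesis
    proof (cases "Suc (e r) < d")
      case True
      have "r * t = mon (e(r := Suc (e r)))" by (simp add: split[OF r] te)
      then show ?thesis using upd[OF True] by (simp add: K.span_base)
    next
      case False
      then have d: "d = Suc (e r)" using e(2)[OF r] by simp
      let ?c = "\<lambda>i. to_ac (coeff P i)"
      have "degree (map_poly to_ac P) = d"
        unfolding d_def by (rule degree_map_poly) auto
      then have "(\<Sum>i\<le>d. ?c i * r ^ i) = 0"
        using root[OF r] by (simp add: poly_altdef coeff_map_poly)
      then have "(\<Sum>i<d. ?c i * r ^ i) + ?c d * r ^ d = 0"
        by (simp add: lessThan_Suc_atMost[symmetric])
      then have "?c d * r ^ d = - (\<Sum>i<d. ?c i * r ^ i)" by (simp add: add_eq_0_iff)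
      moreover have c0: "coeff P d \<noteq> 0" using P0 by (simp add: d_def)
      ultimately have "r ^ d = to_ac (- inverse (coeff P d)) * (\<Sum>i<d. ?c i * r ^ i)"
        by (simp add: field_simps)
      moreover have "r * t = r ^ d * (\<Prod>s\<in>R - {r}. s ^ e s)" by (simp add: te d mult.assoc)
      moreover have "(\<Sum>i<d. ?c i * r ^ i) * (\<Prod>s\<in>R - {r}. s ^ e s) = (\<Sum>i<d. ?c i * mon (e(r := i)))"
        by (simp add: split[OF r] sum_distrib_right mult.assoc)
      ultimately have rt: "r * t = to_ac (- inverse (coeff P d)) * (\<Sum>i<d. ?c i * mon (e(r := i)))"
        by (simp only: mult.assoc)
      show ?thesis unfolding rt by (intro K.span_scale K.span_sum K.span_base upd) simp
    qed
  qed
  have r_span: "r * y \<in> K.span T" if r: "r \<in> R" and y: "y \<in> K.span T" for r y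
    using y
  proof (induction rule: K.span_induct_alt)
    case base
    show ?case by (simp add: K.span_zero)
  next
    case (step c b y)
    have "r * (to_ac c * b + y) = to_ac c * (r * b) + r * y" by (simp add: algebra_simps)
    then show ?case using step r_t[OF r] by (auto intro: K.span_add K.span_scale)
  qed
  define closed where "closed S \<longleftrightarrow> range to_ac \<subseteq> S \<and> R \<subseteq> S \<and>
    (\<forall>x\<in>S. \<forall>y\<in>S. x + y \<in> S \<and> x * y \<in> S)" for S :: "'k alg_closure set"
  define L where "L = \<Inter>{S. closed S}"
  have L: "range to_ac \<subseteq> L" "R \<subseteq> L" "\<And>x y. \<lbrakk>x \<in> L; y \<in> L\<rbrakk> \<Longrightarrow> x + y \<in> L" "\<And>x y. \<lbrakk>x \<in> L; y \<in> L\<rbrakk> \<Longrightarrow> x * y \<in> L"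
    unfolding L_def closed_def by blast+
  have minimal: "L \<subseteq> S" if "closed S" for S using that by (auto simp: L_def)
  \<comment> \<open>The multipliers of the span of \<open>T\<close> form a ring containing
    \<open>K\<close> and \<open>R\<close>, hence \<open>L\<close>; applied to 1 they show that
    \<open>L\<close> lies in that span.\<close>
  have "closed {y. \<forall>z\<in>K.span T. y * z \<in> K.span T}"
    unfolding closed_def using r_span
    by (auto simp: distrib_right mult.assoc intro: K.span_scale K.span_add)
  then have L_mult: "y * z \<in> K.span T" if "y \<in> L" "z \<in> K.span T" for y z
    using minimal that by blast
  have "mon (\<lambda>_. 0) \<in> T" using \<open>d > 0\<close> by (auto simp: T_def)
  then have "1 \<in> K.span T" by (simp add: mon_def K.span_base)
  then have "L \<subseteq> K.span T" using L_mult[of _ 1] by auto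
  moreover have "K.span T \<subseteq> L"
  proof (rule K.span_minimal)
    have one: "1 \<in> L" using L(1) by (metis rangeI subsetD to_ac_1)
    have pow: "r ^ n \<in> L" if "r \<in> R" for r n using one L(2,4) that by (induction n) auto
    have "(\<Prod>r\<in>R'. r ^ e r) \<in> L" if "R' \<subseteq> R" for R' e
      using that by (induction R' rule: infinite_finite_induct) (auto simp: one pow L(4))
    then show "T \<subseteq> L" by (auto simp: T_def mon_def)
    have ac: "to_ac c \<in> L" for c using L(1) by blast
    from ac[of 0] show "K.subspace L" using L(3) L(4)[OF ac] by (simp add: K.subspace_def)
  qed
  ultimately have span: "K.span T = L" by blast
  have "\<sigma> ` L \<subseteq> L" if \<sigma>: "\<sigma> \<in> abs_Gal" for \<sigma>
  proof -
    have "closed {y. \<sigma> y \<in> L}"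
      unfolding closed_def using L abs_Gal_mem_conjugates[OF \<sigma>, of _ x]
      by (auto simp: abs_GalD[OF \<sigma>] R_def subset_iff)
    then show ?thesis using minimal by blast
  qed
  then have "finite_Galois L"
    using subfield_type_ring[OF L(1,3,4)] L(1) finT span by (auto simp: finite_Galois_def finite_intermediate_def)
  then show ?thesis using xR L(2) by blast
qed

lemma finite_Gal:
  fixes L :: "'k::field alg_closure set"
  assumes "finite_intermediate L"
  shows "finite (Gal L)"
proof -
  obtain B where B: "finite B" "Modules.module.span (\<lambda>a x. to_ac a * x) B = L"
    and L: "subfield L type_ring" "range to_ac \<subseteq> L"
    using assms by (auto simp: finite_intermediate_def)
  interpret K: vector_space "\<lambda>(a::'k) (x :: 'k alg_closure). to_ac a * x"
    by (rule vector_space_to_ac)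
  have BL: "B \<subseteq> L" using B(2) K.span_superset by blast
  have "(\<lambda>\<tau>. restrict \<tau> B) ` Gal L \<subseteq> PiE B conjugates"
    using Gal_mem_conjugates[OF _ _ L(2) subfield_closed[OF L(1)]] BL
    by (intro image_subsetI) (auto simp: restrict_PiE_iff)
  then have "finite ((\<lambda>\<tau>. restrict \<tau> B) ` Gal L)"
    by (rule finite_subset) (use B(1) in \<open>auto intro: finite_PiE\<close>)
  moreover have "inj_on (\<lambda>\<tau>. restrict \<tau> B) (Gal L)"
  proof (rule inj_onI)
    fix \<sigma> \<tau> assume st: "\<sigma> \<in> Gal L" "\<tau> \<in> Gal L" "restrict \<sigma> B = restrict \<tau> B"
    have lin: "\<rho> (x + y) = \<rho> x + \<rho> y" "\<rho> (to_ac a * x) = to_ac a * \<rho> x" "\<rho> 0 = 0"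
      if \<rho>: "\<rho> \<in> Gal L" and xy: "x \<in> L" "y \<in> L" for \<rho> x y a
    proof -
      have ac: "to_ac a \<in> L" "\<rho> (to_ac a) = to_ac a" for a using \<rho> L(2) by (auto simp: Gal_iff)
      show "\<rho> 0 = 0" using ac(2)[of 0] by simp
      show "\<rho> (x + y) = \<rho> x + \<rho> y" using \<rho> xy by (simp add: Gal_iff)
      have "\<rho> (to_ac a * x) = \<rho> (to_ac a) * \<rho> x" using \<rho> xy(1) ac(1) by (simp add: Gal_iff)
      then show "\<rho> (to_ac a * x) = to_ac a * \<rho> x" by (simp only: ac(2))
    qed
    have "to_ac 0 \<in> L" using L(2) by blast
    then have z: "0 \<in> L" by simp
    have eqB: "\<sigma> b = \<tau> b" if "b \<in> B" for b using fun_cong[OF st(3), of b] that by simp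
    have "\<sigma> x = \<tau> x" if "x \<in> L" for x
      by (rule span_agree[OF B(2) lin(1)[OF st(1)] lin(2)[OF st(1) _ z] lin(3)[OF st(1) z z]
          lin(1)[OF st(2)] lin(2)[OF st(2) _ z] lin(3)[OF st(2) z z] eqB that])
    moreover have "\<sigma> \<in> extensional L" "\<tau> \<in> extensional L" using st by (auto simp: Gal_iff)
    ultimately show "\<sigma> = \<tau>" by (intro extensionalityI) auto
  qed
  ultimately show ?thesis by (rule finite_imageD)
qed

section \<open>Discreteness of the valuation\<close>

locale local_field = nonarch_field v for v :: "'k::field alg_closure \<Rightarrow> real" +
  fixes l :: nat and abs_l :: "'ql::field_char_0 \<Rightarrow> real" and j :: "'ql \<Rightarrow> 'k"
  assumes prime_l: "Factorial_Ring.prime l" and padic: "padic_field l abs_l"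
    and j: "finite_extension j" and v_j: "v (to_ac (j x)) = abs_l x"
begin

lemma j_hom: "j (x + y) = j x + j y" "j (x * y) = j x * j y" "j 1 = 1" "j 0 = 0"
proof -
  show 1: "j (x + y) = j x + j y" "j (x * y) = j x * j y" "j 1 = 1" for x y
    using j by (auto simp: finite_extension_def ring_hom_def ring_of_type_algebra_def)
  show "j 0 = 0" by (metis 1(1) add.right_neutral add_left_imp_eq)
qed

lemma vector_space_base: "vector_space (\<lambda>(a::'ql) (x :: 'k alg_closure). to_ac (j a) * x)"
  by unfold_locales (auto simp: algebra_simps j_hom)

text \<open>
  The powers \<open>1, x, \<dots>, x\<^sup>n\<close> are linearly dependent over \<open>\<rat>\<^sub>l\<close> if \<open>n\<close> bounds the degree of \<open>L\<close>.
  Two terms of a relation have the same absolute value, so \<open>v x\<close> to some power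
  between \<open>1\<close> and \<open>n\<close> is an integral power of \<open>l\<close>.
\<close>

lemma power_value_of_small:
  fixes D :: "'k alg_closure set"
  assumes D: "finite D" and x: "0 < v x" "v x < 1"
    and span: "\<And>i. x ^ i \<in> Modules.module.span (\<lambda>a x. to_ac (j a) * x) D"
  shows "v x ^ card D \<le> 1 / real l"
proof -
  interpret Q: vector_space "\<lambda>(a::'ql) (x :: 'k alg_closure). to_ac (j a) * x"
    by (rule vector_space_base)
  let ?n = "card D"
  have inj: "inj ((^) x)"
  proof (rule injI)
    fix a b :: nat assume "x ^ a = x ^ b"
    then have "v x ^ a = v x ^ b" by (metis power)
    then show "a = b" using x by (metis power_inject_exp' less_irrefl linorder_neqE_nat power_strict_decreasing)
  qed
  let ?S = "(^) x ` {..?n}"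
  have "card ?S = Suc ?n" using inj by (simp add: card_image inj_on_subset)
  then have "Q.dependent ?S"
    using Q.independent_span_bound[OF D, of ?S] span by auto
  then obtain u where u: "\<exists>s\<in>?S. u s \<noteq> 0" "(\<Sum>s\<in>?S. to_ac (j (u s)) * s) = 0"
    by (auto simp: Q.dependent_finite)
  then obtain s0 where s0: "s0 \<in> ?S" "u s0 \<noteq> 0" by blast
  have u_pos: "0 < v (to_ac (j (u s)))" if "u s \<noteq> 0" for s
  proof -
    have "j (u s) * j (inverse (u s)) = 1" using that j_hom by (metis right_inverse)
    then have "j (u s) \<noteq> 0" by auto
    then show ?thesis by (simp add: pos_iff)
  qed
  have "x \<noteq> 0" using x pos_iff by blast
  then have "to_ac (j (u s0)) * s0 \<noteq> 0" using u_pos[OF s0(2)] s0(1) by (auto simp: pos_iff)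
  then obtain s t where st: "s \<in> ?S" "t \<in> ?S" "s \<noteq> t"
    "v (to_ac (j (u s)) * s) = v (to_ac (j (u t)) * t)" "to_ac (j (u s)) * s \<noteq> 0"
    using two_maximal_terms[OF _ u(2) s0(1)] by blast
  have key: "\<exists>k. 0 < k \<and> k \<le> ?n \<and> (\<exists>e::int. v x ^ k = real l powi e)"
    if ab: "a < b" "b \<le> ?n" "v (to_ac (j c)) * v x ^ a = v (to_ac (j d)) * v x ^ b" "c \<noteq> 0" "d \<noteq> 0" for a b c d
  proof -
    obtain e1 e2 where e: "abs_l c = real l powi e1" "abs_l d = real l powi e2"
      using padic_abs_value[OF padic] ab(4,5) by metis
    have l0: "real l \<noteq> 0" using prime_l by (auto simp: prime_gt_0_nat)
    have "v x ^ b = v x ^ a * v x ^ (b - a)" using ab(1) by (simp flip: power_add)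
    then have "v x ^ a * real l powi e1 = v x ^ a * (real l powi e2 * v x ^ (b - a))"
      using ab(3) by (simp add: v_j e algebra_simps)
    then have "real l powi e1 = real l powi e2 * v x ^ (b - a)" using \<open>x \<noteq> 0\<close> by simp
    then have "v x ^ (b - a) = real l powi (e1 - e2)"
      using l0 by (simp add: power_int_diff field_simps)
    then show ?thesis using ab by (intro exI[of _ "b - a"]) auto
  qed
  obtain a b where ab: "s = x ^ a" "t = x ^ b" "a \<le> ?n" "b \<le> ?n" "a \<noteq> b" using st by auto
  have nz: "u s \<noteq> 0" "u t \<noteq> 0" using st(4,5) j_hom(4) by (auto simp: pos_iff[symmetric])
  have eq: "v (to_ac (j (u s))) * v x ^ a = v (to_ac (j (u t))) * v x ^ b"
    using st(4) ab by (simp add: mult power)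
  have "\<exists>k. 0 < k \<and> k \<le> ?n \<and> (\<exists>e::int. v x ^ k = real l powi e)"
    using key[of a b "u s" "u t"] key[of b a "u t" "u s"] ab eq nz by (cases "a < b") auto
  then obtain k e where k: "0 < k" "k \<le> ?n" "v x ^ k = real l powi e" by blast
  have l1: "real l > 1" using prime_l prime_gt_1_nat by (metis of_nat_1 of_nat_less_iff)
  have "real l powi e < 1" using k x power_strict_decreasing[of 0 k "v x"] by simp
  \<comment> \<open>An integral power of l below 1 is at most 1 / l; passing from the exponent k to
    \<open>card D\<close> only decreases the value.\<close>
  have "e < 0"
  proof (rule ccontr)
    assume "\<not> e < 0"
    then have "1 \<le> real l powi e" using l1 by (simp add: power_int_def)
    then show False using \<open>real l powi e < 1\<close> by simp
  qed
  then have "real l powi e \<le> real l powi (- 1)" using l1 by (intro power_int_increasing) auto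
  moreover have "v x ^ ?n \<le> v x ^ k" using k x by (intro power_decreasing) auto
  ultimately show ?thesis using k(3) by (simp add: power_int_minus divide_inverse)
qed

lemma finite_span_base:
  assumes "finite_intermediate L"
  shows "\<exists>D. finite D \<and> L \<subseteq> Modules.module.span (\<lambda>a x. to_ac (j a) * x) D"
proof -
  interpret Q: vector_space "\<lambda>(a::'ql) (x :: 'k alg_closure). to_ac (j a) * x"
    by (rule vector_space_base)
  interpret K: vector_space "\<lambda>(a::'k) (x :: 'k alg_closure). to_ac a * x"
    by (rule vector_space_to_ac)
  interpret J: vector_space "\<lambda>(a::'ql) (x :: 'k). j a * x"
    by unfold_locales (auto simp: algebra_simps j_hom)
  obtain B where B: "finite B" "K.span B = L" using assms by (auto simp: finite_intermediate_def)
  obtain C where C: "finite C" "J.span C = UNIV" using j by (auto simp: finite_extension_def)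
  let ?D = "(\<lambda>(c, b). to_ac c * b) ` (C \<times> B)"
  have scaled: "to_ac a * b \<in> Q.span ?D" if b: "b \<in> B" for a b
  proof -
    have "a \<in> J.span C" using C by simp
    then show ?thesis
    proof (induction rule: J.span_induct_alt)
      case base
      show ?case by (simp add: Q.span_zero)
    next
      case (step r c y)
      have "to_ac (j r * c + y) * b = to_ac (j r) * (to_ac c * b) + to_ac y * b"
        by (simp add: algebra_simps)
      moreover have "to_ac c * b \<in> ?D" using step b by auto
      ultimately show ?case using step by (metis Q.span_add Q.span_base Q.span_scale)
    qed
  qed
  have "y \<in> Q.span ?D" if "y \<in> K.span B" for y
    using that by (induction rule: K.span_induct_alt) (auto intro: Q.span_zero Q.span_add scaled)
  then show ?thesis using B C by (intro exI[of _ ?D]) auto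
qed

lemma uniformizer_abs_bounds:
  assumes L: "finite_intermediate L"
  shows "0 \<le> uniformizer_abs v L" "uniformizer_abs v L < 1"
proof -
  obtain D where D: "finite D" "L \<subseteq> Modules.module.span (\<lambda>a x. to_ac (j a) * x) D"
    using finite_span_base[OF L] by blast
  have sub: "subfield L type_ring" "range to_ac \<subseteq> L" using L by (auto simp: finite_intermediate_def)
  have l1: "real l > 1" using prime_l prime_gt_1_nat by (metis of_nat_1 of_nat_less_iff)
  \<comment> \<open>A bound below 1 for all v x < 1 at once, which is discreteness. As
    \<open>root 0\<close> yields 0, c < 1 holds for empty \<open>D\<close> too.\<close>
  define c where "c = root (card D) (1 / real l)"
  have c0: "0 \<le> c" using l1 by (simp add: c_def real_root_ge_zero)
  have c1: "c < 1"
  proof (cases "card D = 0")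
    case False
    then show ?thesis using l1 by (simp add: c_def)
  qed (simp add: c_def)
  let ?S = "{v x |x. x \<in> L \<and> v x < 1}"
  have le: "s \<le> c" if "s \<in> ?S" for s
  proof -
    obtain x where x: "s = v x" "x \<in> L" "v x < 1" using \<open>s \<in> ?S\<close> by blast
    show ?thesis
    proof (cases "x = 0")
      case True
      then show ?thesis using x c0 by simp
    next
      case False
      have one: "1 \<in> L" using sub(2) by (metis rangeI subsetD to_ac_1)
      have "x ^ i \<in> L" for i using one x(2) subfield_closed(2)[OF sub(1)] by (induction i) auto
      then have *: "v x ^ card D \<le> 1 / real l"
        using D x(3) False pos_iff[of x] by (intro power_value_of_small) auto
      have "card D > 0"
      proof (rule ccontr)
        assume "\<not> card D > 0"
        then have "1 \<le> 1 / real l" using * by simp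
        then show False using l1 by (simp add: field_simps)
      qed
      then have "v x = root (card D) (v x ^ card D)" by (simp add: real_root_power_cancel)
      also have "\<dots> \<le> c" unfolding c_def using * \<open>card D > 0\<close> by simp
      finally show ?thesis using x by simp
    qed
  qed
  have "to_ac 0 \<in> L" using sub(2) by blast
  then have "v 0 \<in> ?S" by force
  then have 0: "0 \<in> ?S" by simp
  then have "Sup ?S \<le> c" using le by (intro cSup_least) auto
  then show "uniformizer_abs v L < 1" using c1 by (simp add: uniformizer_abs_def)
  show "0 \<le> uniformizer_abs v L"
    unfolding uniformizer_abs_def using 0 le by (intro cSup_upper) (auto simp: bdd_above_def)
qed

section \<open>The ramification filtration\<close>

lemma ram_lower_antimono:
  assumes "finite_intermediate L" "s \<le> t"
  shows "ram_lower v L t \<subseteq> ram_lower v L s"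
proof -
  have "uniformizer_abs v L powr (t + 1) \<le> uniformizer_abs v L powr (s + 1)"
    using uniformizer_abs_bounds[OF assms(1)] assms(2) by (intro powr_mono') auto
  then show ?thesis unfolding ram_lower_def by force
qed

text \<open>The integrand is monotone, hence integrable, and never below 1 / |G_0|, so its integral
  is continuous and grows beyond any u.\<close>

lemma herbrand_surj:
  assumes L: "finite_intermediate L" and u: "0 \<le> u"
  shows "\<exists>s\<ge>0. herbrand v L s = u"
proof -
  have fin: "finite (ram_lower v L s)" for s
    using finite_Gal[OF L] by (rule finite_subset[rotated]) (auto simp: ram_lower_def)
  have id: "restrict (\<lambda>x. x) L \<in> ram_lower v L s" for s
  proof -
    have sub: "subfield L type_ring" "range to_ac \<subseteq> L" using L by (auto simp: finite_intermediate_def)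
    have "1 \<in> L" using sub(2) by (metis rangeI subsetD to_ac_1)
    then have "restrict (\<lambda>x. x) L \<in> Gal L"
      using sub subfield_closed[OF sub(1)] by (auto simp: Gal_iff bij_betw_def inj_on_def)
    then show ?thesis by (auto simp: ram_lower_def)
  qed
  define g where "g t = real (card (ram_lower v L t)) / real (card (ram_lower v L 0))" for t
  have card0: "0 < card (ram_lower v L s)" for s using fin id by (auto simp: card_gt_0_iff)
  define c where "c = 1 / real (card (ram_lower v L 0))"
  have c: "0 < c" using card0 by (simp add: c_def)
  have gc: "c \<le> g t" for t using card0[of t] card0[of 0] unfolding c_def g_def
    by (intro divide_right_mono) auto
  have "g t \<le> g s" if "s \<le> t" for s t
    unfolding g_def using card_mono[OF fin ram_lower_antimono[OF L that]] by (intro divide_right_mono) auto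
  then have "(\<lambda>t. - g t) integrable_on {a..b}" for a b
    by (intro integrable_on_mono_on mono_onI) auto
  then have int: "g integrable_on {a..b}" for a b using integrable_neg by fastforce
  have H: "herbrand v L s = integral {0..s} g" if "0 \<le> s" for s
    using that by (cases "s = 0") (simp_all add: herbrand_def g_def[abs_def])
  \<comment> \<open>As the integrand is at least c, the integral up to u / c is at least u.\<close>
  define b where "b = u / c"
  have b: "0 \<le> b" using u c by (simp add: b_def)
  have "continuous_on {0..b} (\<lambda>s. integral {0..s} g)"
    using int by (rule indefinite_integral_continuous_1)
  moreover have "u \<le> integral {0..b} g"
  proof -
    have "integral {0..b} (\<lambda>_. c) \<le> integral {0..b} g" using gc int by (intro integral_le) auto
    then show ?thesis using b c by (simp add: b_def)
  qed
  moreover have "integral {0..0} g \<le> u" using u by simp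
  ultimately obtain s where "0 \<le> s" "s \<le> b" "integral {0..s} g = u"
    using IVT'[of "\<lambda>s. integral {0..s} g" 0 u b] b by auto
  then show ?thesis using H by auto
qed

text \<open>Inertia can be tested on one integral x at a time, and x lies in some finite Galois
  extension. There the lower index s is nonnegative, and a power s + 1 > 0 of
  \<open>uniformizer_abs\<close> is below 1.\<close>

lemma abs_ram_upper_subset_inertia:
  assumes u: "0 \<le> u"
  shows "abs_ram_upper v u \<subseteq> inertia v"
proof
  fix \<sigma> assume \<sigma>: "\<sigma> \<in> abs_ram_upper v u"
  have "v (\<sigma> x - x) < 1" if x: "v x \<le> 1" for x
  proof -
    obtain L where L: "finite_Galois L" "x \<in> L" using finite_Galois_containing by blast
    then have fin: "finite_intermediate L" by (simp add: finite_Galois_def)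
    define s where "s = inv_into {-1..} (herbrand v L) u"
    have "u \<in> herbrand v L ` {-1..}" using herbrand_surj[OF fin u] by force
    then have s: "s \<in> {-1..}" "herbrand v L s = u"
      unfolding s_def by (simp_all add: inv_into_into f_inv_into_f del: atLeast_iff)
    \<comment> \<open>The Herbrand function is the identity below 0, so a negative s would equal
      u.\<close>
    have "0 \<le> s"
    proof (rule ccontr)
      assume "\<not> 0 \<le> s"
      then have "herbrand v L s = s" by (simp add: herbrand_def)
      then show False using s u \<open>\<not> 0 \<le> s\<close> by simp
    qed
    have "restrict \<sigma> L \<in> ram_upper v L u" using \<sigma> L by (simp add: abs_ram_upper_def)
    then have "restrict \<sigma> L \<in> ram_lower v L s" by (simp add: ram_upper_def s_def)
    then have "v (\<sigma> x - x) \<le> uniformizer_abs v L powr (s + 1)"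
      using L(2) x by (auto simp: ram_lower_def)
    also have "\<dots> < 1"
    proof (cases "uniformizer_abs v L = 0")
      case False
      then show ?thesis
        using uniformizer_abs_bounds[OF fin] \<open>0 \<le> s\<close> powr_less_mono2[of "s + 1" "uniformizer_abs v L" 1]
        by simp
    qed simp
    finally show ?thesis .
  qed
  moreover have "\<sigma> \<in> abs_Gal" using \<sigma> by (simp add: abs_ram_upper_def)
  ultimately show "\<sigma> \<in> inertia v" by (simp add: inertia_def)
qed

end

section \<open>Specialization of Weil-Deligne representations\<close>

instance fract :: ("{idom, ring_char_0}") field_char_0
proof
  have "of_nat n = to_fract (of_nat n :: 'a)" for n
    by (induction n) simp_all
  then show "inj (of_nat :: nat \<Rightarrow> 'a fract)"
    by (simp add: inj_def)
qed

lemma to_fract_of_nat: "to_fract (of_nat n) = of_nat n"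
  by (induction n) simp_all

section \<open>Complex embeddings and weights\<close>

lemma generate_field_closed:
  fixes S :: "'a::field set"
  defines "G \<equiv> generate_field type_ring S"
  shows "of_nat n \<in> G" "x \<in> G \<Longrightarrow> y \<in> G \<Longrightarrow> x + y \<in> G" "x \<in> G \<Longrightarrow> y \<in> G \<Longrightarrow> x * y \<in> G"
    "x \<in> G \<Longrightarrow> inverse x \<in> G"
proof -
  interpret R: field "type_ring :: 'a ring" by (rule field_from_type_algebra)
  note [simp] = type_ring_simps
  show add: "x + y \<in> G" if "x \<in> G" "y \<in> G" for x y
    using generate_field.eng_add[of x type_ring S y] that by (simp add: G_def)
  show "x * y \<in> G" if "x \<in> G" "y \<in> G" for x y
    using generate_field.eng_mult[of x type_ring S y] that by (simp add: G_def)
  have zero: "0 \<in> G" using R.zero_in_generate[of S] by (simp add: G_def)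
  show "inverse x \<in> G" if "x \<in> G" for x
    using generate_field.m_inv[of x type_ring S] that zero type_ring_inverse[of x] by (cases "x = 0") (simp_all add: G_def)
  have "1 \<in> G" using generate_field.one[of type_ring S] by (simp add: G_def)
  then show "of_nat n \<in> G" by (induction n) (auto simp: zero intro: add)
qed

text \<open>Weights are tested on embeddings of the field generated by the eigenvalue, so a and q a
  must be tested on the same field.\<close>

lemma generate_field_of_nat_mult:
  fixes a :: "'a::field_char_0"
  assumes "q > 0"
  shows "generate_field type_ring {of_nat q * a} = generate_field type_ring {a}"
proof -
  interpret R: field "type_ring :: 'a ring" by (rule field_from_type_algebra)
  note carrier = type_ring_simps(1)
  have le: "generate_field type_ring {x} \<subseteq> generate_field type_ring {y}"
    if "x \<in> generate_field type_ring {y}" for x y :: 'a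
    using that carrier by (intro R.generate_field_min_subfield1 R.generate_field_is_subfield) auto
  have mem: "x \<in> generate_field type_ring {x}" for x :: 'a
    by (rule generate_field.incl) simp
  have "of_nat q * a \<in> generate_field type_ring {a}"
    by (intro generate_field_closed mem)
  moreover have "inverse (of_nat q) * (of_nat q * a) \<in> generate_field type_ring {of_nat q * a}"
    by (intro generate_field_closed mem)
  then have "a \<in> generate_field type_ring {of_nat q * a}" using assms by (simp flip: mult.assoc)
  ultimately show ?thesis using le by blast
qed

text \<open>Every embedding fixes q, and |q|^2 = q^2, so q has weight 2.\<close>

lemma has_weight_of_nat_mult:
  fixes a :: "'a::field_char_0"
  assumes q: "q > 0"
  shows "has_weight q (of_nat q * a) k \<longleftrightarrow> has_weight q a (k - 2)"
proof -
  have "(cmod (\<iota> (of_nat q * a)))\<^sup>2 = real q powi k \<longleftrightarrow> (cmod (\<iota> a))\<^sup>2 = real q powi (k - 2)"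
    if \<iota>: "\<iota> \<in> ring_hom (sub_ring (generate_field type_ring {a})) (type_ring :: complex ring)" for \<iota>
  proof -
    let ?G = "generate_field type_ring {a}"
    have hom: "\<iota> (x + y) = \<iota> x + \<iota> y" "\<iota> (x * y) = \<iota> x * \<iota> y" "\<iota> 1 = 1" if "x \<in> ?G" "y \<in> ?G" for x y
      using \<iota> that by (auto simp: ring_hom_def ring_of_type_algebra_def)
    have G: "of_nat n \<in> ?G" "a \<in> ?G" for n by (intro generate_field_closed, rule generate_field.incl, simp)
    have G01: "0 \<in> ?G" "1 \<in> ?G" using G(1)[of 0] G(1)[of 1] by simp_all
    have "\<iota> 0 = 0" using hom(1)[of 0 0] G01 by simp
    then have "\<iota> (of_nat n) = of_nat n" for n
      by (induction n) (use hom(1)[OF G01(2) G(1)] hom(3)[OF G] in auto)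
    then have "\<iota> (of_nat q * a) = of_nat q * \<iota> a" using hom(2)[OF G] by simp
    then have "(cmod (\<iota> (of_nat q * a)))\<^sup>2 = real q ^ 2 * (cmod (\<iota> a))\<^sup>2"
      by (simp add: norm_mult power_mult_distrib)
    moreover have "real q powi k = real q ^ 2 * real q powi (k - 2)"
      using q by (simp add: power_int_diff)
    ultimately show ?thesis using q by simp
  qed
  then show ?thesis unfolding has_weight_def generate_field_of_nat_mult[OF q] by blast
qed

lemma weight_space_eq_gen_space:
  fixes M :: "'a::{alg_closed_field, field_char_0} ^ 'n ^ 'n::finite"
  shows "weight_space q M k = gen_space M (\<lambda>a. has_weight q a k)"
  unfolding weight_space_def by (rule span_gen_eigenspaces)

lemma pure_weighted_monodromy:
  fixes M N :: "'a::{alg_closed_field, field_char_0} ^ 'n ^ 'n::finite"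
  assumes "pure_of_weight v \<phi> (r, N) w" and q: "residue_card v > 0"
    and MN: "mat (of_nat (residue_card v)) ** r \<phi> ** N = N ** r \<phi>"
  shows "weighted_monodromy (r \<phi>) N (of_nat (residue_card v)) (has_weight (residue_card v)) w"
  using assms
  by unfold_locales (auto simp: pure_of_weight_def weight_space_eq_gen_space has_weight_of_nat_mult)

text \<open>Regards \<open>f\<close> as defined on the copy of its source inside the field into
  which \<open>g\<close> embeds it.\<close>

lemma subring_hom_via_injection:
  fixes g :: "'o::comm_ring_1 \<Rightarrow> 'a::comm_ring_1" and f :: "'o \<Rightarrow> 'b::comm_ring_1"
  assumes g: "inj g" "\<And>x y. g (x + y) = g x + g y" "\<And>x y. g (x * y) = g x * g y" "g 1 = 1"
    and f: "\<And>x y. f (x + y) = f x + f y" "\<And>x y. f (x * y) = f x * f y" "f 1 = 1"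
  shows "subring_hom (range g) (f \<circ> inv_into UNIV g)"
proof -
  have inv [simp]: "inv_into UNIV g (g x) = x" for x using g(1) by (rule inv_f_f)
  have zero: "g 0 = 0" using g(2)[of 0 0] by simp
  have minus: "- g x = g (- x)" for x
    using g(2)[of x "- x"] zero by (metis add.right_inverse minus_unique)
  show ?thesis
  proof
    show "1 \<in> range g" "(f \<circ> inv_into UNIV g) 1 = 1"
      using g(4)[symmetric] f(3) inv[of 1] by (auto simp del: inv)
    fix x assume x: "x \<in> range g"
    then show "- x \<in> range g" by (auto simp: minus)
    fix y assume y: "y \<in> range g"
    obtain a b where ab: "x = g a" "y = g b" using x y by blast
    show "x + y \<in> range g" "x * y \<in> range g" unfolding ab by (auto simp flip: g(2,3))
    show "(f \<circ> inv_into UNIV g) (x + y) = (f \<circ> inv_into UNIV g) x + (f \<circ> inv_into UNIV g) y"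
      "(f \<circ> inv_into UNIV g) (x * y) = (f \<circ> inv_into UNIV g) x * (f \<circ> inv_into UNIV g) y"
      unfolding ab by (simp_all add: f flip: g(2,3))
  qed
qed

lemma matrix_inv_mult:
  assumes "invertible A"
  shows "A ** matrix_inv A = mat 1" "matrix_inv A ** A = mat 1"
  using someI_ex[of "\<lambda>B. A ** B = mat 1 \<and> B ** A = mat 1"] assms
  unfolding invertible_def matrix_inv_def by blast+

text \<open>
  Applied with \<open>g\<close> the embedding into an algebraic closure of the fraction field.
\<close>

lemma weil_deligne_specialization:
  fixes v :: "'k::field alg_closure \<Rightarrow> real"
    and r :: "('k alg_closure \<Rightarrow> 'k alg_closure) \<Rightarrow> 'o::{idom, ring_char_0} ^ 'n ^ 'n::finite"
    and g :: "'o \<Rightarrow> 'a::{alg_closed_field, field_char_0}"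
    and f :: "'o \<Rightarrow> 'b::{alg_closed_field, field_char_0}"
  assumes frob: "local_field_frobenius v \<phi>"
    and wd: "weil_deligne v (r, N)"
    and pure: "pure_of_weight v \<phi> (wd_map f (r, N)) w"
    and g: "inj g" "\<And>x y. g (x + y) = g x + g y" "\<And>x y. g (x * y) = g x * g y" "g 1 = 1"
    and f: "\<And>x y. f (x + y) = f x + f y" "\<And>x y. f (x * y) = f x * f y" "f 1 = 1"
  shows "vec.dim {x \<in> fixed_space (\<lambda>\<sigma>. map_matrix g (r \<sigma>)) (inertia v). map_matrix g N *v x = 0} =
      vec.dim {x \<in> fixed_space (\<lambda>\<sigma>. map_matrix f (r \<sigma>)) (inertia v). map_matrix f N *v x = 0}"
    and "S \<subseteq> inertia v \<Longrightarrow> vec.dim (fixed_space (\<lambda>\<sigma>. map_matrix g (r \<sigma>)) S) =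
      vec.dim (fixed_space (\<lambda>\<sigma>. map_matrix f (r \<sigma>)) S)"
proof -
  interpret local_field_frobenius v \<phi> by fact
  let ?A = "range g" and ?f = "f \<circ> inv_into UNIV g"
  have fA: "subring_hom ?A ?f" by (rule subring_hom_via_injection[OF g f])
  interpret F: subring_hom ?A ?f by (rule fA)
  interpret G: subring_hom "UNIV :: 'o set" g
    by unfold_locales (simp_all add: g)
  have gA: "map_matrix g B $ i $ j \<in> ?A" for B :: "'o ^ 'n ^ 'n" and i j by simp
  have fg: "map_matrix ?f (map_matrix g B) = map_matrix f B" for B :: "'o ^ 'n ^ 'n"
    using g(1) by (simp add: vec_eq_iff)
  have idA: "subring_hom ?A (\<lambda>x. x)"
    by unfold_locales (auto intro: F.minus_mem F.add_mem F.mult_mem)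
  have id: "map_matrix (\<lambda>x. x) B = B" for B :: "'a ^ 'n ^ 'n" by (simp add: vec_eq_iff)
  have inv: "\<And>\<sigma>. \<sigma> \<in> weil_group v \<Longrightarrow> invertible (r \<sigma>)"
    and hom: "\<And>\<sigma> \<tau>. \<lbrakk>\<sigma> \<in> weil_group v; \<tau> \<in> weil_group v\<rbrakk> \<Longrightarrow> r (\<sigma> \<circ> \<tau>) = r \<sigma> ** r \<tau>"
    and op: "openin (weil_topology v) {\<sigma> \<in> weil_group v. r \<sigma> = mat 1}"
    and rel: "\<And>\<sigma>. \<sigma> \<in> weil_group v \<Longrightarrow> map_matrix to_fract (r \<sigma> ** N ** matrix_inv (r \<sigma>)) =
       map_matrix (\<lambda>x. of_nat (residue_card v) powi (- weil_deg v \<sigma>) * to_fract x) N"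
    using wd unfolding weil_deligne_def by auto
  note IW = subsetD[OF inertia_subset_weil_group]
  have idI: "(\<lambda>x. x) \<in> inertia v" by (rule id_inertia)
  \<comment> \<open>Multiplicativity makes this matrix idempotent, and an invertible idempotent is
    the identity.\<close>
  have r1: "r (\<lambda>x. x) = mat 1"
  proof -
    have "r (\<lambda>x. x) ** r (\<lambda>x. x) = r (\<lambda>x. x)" using hom[OF IW[OF idI] IW[OF idI]] by (simp add: comp_def)
    then show ?thesis using inv[OF IW[OF idI]] unfolding invertible_def
      by (metis matrix_mul_assoc matrix_mul_rid)
  qed
  have conj_eq: "r \<sigma> ** N ** matrix_inv (r \<sigma>) ** r \<sigma> = r \<sigma> ** N" if "\<sigma> \<in> weil_group v" for \<sigma>
    using matrix_inv_mult[OF inv[OF that]] by (metis matrix_mul_assoc matrix_mul_rid)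
  have rN: "r \<sigma> ** N = N ** r \<sigma>" if \<sigma>: "\<sigma> \<in> inertia v" for \<sigma>
  proof -
    have "weil_deg v \<sigma> = 0" by (rule weil_degI[OF inertia_acts_as_frob[OF \<sigma>]])
    then have "r \<sigma> ** N ** matrix_inv (r \<sigma>) = N" using rel[OF IW[OF \<sigma>]] by (simp add: vec_eq_iff)
    then show ?thesis using conj_eq[OF IW[OF \<sigma>]] by simp
  qed
  \<comment> \<open>Frobenius has degree 1, so conjugation divides \<open>N\<close> by q.
    Multiplying by q in the fraction field gives an equation that descends to the coefficient ring
    and can be specialized.\<close>
  have MN: "mat (of_nat q) ** r \<phi> ** N = N ** r \<phi>"
  proof -
    have q0: "(of_nat q :: 'o fract) \<noteq> 0" using q_ge_2 by simp
    have "weil_deg v \<phi> = 1" by (rule weil_degI[OF frob])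
    then have "of_nat q * to_fract ((r \<phi> ** N ** matrix_inv (r \<phi>)) $ i $ j) = to_fract (N $ i $ j)" for i j
      using rel[OF frobenius_mem_weil_group] q0
      by (simp add: vec_eq_iff q_def power_int_minus)
    then have "of_nat q * (r \<phi> ** N ** matrix_inv (r \<phi>)) $ i $ j = N $ i $ j" for i j
      by (simp only: to_fract_of_nat[symmetric] to_fract_mult[symmetric] to_fract_eq_iff)
    then have "mat (of_nat q) ** (r \<phi> ** N ** matrix_inv (r \<phi>)) = N"
      by (simp add: vec_eq_iff mat_mult_left)
    then show ?thesis using conj_eq[OF frobenius_mem_weil_group] by (metis matrix_mul_assoc)
  qed
  define H where "H = map_matrix g ` r ` inertia v"
  have HA: "h $ i $ j \<in> ?A" if "h \<in> H" for h i j using that by (auto simp: H_def)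
  have g_mult: "map_matrix g (B ** C) = map_matrix g B ** map_matrix g C" for B C :: "'o ^ 'n ^ 'n"
    by (rule G.map_matrix_mult) auto
  have g_one: "map_matrix g (mat 1 :: 'o ^ 'n ^ 'n) = mat 1"
    using G.map_matrix_mat[of 1] by simp
  have g_inv: "invertible (map_matrix g B)" if "invertible B" for B :: "'o ^ 'n ^ 'n"
    using that unfolding invertible_def by (metis g_mult g_one)
  interpret H: finite_matrix_group H
  proof
    show "finite H" unfolding H_def by (intro finite_imageI finite_image_inertia hom r1 op)
    show "mat 1 \<in> H" unfolding H_def using idI r1 g_one by (metis imageI)
    show "a ** b \<in> H" if ab: "a \<in> H" "b \<in> H" for a b
    proof -
      obtain \<sigma> \<tau> where st: "\<sigma> \<in> inertia v" "\<tau> \<in> inertia v" "a = map_matrix g (r \<sigma>)" "b = map_matrix g (r \<tau>)"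
        using ab by (auto simp: H_def)
      then have "a ** b = map_matrix g (r (\<sigma> \<circ> \<tau>))" by (simp add: g_mult hom IW)
      then show ?thesis using comp_inertia[OF st(1,2)] by (auto simp: H_def)
    qed
    show "invertible h" if "h \<in> H" for h using that g_inv inv IW by (auto simp: H_def)
  qed
  have fixed: "fixed_space (\<lambda>\<sigma>. map_matrix g (r \<sigma>)) S = {x. \<forall>h\<in>map_matrix g ` r ` S. h *v x = x}"
    "fixed_space (\<lambda>\<sigma>. map_matrix f (r \<sigma>)) S = {x. \<forall>h\<in>map_matrix g ` r ` S. map_matrix ?f h *v x = x}" for S
    by (auto simp: fixed_space_def fg)
  show "vec.dim (fixed_space (\<lambda>\<sigma>. map_matrix g (r \<sigma>)) S) = vec.dim (fixed_space (\<lambda>\<sigma>. map_matrix f (r \<sigma>)) S)"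
    if "S \<subseteq> inertia v"
    unfolding fixed by (rule H.dim_fixed_space_map[OF fA HA]) (use that in \<open>auto simp: H_def\<close>)
  let ?M = "map_matrix g (r \<phi>)" and ?N = "map_matrix g N" and ?E = "\<Sum>H"
  have M_inv: "invertible ?M" using g_inv inv frobenius_mem_weil_group by blast
  \<comment> \<open>Single elements of \<open>H\<close> need not commute with the image of
    Frobenius, but conjugation by \<open>\<phi>\<close> permutes inertia, so the sum does.\<close>
  have EM: "?E ** ?M = ?M ** ?E"
  proof (rule H.sum_commute[OF _ M_inv])
    have eq1: "r \<phi> ** r \<sigma> = r (\<phi> \<circ> \<sigma> \<circ> inv_into UNIV \<phi>) ** r \<phi>" if \<sigma>: "\<sigma> \<in> inertia v" for \<sigma>
    proof -
      have "\<phi> \<circ> \<sigma> = \<phi> \<circ> \<sigma> \<circ> inv_into UNIV \<phi> \<circ> \<phi>" by (auto simp: abs_Gal_inv[OF \<phi>])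
      then show ?thesis
        using hom[OF frobenius_mem_weil_group IW[OF \<sigma>]]
          hom[OF IW[OF conj_inertia(1)[OF \<sigma>]] frobenius_mem_weil_group] by simp
    qed
    have eq2: "r \<sigma> ** r \<phi> = r \<phi> ** r (inv_into UNIV \<phi> \<circ> \<sigma> \<circ> \<phi>)" if \<sigma>: "\<sigma> \<in> inertia v" for \<sigma>
    proof -
      have "\<sigma> \<circ> \<phi> = \<phi> \<circ> (inv_into UNIV \<phi> \<circ> \<sigma> \<circ> \<phi>)" by (auto simp: abs_Gal_inv[OF \<phi>])
      then show ?thesis
        using hom[OF IW[OF \<sigma>] frobenius_mem_weil_group]
          hom[OF frobenius_mem_weil_group IW[OF conj_inertia(2)[OF \<sigma>]]] by simp
    qed
    show "(\<lambda>h. ?M ** h) ` H = (\<lambda>h. h ** ?M) ` H"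
    proof (intro subset_antisym image_subsetI)
      fix h assume "h \<in> H"
      then obtain \<sigma> where \<sigma>: "\<sigma> \<in> inertia v" "h = map_matrix g (r \<sigma>)" by (auto simp: H_def)
      show "?M ** h \<in> (\<lambda>h. h ** ?M) ` H"
        by (rule image_eqI[of _ _ "map_matrix g (r (\<phi> \<circ> \<sigma> \<circ> inv_into UNIV \<phi>))"])
          (use \<sigma> eq1[OF \<sigma>(1)] conj_inertia(1)[OF \<sigma>(1)] in \<open>auto simp: H_def simp flip: g_mult\<close>)
      show "h ** ?M \<in> (\<lambda>h. ?M ** h) ` H"
        by (rule image_eqI[of _ _ "map_matrix g (r (inv_into UNIV \<phi> \<circ> \<sigma> \<circ> \<phi>))"])
          (use \<sigma> eq2[OF \<sigma>(1)] conj_inertia(2)[OF \<sigma>(1)] in \<open>auto simp: H_def simp flip: g_mult\<close>)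
    qed
  qed
  have "h ** ?N = ?N ** h" if "h \<in> H" for h
    using that rN by (auto simp: H_def simp flip: g_mult)
  then have EN: "?E ** ?N = ?N ** ?E"
    by (simp add: H.sum_mult H.mult_sum cong: sum.cong)
  have g_MN: "mat (of_nat q) ** ?M ** ?N = ?N ** ?M"
    using MN G.map_matrix_mat[of "of_nat q"] by (metis G.hom_of_nat UNIV_I g_mult)
  have "subring_hom (UNIV :: 'o set) f" by unfold_locales (simp_all add: f)
  then interpret F0: subring_hom "UNIV :: 'o set" f .
  have "map_matrix f (mat (of_nat q) :: 'o ^ 'n ^ 'n) = mat (of_nat q)"
    using F0.map_matrix_mat[of "of_nat q"] by simp
  then have "mat (of_nat q) ** map_matrix f (r \<phi>) ** map_matrix f N = map_matrix f N ** map_matrix f (r \<phi>)"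
    using arg_cong[OF MN, of "map_matrix f"] by (simp add: F0.map_matrix_mult)
  then have wm: "weighted_monodromy (map_matrix ?f ?M) (map_matrix ?f ?N) (of_nat q) (has_weight q) w"
    using pure_weighted_monodromy[of v \<phi> "\<lambda>\<sigma>. map_matrix f (r \<sigma>)" "map_matrix f N" w] pure q_ge_2
    by (simp add: wd_map_def fg q_def)
  have EA: "?E $ i $ j \<in> ?A" for i j using HA by (auto intro: F.sum_mem)
  have "vec.dim {x. ?E *v x = of_nat (card H) *s x \<and> ?N *v x = 0} =
    vec.dim {x. map_matrix ?f ?E *v x = of_nat (card H) *s x \<and> map_matrix ?f ?N *v x = 0}"
    by (rule dim_kernel_specialization[OF fA gA gA EA H.quasi_idempotent_sum EM EN g_MN wm])
  moreover have "fixed_space (\<lambda>\<sigma>. map_matrix g (r \<sigma>)) (inertia v) = {x. ?E *v x = of_nat (card H) *s x}"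
    using H.fixed_space_eq_ker[OF idA HA] by (simp add: fixed id flip: H_def)
  moreover have "fixed_space (\<lambda>\<sigma>. map_matrix f (r \<sigma>)) (inertia v) =
      {x. map_matrix ?f ?E *v x = of_nat (card H) *s x}"
    using H.fixed_space_eq_ker[OF fA HA] by (simp only: fixed flip: H_def)
  ultimately show "vec.dim {x \<in> fixed_space (\<lambda>\<sigma>. map_matrix g (r \<sigma>)) (inertia v). ?N *v x = 0} =
      vec.dim {x \<in> fixed_space (\<lambda>\<sigma>. map_matrix f (r \<sigma>)) (inertia v). map_matrix f N *v x = 0}"
    by (simp add: fg)
qed

theorem theorem3p1:
  fixes p l :: nat
    and abs_p :: "'qp::field_char_0 \<Rightarrow> real"
    and abs_l :: "'ql::field_char_0 \<Rightarrow> real"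
    and j :: "'ql \<Rightarrow> 'k::field"
    and v :: "'k alg_closure \<Rightarrow> real"
    and \<phi> :: "'k alg_closure \<Rightarrow> 'k alg_closure"
    and \<rho> :: "('k, 'o::{idom, ring_char_0}, 'n::finite) wd"
    and f :: "'o \<Rightarrow> 'qp alg_closure"
  assumes "Factorial_Ring.prime p" "Factorial_Ring.prime l" "p \<noteq> l"
    and "padic_field p abs_p" "padic_field l abs_l"
    and "finite_extension j"
    and "nonarch_abs v" "\<forall>x. v (to_ac (j x)) = abs_l x"
    and "\<phi> \<in> abs_Gal" "acts_as_frob v \<phi> 1"
    and "\<exists>h. h \<in> ring_hom (type_ring :: rat ring) (type_ring :: 'o ring)"
    and "weil_deligne v \<rho>"
    and "f \<in> ring_hom type_ring type_ring"
    and "wd_pure v \<phi> (wd_map f \<rho>)"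
  shows "conductor v (wd_map f \<rho>) = conductor v (wd_map (to_ac \<circ> to_fract) \<rho>)"
proof -
  obtain r N where \<rho>: "\<rho> = (r, N)" by (cases \<rho>)
  obtain w where pure: "pure_of_weight v \<phi> (wd_map f (r, N)) w"
    using assms(14) by (auto simp: wd_pure_def \<rho>)
  have frob: "local_field_frobenius v \<phi>"
    using assms(7,9,10) by unfold_locales
  interpret local_field v l abs_l j
    using assms(2,5-8) by unfold_locales auto
  let ?g = "to_ac \<circ> to_fract :: 'o \<Rightarrow> 'o fract alg_closure"
  have g: "inj ?g" "\<And>x y. ?g (x + y) = ?g x + ?g y" "\<And>x y. ?g (x * y) = ?g x * ?g y" "?g 1 = 1"
    by (auto simp: inj_def)
  have f: "f (x + y) = f x + f y" "f (x * y) = f x * f y" "f 1 = 1" for x y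
    using assms(13) by (auto simp: ring_hom_def ring_of_type_algebra_def)
  note spec = weil_deligne_specialization[OF frob assms(12)[unfolded \<rho>] pure g f]
  \<comment> \<open>The integral runs over u >= 0, where the ramification groups are subsets of
    inertia.\<close>
  have "codim (fixed_space (\<lambda>\<sigma>. map_matrix f (r \<sigma>)) (abs_ram_upper v u)) =
    codim (fixed_space (\<lambda>\<sigma>. map_matrix ?g (r \<sigma>)) (abs_ram_upper v u))" if "0 \<le> u" for u
    using spec(2)[OF abs_ram_upper_subset_inertia[OF that]] by (simp only: codim_def)
  then have "integral {0..} (\<lambda>u. real (codim (fixed_space (\<lambda>\<sigma>. map_matrix f (r \<sigma>)) (abs_ram_upper v u)))) =
    integral {0..} (\<lambda>u. real (codim (fixed_space (\<lambda>\<sigma>. map_matrix ?g (r \<sigma>)) (abs_ram_upper v u))))"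
    by (intro integral_cong) simp
  moreover have "codim {x \<in> fixed_space (\<lambda>\<sigma>. map_matrix f (r \<sigma>)) (inertia v). map_matrix f N *v x = 0} =
    codim {x \<in> fixed_space (\<lambda>\<sigma>. map_matrix ?g (r \<sigma>)) (inertia v). map_matrix ?g N *v x = 0}"
    using spec(1) by (simp only: codim_def)
  ultimately show ?thesis unfolding \<rho> conductor_def wd_map_def by simp
qed

end
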